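(* Let $\mathcal{C}$ be a triangulated category admitting a generator. Then there is a bijection between the set of localizing prime rank functions on $\mathcal{C}$ and the set of thick subcategories $\tau$ of $\mathcal{C}$ such that the Verdier quotient $\mathcal{C}/\tau$ is a simple triangulated category.
   Context: A generator of $\mathcal{C}$ is an object $X$ such that the smallest thick subcategory of $\mathcal{C}$ containing $X$ is $\mathcal{C}$. A rank function on $\mathcal{C}$ (with translation $\Sigma$) assigns to each morphism $f$ a real number $\rho(f)\geq0$ such that $\rho(\Sigma f)=\rho(f)$, $\rho(f\oplus g)=\rho(f)+\rho(g)$, and $\rho(f)+\rho(g)=\rho(\mathrm{id}_Y)$ for every exact triangle $X\xrightarrow{f}Y\xrightarrow{g}Z\rightsquigarrow$; write $\rho(X)=\rho(\mathrm{id}_X)$. It is integral if all values lie in $\mathbb{Z}$, and prime if it is integral and $\mathcal{C}$ admits a generator $X$ with $\rho(X)=1$. An integral rank function is localizing if every morphism $f$ with $\rho(f)=0$ factors through an object $Z$ with $\rho(Z)=0$. A triangulated category is simple if every exact triangle in it is split (isomorphic to a direct sum of triangles each having an isomorphism as one of its arrows) and it is generated as a triangulated category by one nonzero indecomposable object. *)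

theory Defs
  imports Main "HOL.Real"
begin

text \<open>A category with objects t_ob, morphisms t_mor, domain/codomain maps,
composition t_comp g f (= g o f), identities, the additive structure on hom-sets
(addition, negation, zero morphisms), the translation functor (on objects and
morphisms) and the class of exact (distinguished) triangles (f, g, h) with
f : X -> Y, g : Y -> Z, h : Z -> Sigma X.\<close>

record ('o, 'm) tricat =
  t_ob   :: "'o set"
  t_mor  :: "'m set"
  t_dom  :: "'m \<Rightarrow> 'o"
  t_cod  :: "'m \<Rightarrow> 'o"
  t_comp :: "'m \<Rightarrow> 'm \<Rightarrow> 'm"
  t_id   :: "'o \<Rightarrow> 'm"
  t_add  :: "'m \<Rightarrow> 'm \<Rightarrow> 'm"
  t_neg  :: "'m \<Rightarrow> 'm"
  t_zero :: "'o \<Rightarrow> 'o \<Rightarrow> 'm"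
  t_shO  :: "'o \<Rightarrow> 'o"
  t_shM  :: "'m \<Rightarrow> 'm"
  t_tri  :: "('m \<times> 'm \<times> 'm) set"

definition hom :: "('o,'m,'x) tricat_scheme \<Rightarrow> 'o \<Rightarrow> 'o \<Rightarrow> 'm set" where
  "hom C X Y = {f \<in> t_mor C. t_dom C f = X \<and> t_cod C f = Y}"

definition category_ax :: "('o,'m,'x) tricat_scheme \<Rightarrow> bool" where
  "category_ax C \<longleftrightarrow>
     (\<forall>f\<in>t_mor C. t_dom C f \<in> t_ob C \<and> t_cod C f \<in> t_ob C) \<and>
     (\<forall>X\<in>t_ob C. t_id C X \<in> hom C X X) \<and>
     (\<forall>X\<in>t_ob C. \<forall>Y\<in>t_ob C. \<forall>Z\<in>t_ob C. \<forall>f\<in>hom C X Y. \<forall>g\<in>hom C Y Z.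
        t_comp C g f \<in> hom C X Z) \<and>
     (\<forall>f\<in>t_mor C. t_comp C f (t_id C (t_dom C f)) = f \<and> t_comp C (t_id C (t_cod C f)) f = f) \<and>
     (\<forall>f\<in>t_mor C. \<forall>g\<in>t_mor C. \<forall>h\<in>t_mor C.
        t_cod C f = t_dom C g \<longrightarrow> t_cod C g = t_dom C h \<longrightarrow>
        t_comp C h (t_comp C g f) = t_comp C (t_comp C h g) f)"

definition preadditive_ax :: "('o,'m,'x) tricat_scheme \<Rightarrow> bool" where
  "preadditive_ax C \<longleftrightarrow>
     (\<forall>X\<in>t_ob C. \<forall>Y\<in>t_ob C.
        t_zero C X Y \<in> hom C X Y \<and>
        (\<forall>f\<in>hom C X Y. \<forall>g\<in>hom C X Y. t_add C f g \<in> hom C X Y) \<and>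
        (\<forall>f\<in>hom C X Y. t_neg C f \<in> hom C X Y) \<and>
        (\<forall>f\<in>hom C X Y. \<forall>g\<in>hom C X Y. \<forall>h\<in>hom C X Y.
            t_add C (t_add C f g) h = t_add C f (t_add C g h)) \<and>
        (\<forall>f\<in>hom C X Y. \<forall>g\<in>hom C X Y. t_add C f g = t_add C g f) \<and>
        (\<forall>f\<in>hom C X Y. t_add C f (t_zero C X Y) = f) \<and>
        (\<forall>f\<in>hom C X Y. t_add C f (t_neg C f) = t_zero C X Y)) \<and>
     (\<forall>X\<in>t_ob C. \<forall>Y\<in>t_ob C. \<forall>Z\<in>t_ob C.
        \<forall>f\<in>hom C X Y. \<forall>f'\<in>hom C X Y. \<forall>g\<in>hom C Y Z. \<forall>g'\<in>hom C Y Z.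
          t_comp C g (t_add C f f') = t_add C (t_comp C g f) (t_comp C g f') \<and>
          t_comp C (t_add C g g') f = t_add C (t_comp C g f) (t_comp C g' f))"

definition zero_obj :: "('o,'m,'x) tricat_scheme \<Rightarrow> 'o \<Rightarrow> bool" where
  "zero_obj C Z \<longleftrightarrow> Z \<in> t_ob C \<and>
     (\<forall>X\<in>t_ob C. (\<forall>f\<in>hom C Z X. f = t_zero C Z X) \<and> (\<forall>f\<in>hom C X Z. f = t_zero C X Z))"

definition is_biprod :: "('o,'m,'x) tricat_scheme \<Rightarrow> 'o \<Rightarrow> 'o \<Rightarrow> 'o \<Rightarrow> 'm \<Rightarrow> 'm \<Rightarrow> 'm \<Rightarrow> 'm \<Rightarrow> bool" where
  "is_biprod C A B S i1 i2 p1 p2 \<longleftrightarrow>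
     A \<in> t_ob C \<and> B \<in> t_ob C \<and> S \<in> t_ob C \<and>
     i1 \<in> hom C A S \<and> i2 \<in> hom C B S \<and> p1 \<in> hom C S A \<and> p2 \<in> hom C S B \<and>
     t_comp C p1 i1 = t_id C A \<and> t_comp C p2 i2 = t_id C B \<and>
     t_comp C p2 i1 = t_zero C A B \<and> t_comp C p1 i2 = t_zero C B A \<and>
     t_add C (t_comp C i1 p1) (t_comp C i2 p2) = t_id C S"

definition additive_ax :: "('o,'m,'x) tricat_scheme \<Rightarrow> bool" where
  "additive_ax C \<longleftrightarrow> preadditive_ax C \<and> (\<exists>Z. zero_obj C Z) \<and>
     (\<forall>A\<in>t_ob C. \<forall>B\<in>t_ob C. \<exists>S i1 i2 p1 p2. is_biprod C A B S i1 i2 p1 p2)"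

definition iso_mor :: "('o,'m,'x) tricat_scheme \<Rightarrow> 'm \<Rightarrow> bool" where
  "iso_mor C f \<longleftrightarrow> f \<in> t_mor C \<and>
     (\<exists>g\<in>hom C (t_cod C f) (t_dom C f).
        t_comp C g f = t_id C (t_dom C f) \<and> t_comp C f g = t_id C (t_cod C f))"

definition isomorphic :: "('o,'m,'x) tricat_scheme \<Rightarrow> 'o \<Rightarrow> 'o \<Rightarrow> bool" where
  "isomorphic C X Y \<longleftrightarrow> (\<exists>f\<in>hom C X Y. iso_mor C f)"

definition shift_ax :: "('o,'m,'x) tricat_scheme \<Rightarrow> bool" where
  "shift_ax C \<longleftrightarrow>
     (\<forall>X\<in>t_ob C. t_shO C X \<in> t_ob C \<and> t_shM C (t_id C X) = t_id C (t_shO C X)) \<and>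
     (\<forall>X\<in>t_ob C. \<forall>Y\<in>t_ob C.
        bij_betw (t_shM C) (hom C X Y) (hom C (t_shO C X) (t_shO C Y)) \<and>
        (\<forall>f\<in>hom C X Y. \<forall>g\<in>hom C X Y. t_shM C (t_add C f g) = t_add C (t_shM C f) (t_shM C g))) \<and>
     (\<forall>f\<in>t_mor C. \<forall>g\<in>t_mor C. t_cod C f = t_dom C g \<longrightarrow>
        t_shM C (t_comp C g f) = t_comp C (t_shM C g) (t_shM C f)) \<and>
     (\<forall>Y\<in>t_ob C. \<exists>X\<in>t_ob C. isomorphic C (t_shO C X) Y)"

definition is_triangle :: "('o,'m,'x) tricat_scheme \<Rightarrow> 'm \<times> 'm \<times> 'm \<Rightarrow> bool" where
  "is_triangle C T \<longleftrightarrow> (case T of (f, g, h) \<Rightarrow>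
     f \<in> t_mor C \<and> g \<in> t_mor C \<and> h \<in> t_mor C \<and>
     t_cod C f = t_dom C g \<and> t_cod C g = t_dom C h \<and> t_cod C h = t_shO C (t_dom C f))"

definition tri_morph :: "('o,'m,'x) tricat_scheme \<Rightarrow> 'm \<times> 'm \<times> 'm \<Rightarrow> 'm \<times> 'm \<times> 'm \<Rightarrow> 'm \<Rightarrow> 'm \<Rightarrow> 'm \<Rightarrow> bool" where
  "tri_morph C T T' a b c \<longleftrightarrow> (case T of (f, g, h) \<Rightarrow> case T' of (f', g', h') \<Rightarrow>
     a \<in> hom C (t_dom C f) (t_dom C f') \<and> b \<in> hom C (t_dom C g) (t_dom C g') \<and>
     c \<in> hom C (t_dom C h) (t_dom C h') \<and>
     t_comp C b f = t_comp C f' a \<and> t_comp C c g = t_comp C g' b \<and>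
     t_comp C (t_shM C a) h = t_comp C h' c)"

definition tri_iso :: "('o,'m,'x) tricat_scheme \<Rightarrow> 'm \<times> 'm \<times> 'm \<Rightarrow> 'm \<times> 'm \<times> 'm \<Rightarrow> bool" where
  "tri_iso C T T' \<longleftrightarrow> is_triangle C T \<and> is_triangle C T' \<and>
     (\<exists>a b c. tri_morph C T T' a b c \<and> iso_mor C a \<and> iso_mor C b \<and> iso_mor C c)"

definition TR1 :: "('o,'m,'x) tricat_scheme \<Rightarrow> bool" where
  "TR1 C \<longleftrightarrow>
     (\<forall>T\<in>t_tri C. is_triangle C T) \<and>
     (\<forall>T\<in>t_tri C. \<forall>T'. tri_iso C T T' \<longrightarrow> T' \<in> t_tri C) \<and>
     (\<forall>X\<in>t_ob C. \<forall>Z. zero_obj C Z \<longrightarrow>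
        (t_id C X, t_zero C X Z, t_zero C Z (t_shO C X)) \<in> t_tri C) \<and>
     (\<forall>f\<in>t_mor C. \<exists>g h. (f, g, h) \<in> t_tri C)"

definition TR2 :: "('o,'m,'x) tricat_scheme \<Rightarrow> bool" where
  "TR2 C \<longleftrightarrow> (\<forall>f g h. is_triangle C (f, g, h) \<longrightarrow>
     ((f, g, h) \<in> t_tri C \<longleftrightarrow> (g, h, t_neg C (t_shM C f)) \<in> t_tri C))"

definition TR3 :: "('o,'m,'x) tricat_scheme \<Rightarrow> bool" where
  "TR3 C \<longleftrightarrow> (\<forall>f g h f' g' h' a b.
     (f, g, h) \<in> t_tri C \<longrightarrow> (f', g', h') \<in> t_tri C \<longrightarrow>
     a \<in> hom C (t_dom C f) (t_dom C f') \<longrightarrow> b \<in> hom C (t_dom C g) (t_dom C g') \<longrightarrow>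
     t_comp C b f = t_comp C f' a \<longrightarrow>
     (\<exists>c. tri_morph C (f, g, h) (f', g', h') a b c))"

text \<open>Octahedral axiom (as in the Stacks project, TR4).\<close>
definition TR4 :: "('o,'m,'x) tricat_scheme \<Rightarrow> bool" where
  "TR4 C \<longleftrightarrow> (\<forall>f g u u' v v' w w'.
     (f, u, u') \<in> t_tri C \<longrightarrow> (g, v, v') \<in> t_tri C \<longrightarrow>
     (t_comp C g f, w, w') \<in> t_tri C \<longrightarrow> t_cod C f = t_dom C g \<longrightarrow>
     (\<exists>a b. (a, b, t_comp C (t_shM C u) v') \<in> t_tri C \<and>
        t_comp C a u = t_comp C w g \<and> t_comp C w' a = u' \<and>
        t_comp C b w = v \<and> t_comp C v' b = t_comp C (t_shM C f) w'))"

definition triangulated :: "('o,'m,'x) tricat_scheme \<Rightarrow> bool" where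
  "triangulated C \<longleftrightarrow> category_ax C \<and> additive_ax C \<and> shift_ax C \<and>
     TR1 C \<and> TR2 C \<and> TR3 C \<and> TR4 C"

text \<open>Full triangulated subcategories (given by their object sets; replete).\<close>
definition tri_subcat :: "('o,'m,'x) tricat_scheme \<Rightarrow> 'o set \<Rightarrow> bool" where
  "tri_subcat C S \<longleftrightarrow> S \<subseteq> t_ob C \<and> S \<noteq> {} \<and>
     (\<forall>X\<in>S. \<forall>Y. isomorphic C X Y \<longrightarrow> Y \<in> S) \<and>
     (\<forall>X\<in>t_ob C. X \<in> S \<longleftrightarrow> t_shO C X \<in> S) \<and>
     (\<forall>f g h. (f, g, h) \<in> t_tri C \<longrightarrow>
        (let X = t_dom C f; Y = t_dom C g; Z = t_dom C h in
          (X \<in> S \<and> Y \<in> S \<longrightarrow> Z \<in> S) \<and> (X \<in> S \<and> Z \<in> S \<longrightarrow> Y \<in> S) \<and>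
          (Y \<in> S \<and> Z \<in> S \<longrightarrow> X \<in> S)))"

definition thick :: "('o,'m,'x) tricat_scheme \<Rightarrow> 'o set \<Rightarrow> bool" where
  "thick C S \<longleftrightarrow> tri_subcat C S \<and>
     (\<forall>A B X i1 i2 p1 p2. is_biprod C A B X i1 i2 p1 p2 \<longrightarrow> X \<in> S \<longrightarrow> A \<in> S \<and> B \<in> S)"

definition generator :: "('o,'m,'x) tricat_scheme \<Rightarrow> 'o \<Rightarrow> bool" where
  "generator C X \<longleftrightarrow> X \<in> t_ob C \<and> (\<forall>S. thick C S \<and> X \<in> S \<longrightarrow> S = t_ob C)"

definition rank_fun :: "('o,'m,'x) tricat_scheme \<Rightarrow> ('m \<Rightarrow> real) \<Rightarrow> bool" where
  "rank_fun C \<rho> \<longleftrightarrow>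
     (\<forall>f\<in>t_mor C. \<rho> f \<ge> 0) \<and>
     (\<forall>f\<in>t_mor C. \<rho> (t_shM C f) = \<rho> f) \<and>
     (\<forall>A B S i1 i2 p1 p2 A' B' S' j1 j2 q1 q2 f g.
        is_biprod C A B S i1 i2 p1 p2 \<longrightarrow> is_biprod C A' B' S' j1 j2 q1 q2 \<longrightarrow>
        f \<in> hom C A A' \<longrightarrow> g \<in> hom C B B' \<longrightarrow>
        \<rho> (t_add C (t_comp C j1 (t_comp C f p1)) (t_comp C j2 (t_comp C g p2))) = \<rho> f + \<rho> g) \<and>
     (\<forall>f g h. (f, g, h) \<in> t_tri C \<longrightarrow> \<rho> f + \<rho> g = \<rho> (t_id C (t_cod C f)))"

definition integral_rank :: "('o,'m,'x) tricat_scheme \<Rightarrow> ('m \<Rightarrow> real) \<Rightarrow> bool" where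
  "integral_rank C \<rho> \<longleftrightarrow> rank_fun C \<rho> \<and> (\<forall>f\<in>t_mor C. \<rho> f \<in> \<int>)"

definition prime_rank :: "('o,'m,'x) tricat_scheme \<Rightarrow> ('m \<Rightarrow> real) \<Rightarrow> bool" where
  "prime_rank C \<rho> \<longleftrightarrow> integral_rank C \<rho> \<and> (\<exists>X. generator C X \<and> \<rho> (t_id C X) = 1)"

definition localizing_rank :: "('o,'m,'x) tricat_scheme \<Rightarrow> ('m \<Rightarrow> real) \<Rightarrow> bool" where
  "localizing_rank C \<rho> \<longleftrightarrow> integral_rank C \<rho> \<and>
     (\<forall>f\<in>t_mor C. \<rho> f = 0 \<longrightarrow>
        (\<exists>Z\<in>t_ob C. \<rho> (t_id C Z) = 0 \<and>
          (\<exists>u\<in>hom C (t_dom C f) Z. \<exists>v\<in>hom C Z (t_cod C f). f = t_comp C v u)))"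

text \<open>Rank functions are functions on morphisms; as HOL functions they are
normalised to be 0 outside the morphism set.\<close>
definition loc_prime_ranks :: "('o,'m,'x) tricat_scheme \<Rightarrow> ('m \<Rightarrow> real) set" where
  "loc_prime_ranks C = {\<rho>. localizing_rank C \<rho> \<and> prime_rank C \<rho> \<and> (\<forall>f. f \<notin> t_mor C \<longrightarrow> \<rho> f = 0)}"

definition cone_in :: "('o,'m,'x) tricat_scheme \<Rightarrow> 'o set \<Rightarrow> 'm \<Rightarrow> bool" where
  "cone_in C S s \<longleftrightarrow> (\<exists>g h. (s, g, h) \<in> t_tri C \<and> t_cod C g \<in> S)"

definition roofs :: "('o,'m,'x) tricat_scheme \<Rightarrow> 'o set \<Rightarrow> 'o \<Rightarrow> 'o \<Rightarrow> ('m \<times> 'm) set" where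
  "roofs C S X Y = {(s, f). s \<in> t_mor C \<and> f \<in> t_mor C \<and> t_cod C s = X \<and>
      t_dom C f = t_dom C s \<and> t_cod C f = Y \<and> cone_in C S s}"

definition roof_eq :: "('o,'m,'x) tricat_scheme \<Rightarrow> 'o set \<Rightarrow> 'm \<times> 'm \<Rightarrow> 'm \<times> 'm \<Rightarrow> bool" where
  "roof_eq C S r r' \<longleftrightarrow> (case r of (s, f) \<Rightarrow> case r' of (t, g) \<Rightarrow>
     (\<exists>u v. u \<in> t_mor C \<and> v \<in> t_mor C \<and> t_cod C u = t_dom C s \<and> t_cod C v = t_dom C t \<and>
        t_dom C u = t_dom C v \<and> t_comp C s u = t_comp C t v \<and> cone_in C S (t_comp C s u) \<and>
        t_comp C f u = t_comp C g v))"

definition qclass :: "('o,'m,'x) tricat_scheme \<Rightarrow> 'o set \<Rightarrow> 'm \<times> 'm \<Rightarrow> ('m \<times> 'm) set" where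
  "qclass C S r = {r'. r' \<in> roofs C S (t_cod C (fst r)) (t_cod C (snd r)) \<and> roof_eq C S r r'}"

definition q_mor :: "('o,'m,'x) tricat_scheme \<Rightarrow> 'o set \<Rightarrow> ('m \<times> 'm) set set" where
  "q_mor C S = {qclass C S r | r X Y. X \<in> t_ob C \<and> Y \<in> t_ob C \<and> r \<in> roofs C S X Y}"

definition q_dom :: "('o,'m,'x) tricat_scheme \<Rightarrow> ('m \<times> 'm) set \<Rightarrow> 'o" where
  "q_dom C \<alpha> = t_cod C (fst (SOME r. r \<in> \<alpha>))"

definition q_cod :: "('o,'m,'x) tricat_scheme \<Rightarrow> ('m \<times> 'm) set \<Rightarrow> 'o" where
  "q_cod C \<alpha> = t_cod C (snd (SOME r. r \<in> \<alpha>))"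

text \<open>Composition beta o alpha: [t,g] o [s,f] = [s o u, g o h] where f o u = t o h,
cone of u in S (well defined by the Ore conditions).\<close>
definition q_comp :: "('o,'m,'x) tricat_scheme \<Rightarrow> 'o set \<Rightarrow> ('m \<times> 'm) set \<Rightarrow> ('m \<times> 'm) set \<Rightarrow> ('m \<times> 'm) set" where
  "q_comp C S \<beta> \<alpha> = \<Union> {qclass C S (t_comp C s u, t_comp C g h) | s f t g u h.
      (s, f) \<in> \<alpha> \<and> (t, g) \<in> \<beta> \<and> u \<in> t_mor C \<and> h \<in> t_mor C \<and>
      t_cod C u = t_dom C s \<and> t_dom C h = t_dom C u \<and> t_cod C h = t_dom C t \<and>
      t_comp C f u = t_comp C t h \<and> cone_in C S u}"

definition q_add :: "('o,'m,'x) tricat_scheme \<Rightarrow> 'o set \<Rightarrow> ('m \<times> 'm) set \<Rightarrow> ('m \<times> 'm) set \<Rightarrow> ('m \<times> 'm) set" where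
  "q_add C S \<alpha> \<beta> = \<Union> {qclass C S (t_comp C s u, t_add C (t_comp C f u) (t_comp C g v)) | s f t g u v.
      (s, f) \<in> \<alpha> \<and> (t, g) \<in> \<beta> \<and> u \<in> t_mor C \<and> v \<in> t_mor C \<and>
      t_cod C u = t_dom C s \<and> t_cod C v = t_dom C t \<and> t_dom C u = t_dom C v \<and>
      t_comp C s u = t_comp C t v \<and> cone_in C S (t_comp C s u)}"

definition q_neg :: "('o,'m,'x) tricat_scheme \<Rightarrow> 'o set \<Rightarrow> ('m \<times> 'm) set \<Rightarrow> ('m \<times> 'm) set" where
  "q_neg C S \<alpha> = \<Union> {qclass C S (s, t_neg C f) | s f. (s, f) \<in> \<alpha>}"

definition q_shM :: "('o,'m,'x) tricat_scheme \<Rightarrow> 'o set \<Rightarrow> ('m \<times> 'm) set \<Rightarrow> ('m \<times> 'm) set" where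
  "q_shM C S \<alpha> = \<Union> {qclass C S (t_shM C s, t_shM C f) | s f. (s, f) \<in> \<alpha>}"

definition q_fun :: "('o,'m,'x) tricat_scheme \<Rightarrow> 'o set \<Rightarrow> 'm \<Rightarrow> ('m \<times> 'm) set" where
  "q_fun C S f = qclass C S (t_id C (t_dom C f), f)"

definition verdier_pre :: "('o,'m,'x) tricat_scheme \<Rightarrow> 'o set \<Rightarrow> ('o, ('m \<times> 'm) set) tricat" where
  "verdier_pre C S = \<lparr> t_ob = t_ob C, t_mor = q_mor C S, t_dom = q_dom C, t_cod = q_cod C,
     t_comp = q_comp C S, t_id = (\<lambda>X. q_fun C S (t_id C X)), t_add = q_add C S,
     t_neg = q_neg C S, t_zero = (\<lambda>X Y. q_fun C S (t_zero C X Y)),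
     t_shO = t_shO C, t_shM = q_shM C S, t_tri = {} \<rparr>"

definition verdier :: "('o,'m,'x) tricat_scheme \<Rightarrow> 'o set \<Rightarrow> ('o, ('m \<times> 'm) set) tricat" where
  "verdier C S = (verdier_pre C S) \<lparr> t_tri :=
     {T'. \<exists>f g h. (f, g, h) \<in> t_tri C \<and>
        tri_iso (verdier_pre C S) (q_fun C S f, q_fun C S g, q_fun C S h) T'} \<rparr>"

definition tri_sum :: "('o,'m,'x) tricat_scheme \<Rightarrow> 'm \<times> 'm \<times> 'm \<Rightarrow> 'm \<times> 'm \<times> 'm \<Rightarrow> 'm \<times> 'm \<times> 'm \<Rightarrow> bool" where
  "tri_sum C T1 T2 T \<longleftrightarrow> is_triangle C T1 \<and> is_triangle C T2 \<and> is_triangle C T \<and>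
     (case T1 of (f1, g1, h1) \<Rightarrow> case T2 of (f2, g2, h2) \<Rightarrow> case T of (f, g, h) \<Rightarrow>
      (\<exists>a1 a2 b1 b2 c1 c2 x1 x2 y1 y2 z1 z2.
        is_biprod C (t_dom C f1) (t_dom C f2) (t_dom C f) a1 a2 x1 x2 \<and>
        is_biprod C (t_dom C g1) (t_dom C g2) (t_dom C g) b1 b2 y1 y2 \<and>
        is_biprod C (t_dom C h1) (t_dom C h2) (t_dom C h) c1 c2 z1 z2 \<and>
        f = t_add C (t_comp C b1 (t_comp C f1 x1)) (t_comp C b2 (t_comp C f2 x2)) \<and>
        g = t_add C (t_comp C c1 (t_comp C g1 y1)) (t_comp C c2 (t_comp C g2 y2)) \<and>
        h = t_add C (t_comp C (t_shM C a1) (t_comp C h1 z1)) (t_comp C (t_shM C a2) (t_comp C h2 z2))))"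

inductive split_tri :: "('o,'m,'x) tricat_scheme \<Rightarrow> 'm \<times> 'm \<times> 'm \<Rightarrow> bool" for C where
  split_base: "is_triangle C (f, g, h) \<Longrightarrow> iso_mor C f \<or> iso_mor C g \<or> iso_mor C h
      \<Longrightarrow> split_tri C (f, g, h)"
| split_sum: "split_tri C T1 \<Longrightarrow> split_tri C T2 \<Longrightarrow> tri_sum C T1 T2 T' \<Longrightarrow> tri_iso C T' T
      \<Longrightarrow> split_tri C T"

definition indecomposable :: "('o,'m,'x) tricat_scheme \<Rightarrow> 'o \<Rightarrow> bool" where
  "indecomposable C X \<longleftrightarrow> X \<in> t_ob C \<and> \<not> zero_obj C X \<and>
     (\<forall>A B i1 i2 p1 p2. is_biprod C A B X i1 i2 p1 p2 \<longrightarrow> zero_obj C A \<or> zero_obj C B)"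

definition simple_tricat :: "('o,'m,'x) tricat_scheme \<Rightarrow> bool" where
  "simple_tricat C \<longleftrightarrow> (\<forall>T\<in>t_tri C. split_tri C T) \<and>
     (\<exists>X. indecomposable C X \<and> (\<forall>S. tri_subcat C S \<and> X \<in> S \<longrightarrow> S = t_ob C))"

end

theory Submission
  imports Defs
begin

text \<open>A rank function \<open>\<rho>\<close> is sent to its kernel \<open>\<tau>\<close>, the objects of rank zero. The rank identities of
  a triangle and its rotations show that \<open>\<rho>\<close> is determined by its values on objects.

  If \<open>\<rho>\<close> is localizing and prime, a nonzero morphism of the quotient has nonzero rank. So an object of
  rank one only has split monomorphisms and zero morphisms leaving it, and only split epimorphisms and
  zero morphisms entering it. As a generator of rank one detects nonzero objects, every object of the
  quotient is exhausted by splitting off summands of rank one, and so is every morphism. Hence all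
  triangles split. The same argument with two rank functions of the same kernel shows that they agree.

  Conversely, if the quotient is simple, each object has a finite filtration whose steps are shifts of
  the indecomposable generator. Its length is unique by an exchange argument, and this length, extended
  to morphisms by the identity above, is the wanted rank function.\<close>

section \<open>Additive categories with a shift\<close>

text \<open>The quotient is handled only as an additive category with a shift; this locale is what
  it shares with the given category. Arguments about triangles take place in the given category, and
  exactness lemmas for images of its triangles carry the results over.

  Why objects of rank one split: a morphism out of or into one that survives in the quotient has a
  nonzero integral rank bounded by one. The rank identities then leave rank zero for the next or
  previous map of its triangle. That map dies in the quotient, so the morphism is a split
  monomorphism or a split epimorphism there.

  Why length gives a rank: coning off a shift of the indecomposable generator adds one to the length
  if the attaching map dies in the quotient, and removes one otherwise. So the length of a cone is
  at most the sum of the two lengths and has the same parity, which makes half the difference a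
  nonnegative integer. The bound is attained only if the morphism dies, and that is the localizing
  property.\<close>

locale additive_shift_category =
  fixes K :: "('o,'m,'x) tricat_scheme"
  assumes cat: "category_ax K" and addt: "additive_ax K" and shft: "shift_ax K"
begin

abbreviation arr where "arr f \<equiv> f \<in> t_mor K"
abbreviation ob where "ob X \<equiv> X \<in> t_ob K"
abbreviation dm where "dm \<equiv> t_dom K"
abbreviation cd where "cd \<equiv> t_cod K"
abbreviation cmp (infixr "\<cdot>" 70) where "g \<cdot> f \<equiv> t_comp K g f"
abbreviation one where "one \<equiv> t_id K"
abbreviation pls (infixl "\<oplus>" 65) where "f \<oplus> g \<equiv> t_add K f g"
abbreviation mns where "mns \<equiv> t_neg K"
abbreviation nul where "nul \<equiv> t_zero K"
abbreviation So where "So \<equiv> t_shO K"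
abbreviation Sh where "Sh \<equiv> t_shM K"

lemma hom_iff: "f \<in> hom K X Y \<longleftrightarrow> arr f \<and> dm f = X \<and> cd f = Y"
  by (auto simp: hom_def)

lemma preadd: "preadditive_ax K"
  using addt by (simp add: additive_ax_def)

lemma ob_dm [simp]: "arr f \<Longrightarrow> ob (dm f)" and ob_cd [simp]: "arr f \<Longrightarrow> ob (cd f)"
  using cat by (auto simp: category_ax_def)

lemma arr_one [simp]: "ob X \<Longrightarrow> arr (one X)"
  and dm_one [simp]: "ob X \<Longrightarrow> dm (one X) = X"
  and cd_one [simp]: "ob X \<Longrightarrow> cd (one X) = X"
  using cat by (auto simp: category_ax_def hom_def)

lemma cmp_hom:
  assumes "arr f" "arr g" "dm g = cd f"
  shows "g \<cdot> f \<in> hom K (dm f) (cd g)"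
proof -
  have "\<forall>X\<in>t_ob K. \<forall>Y\<in>t_ob K. \<forall>Z\<in>t_ob K. \<forall>f\<in>hom K X Y. \<forall>g\<in>hom K Y Z. g \<cdot> f \<in> hom K X Z"
    using cat by (simp add: category_ax_def)
  then show ?thesis using assms by (metis hom_iff ob_dm ob_cd)
qed

lemma arr_cmp [simp]: "arr f \<Longrightarrow> arr g \<Longrightarrow> dm g = cd f \<Longrightarrow> arr (g \<cdot> f)"
  and dm_cmp [simp]: "arr f \<Longrightarrow> arr g \<Longrightarrow> dm g = cd f \<Longrightarrow> dm (g \<cdot> f) = dm f"
  and cd_cmp [simp]: "arr f \<Longrightarrow> arr g \<Longrightarrow> dm g = cd f \<Longrightarrow> cd (g \<cdot> f) = cd g"
  using cmp_hom by (auto simp: hom_iff)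

lemma cmp_one [simp]: "arr f \<Longrightarrow> dm f = X \<Longrightarrow> f \<cdot> one X = f"
  and one_cmp [simp]: "arr f \<Longrightarrow> cd f = Y \<Longrightarrow> one Y \<cdot> f = f"
  using cat by (auto simp: category_ax_def)

lemma assoc [simp]:
  "arr f \<Longrightarrow> arr g \<Longrightarrow> arr h \<Longrightarrow> dm g = cd f \<Longrightarrow> dm h = cd g \<Longrightarrow> (h \<cdot> g) \<cdot> f = h \<cdot> (g \<cdot> f)"
  using cat by (simp add: category_ax_def)

lemma reassoc: "a \<cdot> b = c \<Longrightarrow> arr a \<Longrightarrow> arr b \<Longrightarrow> arr x \<Longrightarrow> dm a = cd b \<Longrightarrow> dm b = cd x
   \<Longrightarrow> a \<cdot> (b \<cdot> x) = c \<cdot> x"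
  using assoc by metis

lemma preadd_hom:
  assumes "ob X" "ob Y"
  shows "nul X Y \<in> hom K X Y"
    "f \<in> hom K X Y \<Longrightarrow> g \<in> hom K X Y \<Longrightarrow> f \<oplus> g \<in> hom K X Y"
    "f \<in> hom K X Y \<Longrightarrow> mns f \<in> hom K X Y"
    "f \<in> hom K X Y \<Longrightarrow> g \<in> hom K X Y \<Longrightarrow> h \<in> hom K X Y \<Longrightarrow> f \<oplus> g \<oplus> h = f \<oplus> (g \<oplus> h)"
    "f \<in> hom K X Y \<Longrightarrow> g \<in> hom K X Y \<Longrightarrow> f \<oplus> g = g \<oplus> f"
    "f \<in> hom K X Y \<Longrightarrow> f \<oplus> nul X Y = f"
    "f \<in> hom K X Y \<Longrightarrow> f \<oplus> mns f = nul X Y"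
  using preadd assms unfolding preadditive_ax_def by blast+

lemma arr_nul [simp]: "ob X \<Longrightarrow> ob Y \<Longrightarrow> arr (nul X Y)"
  and dm_nul [simp]: "ob X \<Longrightarrow> ob Y \<Longrightarrow> dm (nul X Y) = X"
  and cd_nul [simp]: "ob X \<Longrightarrow> ob Y \<Longrightarrow> cd (nul X Y) = Y"
  using preadd_hom(1) by (auto simp: hom_iff)

lemma arr_pls [simp]: "arr f \<Longrightarrow> arr g \<Longrightarrow> dm g = dm f \<Longrightarrow> cd g = cd f \<Longrightarrow> arr (f \<oplus> g)"
  and dm_pls [simp]: "arr f \<Longrightarrow> arr g \<Longrightarrow> dm g = dm f \<Longrightarrow> cd g = cd f \<Longrightarrow> dm (f \<oplus> g) = dm f"
  and cd_pls [simp]: "arr f \<Longrightarrow> arr g \<Longrightarrow> dm g = dm f \<Longrightarrow> cd g = cd f \<Longrightarrow> cd (f \<oplus> g) = cd f"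
  using preadd_hom(2)[of "dm f" "cd f" f g] by (auto simp: hom_iff)

lemma arr_mns [simp]: "arr f \<Longrightarrow> arr (mns f)"
  and dm_mns [simp]: "arr f \<Longrightarrow> dm (mns f) = dm f"
  and cd_mns [simp]: "arr f \<Longrightarrow> cd (mns f) = cd f"
  using preadd_hom(3)[of "dm f" "cd f" f] by (auto simp: hom_iff)

lemma pls_assoc: "arr f \<Longrightarrow> arr g \<Longrightarrow> arr h \<Longrightarrow> dm g = dm f \<Longrightarrow> cd g = cd f \<Longrightarrow>
   dm h = dm f \<Longrightarrow> cd h = cd f \<Longrightarrow> f \<oplus> g \<oplus> h = f \<oplus> (g \<oplus> h)"
  using preadd_hom(4)[of "dm f" "cd f" f g h] by (auto simp: hom_iff)

lemma pls_comm: "arr f \<Longrightarrow> arr g \<Longrightarrow> dm g = dm f \<Longrightarrow> cd g = cd f \<Longrightarrow> f \<oplus> g = g \<oplus> f"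
  using preadd_hom(5)[of "dm f" "cd f" f g] by (auto simp: hom_iff)

lemma pls_left_comm: "arr f \<Longrightarrow> arr g \<Longrightarrow> arr h \<Longrightarrow> dm g = dm f \<Longrightarrow> cd g = cd f \<Longrightarrow>
   dm h = dm f \<Longrightarrow> cd h = cd f \<Longrightarrow> f \<oplus> (g \<oplus> h) = g \<oplus> (f \<oplus> h)"
  using pls_assoc[of f g h] pls_assoc[of g f h] pls_comm[of f g] by simp

lemmas pls_ac = pls_assoc pls_comm pls_left_comm

lemma pls_nul [simp]: "arr f \<Longrightarrow> dm f = X \<Longrightarrow> cd f = Y \<Longrightarrow> f \<oplus> nul X Y = f"
  using preadd_hom(6)[of X Y f] by (auto simp: hom_iff)

lemma nul_pls [simp]: "arr f \<Longrightarrow> dm f = X \<Longrightarrow> cd f = Y \<Longrightarrow> nul X Y \<oplus> f = f"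
  using pls_comm[of f "nul X Y"] by auto

lemma pls_mns [simp]: "arr f \<Longrightarrow> f \<oplus> mns f = nul (dm f) (cd f)"
  using preadd_hom(7)[of "dm f" "cd f" f] by (auto simp: hom_iff)

lemma mns_pls [simp]: "arr f \<Longrightarrow> mns f \<oplus> f = nul (dm f) (cd f)"
  using pls_comm[of f "mns f"] by auto

lemma pls_mns_left [simp]: "arr f \<Longrightarrow> arr g \<Longrightarrow> dm g = dm f \<Longrightarrow> cd g = cd f \<Longrightarrow> f \<oplus> (mns f \<oplus> g) = g"
  using pls_assoc[of f "mns f" g] by auto

lemma mns_pls_left [simp]: "arr f \<Longrightarrow> arr g \<Longrightarrow> dm g = dm f \<Longrightarrow> cd g = cd f \<Longrightarrow> mns f \<oplus> (f \<oplus> g) = g"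
  using pls_assoc[of "mns f" f g] by auto

lemma pls_cancel: "f \<oplus> g = f \<oplus> h \<Longrightarrow> arr f \<Longrightarrow> arr g \<Longrightarrow> arr h \<Longrightarrow> dm g = dm f \<Longrightarrow> cd g = cd f \<Longrightarrow>
   dm h = dm f \<Longrightarrow> cd h = cd f \<Longrightarrow> g = h"
  by (metis mns_pls_left)

lemma eq_if_diff_nul:
  assumes "f \<oplus> mns g = nul X Y" "arr f" "arr g" "dm f = X" "cd f = Y" "dm g = X" "cd g = Y"
  shows "f = g"
proof (rule pls_cancel[of "mns g"])
  show "mns g \<oplus> f = mns g \<oplus> g" using assms pls_comm[of f "mns g"] by (metis arr_mns cd_mns dm_mns mns_pls)
qed (use assms in simp_all)

lemma mns_unique: "f \<oplus> g = nul (dm f) (cd f) \<Longrightarrow> arr f \<Longrightarrow> arr g \<Longrightarrow> dm g = dm f \<Longrightarrow> cd g = cd f \<Longrightarrow> mns f = g"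
  using pls_cancel[of f g "mns f"] by simp

lemma mns_mns [simp]: "arr f \<Longrightarrow> mns (mns f) = f"
  by (rule mns_unique) auto

lemma mns_nul [simp]: "ob X \<Longrightarrow> ob Y \<Longrightarrow> mns (nul X Y) = nul X Y"
  by (rule mns_unique) auto

lemma distrib_raw:
  assumes "ob X" "ob Y" "ob Z" "f \<in> hom K X Y" "f' \<in> hom K X Y" "g \<in> hom K Y Z" "g' \<in> hom K Y Z"
  shows "g \<cdot> (f \<oplus> f') = g \<cdot> f \<oplus> g \<cdot> f'" "(g \<oplus> g') \<cdot> f = g \<cdot> f \<oplus> g' \<cdot> f"
  using preadd assms unfolding preadditive_ax_def by blast+

lemma cmp_pls [simp]: "arr f \<Longrightarrow> arr f' \<Longrightarrow> arr g \<Longrightarrow> dm f' = dm f \<Longrightarrow> cd f' = cd f \<Longrightarrow> dm g = cd f \<Longrightarrow>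
   g \<cdot> (f \<oplus> f') = g \<cdot> f \<oplus> g \<cdot> f'"
  using distrib_raw(1)[of "dm f" "cd f" "cd g" f f' g g] by (auto simp: hom_iff)

lemma pls_cmp [simp]: "arr f \<Longrightarrow> arr g \<Longrightarrow> arr g' \<Longrightarrow> dm g = cd f \<Longrightarrow> dm g' = dm g \<Longrightarrow> cd g' = cd g \<Longrightarrow>
   (g \<oplus> g') \<cdot> f = g \<cdot> f \<oplus> g' \<cdot> f"
  using distrib_raw(2)[of "dm f" "cd f" "cd g" f f g g'] by (auto simp: hom_iff)

lemma cmp_nul [simp]: assumes "arr g" "ob X" "dm g = Y" shows "g \<cdot> nul X Y = nul X (cd g)"
proof -
  have "g \<cdot> (nul X Y \<oplus> nul X Y) = g \<cdot> nul X Y \<oplus> g \<cdot> nul X Y" using assms by (intro cmp_pls) auto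
  then have "g \<cdot> nul X Y \<oplus> nul X (cd g) = g \<cdot> nul X Y \<oplus> g \<cdot> nul X Y" using assms by auto
  from pls_cancel[OF this] show ?thesis using assms by auto
qed

lemma nul_cmp [simp]: assumes "arr g" "ob Z" "cd g = Y" shows "nul Y Z \<cdot> g = nul (dm g) Z"
proof -
  have "(nul Y Z \<oplus> nul Y Z) \<cdot> g = nul Y Z \<cdot> g \<oplus> nul Y Z \<cdot> g" using assms by (intro pls_cmp) auto
  then have "nul Y Z \<cdot> g \<oplus> nul (dm g) Z = nul Y Z \<cdot> g \<oplus> nul Y Z \<cdot> g" using assms by auto
  from pls_cancel[OF this] show ?thesis using assms by auto
qed

lemma cmp_mns [simp]: "arr f \<Longrightarrow> arr g \<Longrightarrow> dm g = cd f \<Longrightarrow> g \<cdot> mns f = mns (g \<cdot> f)"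
  by (rule mns_unique[symmetric]) (auto simp flip: cmp_pls)

lemma mns_cmp [simp]: "arr f \<Longrightarrow> arr g \<Longrightarrow> dm g = cd f \<Longrightarrow> mns g \<cdot> f = mns (g \<cdot> f)"
  by (rule mns_unique[symmetric]) (auto simp flip: pls_cmp)

lemma mns_eq_nul: "mns f = nul X Y \<Longrightarrow> arr f \<Longrightarrow> dm f = X \<Longrightarrow> cd f = Y \<Longrightarrow> f = nul X Y"
  using mns_mns[of f] by (metis mns_nul ob_dm ob_cd)

lemma mns_inject: "mns f = mns g \<Longrightarrow> arr f \<Longrightarrow> arr g \<Longrightarrow> f = g"
  by (metis mns_mns)

lemma mns_pls_distrib: "arr f \<Longrightarrow> arr g \<Longrightarrow> dm g = dm f \<Longrightarrow> cd g = cd f \<Longrightarrow> mns (f \<oplus> g) = mns f \<oplus> mns g"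
  by (rule mns_unique) (auto simp: pls_assoc pls_left_comm[of g "mns f"])

section \<open>The shift on objects and morphisms\<close>

lemma ob_So [simp]: "ob X \<Longrightarrow> ob (So X)"
  and Sh_one [simp]: "ob X \<Longrightarrow> Sh (one X) = one (So X)"
  using shft by (auto simp: shift_ax_def)

lemma Sh_bij: "ob X \<Longrightarrow> ob Y \<Longrightarrow> bij_betw Sh (hom K X Y) (hom K (So X) (So Y))"
  using shft by (auto simp: shift_ax_def)

lemma Sh_hom: "arr f \<Longrightarrow> Sh f \<in> hom K (So (dm f)) (So (cd f))"
  using bij_betwE[OF Sh_bij[of "dm f" "cd f"]] by (auto simp: hom_iff)

lemma arr_Sh [simp]: "arr f \<Longrightarrow> arr (Sh f)"
  and dm_Sh [simp]: "arr f \<Longrightarrow> dm (Sh f) = So (dm f)"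
  and cd_Sh [simp]: "arr f \<Longrightarrow> cd (Sh f) = So (cd f)"
  using Sh_hom by (auto simp: hom_iff)

lemma Sh_pls [simp]: "arr f \<Longrightarrow> arr g \<Longrightarrow> dm g = dm f \<Longrightarrow> cd g = cd f \<Longrightarrow> Sh (f \<oplus> g) = Sh f \<oplus> Sh g"
  using shft unfolding shift_ax_def by (metis hom_iff ob_dm ob_cd)

lemma Sh_cmp [simp]: "arr f \<Longrightarrow> arr g \<Longrightarrow> dm g = cd f \<Longrightarrow> Sh (g \<cdot> f) = Sh g \<cdot> Sh f"
  using shft by (auto simp: shift_ax_def)

lemma Sh_inject: "Sh f = Sh g \<Longrightarrow> arr f \<Longrightarrow> arr g \<Longrightarrow> dm g = dm f \<Longrightarrow> cd g = cd f \<Longrightarrow> f = g"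
  using bij_betw_imp_inj_on[OF Sh_bij[of "dm f" "cd f"]] by (auto simp: inj_on_def hom_iff)

lemma Sh_full:
  assumes "arr x" "dm x = So X" "cd x = So Y" "ob X" "ob Y"
  obtains y where "arr y" "dm y = X" "cd y = Y" "x = Sh y"
  using bij_betw_imp_surj_on[OF Sh_bij[of X Y]] assms by (force simp: hom_iff image_def set_eq_iff)

lemma Sh_nul [simp]: assumes "ob X" "ob Y" shows "Sh (nul X Y) = nul (So X) (So Y)"
proof -
  have "Sh (nul X Y \<oplus> nul X Y) = Sh (nul X Y) \<oplus> Sh (nul X Y)" using assms by (intro Sh_pls) auto
  then have "Sh (nul X Y) \<oplus> nul (So X) (So Y) = Sh (nul X Y) \<oplus> Sh (nul X Y)" using assms by simp
  from pls_cancel[OF this] show ?thesis using assms by auto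
qed

lemma Sh_mns [simp]: "arr f \<Longrightarrow> Sh (mns f) = mns (Sh f)"
  by (rule mns_unique[symmetric]) (auto simp flip: Sh_pls)

lemma Sh_eq_nul:
  assumes "Sh f = nul (So X) (So Y)" "arr f" "dm f = X" "cd f = Y" shows "f = nul X Y"
  by (rule Sh_inject) (use assms in auto)

section \<open>Isomorphisms, zero objects and biproducts\<close>

lemma iso_iff: "iso_mor K f \<longleftrightarrow> arr f \<and> (\<exists>g. arr g \<and> dm g = cd f \<and> cd g = dm f \<and> g \<cdot> f = one (dm f) \<and> f \<cdot> g = one (cd f))"
  by (auto simp: iso_mor_def hom_iff)

lemma iso_arr: "iso_mor K f \<Longrightarrow> arr f" by (simp add: iso_iff)

lemma iso_inv:
  assumes "iso_mor K f"
  obtains g where "arr g" "dm g = cd f" "cd g = dm f" "g \<cdot> f = one (dm f)" "f \<cdot> g = one (cd f)" "iso_mor K g"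
  using assms iso_iff[of f] by (metis iso_iff)

lemma iso_one [simp]: "ob X \<Longrightarrow> iso_mor K (one X)"
  by (auto simp: iso_iff intro!: exI[of _ "one X"])

lemma iso_cmp: assumes "iso_mor K f" "iso_mor K g" "dm g = cd f" shows "iso_mor K (g \<cdot> f)"
proof -
  obtain f' where f': "arr f'" "dm f' = cd f" "cd f' = dm f" "f' \<cdot> f = one (dm f)" "f \<cdot> f' = one (cd f)"
    using assms by (auto elim: iso_inv)
  obtain g' where g': "arr g'" "dm g' = cd g" "cd g' = dm g" "g' \<cdot> g = one (dm g)" "g \<cdot> g' = one (cd g)"
    using assms by (auto elim: iso_inv)
  note a = iso_arr[OF assms(1)] iso_arr[OF assms(2)]
  have "(f' \<cdot> g') \<cdot> (g \<cdot> f) = one (dm f)" using f' g' a assms(3) reassoc[OF g'(4), of f] by simp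
  moreover have "(g \<cdot> f) \<cdot> (f' \<cdot> g') = one (cd g)" using f' g' a assms(3) reassoc[OF f'(5), of g'] by simp
  ultimately show ?thesis using a f' g' assms(3) by (auto simp: iso_iff intro!: exI[of _ "f' \<cdot> g'"])
qed

text \<open>Serves where the two inverses come out of separate arguments, as for comparison maps
  between cones.\<close>

lemma iso_from_left_right:
  assumes "arr f" "arr g" "arr h" "dm g = cd f" "cd g = dm f" "dm h = cd f" "cd h = dm f"
    "g \<cdot> f = one (dm f)" "f \<cdot> h = one (cd f)"
  shows "iso_mor K f"
proof -
  have "g = g \<cdot> (f \<cdot> h)" using assms by simp
  also have "\<dots> = h" using assms reassoc[OF assms(8), of h] by simp
  finally show ?thesis using assms by (auto simp: iso_iff)
qed

lemma iso_mns: assumes "iso_mor K f" shows "iso_mor K (mns f)"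
proof -
  obtain g where g: "arr g" "dm g = cd f" "cd g = dm f" "g \<cdot> f = one (dm f)" "f \<cdot> g = one (cd f)"
    using assms by (auto elim: iso_inv)
  then show ?thesis using iso_arr[OF assms] by (auto simp: iso_iff intro!: exI[of _ "mns g"])
qed

lemma isomorphicI: "iso_mor K f \<Longrightarrow> isomorphic K (dm f) (cd f)"
  by (auto simp: isomorphic_def hom_iff iso_arr)

lemma isomorphicE:
  assumes "isomorphic K X Y"
  obtains f where "iso_mor K f" "arr f" "dm f = X" "cd f = Y"
  using assms by (auto simp: isomorphic_def hom_iff)

lemma isomorphic_sym: "isomorphic K X Y \<Longrightarrow> isomorphic K Y X"
  by (metis isomorphicE isomorphicI iso_inv)

lemma isomorphic_trans: "isomorphic K X Y \<Longrightarrow> isomorphic K Y Z \<Longrightarrow> isomorphic K X Z"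
  by (metis isomorphicE isomorphicI iso_cmp cd_cmp dm_cmp)

lemma isomorphic_refl: "ob X \<Longrightarrow> isomorphic K X X"
  using isomorphicI[of "one X"] by simp

text \<open>The shift is only essentially surjective on objects, so undoing it costs an
  isomorphism.\<close>

lemma desuspend:
  assumes "ob Y"
  obtains X f where "ob X" "iso_mor K f" "arr f" "dm f = So X" "cd f = Y"
proof -
  obtain X where X: "ob X" "isomorphic K (So X) Y" using assms shft unfolding shift_ax_def by blast
  from X(2) show ?thesis by (rule isomorphicE) (rule that[OF X(1)])
qed

lemma zero_obj_ob: "zero_obj K Z \<Longrightarrow> ob Z" by (simp add: zero_obj_def)

lemma zero_obj_exists: obtains Z where "zero_obj K Z"
  using addt by (auto simp: additive_ax_def)

lemma into_zero: "zero_obj K Z \<Longrightarrow> arr f \<Longrightarrow> cd f = Z \<Longrightarrow> f = nul (dm f) Z"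
  and from_zero: "zero_obj K Z \<Longrightarrow> arr f \<Longrightarrow> dm f = Z \<Longrightarrow> f = nul Z (cd f)"
  by (auto simp: zero_obj_def hom_iff)

lemma zero_obj_iff: "zero_obj K Z \<longleftrightarrow> ob Z \<and> one Z = nul Z Z"
proof
  assume a: "ob Z \<and> one Z = nul Z Z"
  have "f = nul Z (cd f)" if "arr f" "dm f = Z" for f
    using cmp_one[of f Z] that a cmp_nul[of f Z Z] by metis
  moreover have "f = nul (dm f) Z" if "arr f" "cd f = Z" for f
    using one_cmp[of f Z] that a nul_cmp[of f Z Z] by metis
  ultimately show "zero_obj K Z" using a by (auto simp: zero_obj_def hom_iff)
next
  assume z: "zero_obj K Z"
  then have "ob Z" by (rule zero_obj_ob)
  with from_zero[OF z, of "one Z"] show "ob Z \<and> one Z = nul Z Z" by simp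
qed

lemma zero_obj_iso: assumes "zero_obj K Z" "isomorphic K Z Y" shows "zero_obj K Y"
proof -
  obtain f where f: "iso_mor K f" "arr f" "dm f = Z" "cd f = Y" using assms(2) by (rule isomorphicE)
  obtain g where g: "arr g" "dm g = cd f" "cd g = dm f" "f \<cdot> g = one (cd f)" using f(1) by (auto elim: iso_inv)
  have "one Y = nul Z Y \<cdot> nul Y Z" using g f from_zero[OF assms(1) f(2,3)] into_zero[OF assms(1) g(1)] by simp
  also have "\<dots> = nul Y Y" using f(2-4) by auto
  finally show ?thesis using f by (auto simp: zero_obj_iff)
qed

lemma zero_obj_So: "zero_obj K Z \<Longrightarrow> zero_obj K (So Z)"
  by (metis zero_obj_iff Sh_one Sh_nul ob_So)

lemma biprod_exists:
  assumes "ob A" "ob B" obtains S i j p q where "is_biprod K A B S i j p q"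
  using addt assms unfolding additive_ax_def by blast

lemma biprod_iff: "is_biprod K A B S i j p q \<longleftrightarrow> ob A \<and> ob B \<and> ob S \<and>
   (arr i \<and> dm i = A \<and> cd i = S) \<and> (arr j \<and> dm j = B \<and> cd j = S) \<and>
   (arr p \<and> dm p = S \<and> cd p = A) \<and> (arr q \<and> dm q = S \<and> cd q = B) \<and>
   p \<cdot> i = one A \<and> q \<cdot> j = one B \<and> q \<cdot> i = nul A B \<and> p \<cdot> j = nul B A \<and> i \<cdot> p \<oplus> j \<cdot> q = one S"
  by (auto simp: is_biprod_def hom_iff)

lemma biprod_swap: "is_biprod K A B S i j p q \<Longrightarrow> is_biprod K B A S j i q p"
  by (auto simp: biprod_iff pls_comm)

lemma biprod_split:
  assumes "is_biprod K A B S i j p q" "arr x" "dm x = S"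
  shows "x = (x \<cdot> i) \<cdot> p \<oplus> (x \<cdot> j) \<cdot> q"
proof -
  have "x = x \<cdot> (i \<cdot> p \<oplus> j \<cdot> q)" using assms by (simp add: biprod_iff)
  also have "\<dots> = (x \<cdot> i) \<cdot> p \<oplus> (x \<cdot> j) \<cdot> q" using assms unfolding biprod_iff by (subst cmp_pls) auto
  finally show ?thesis .
qed

lemma biprod_split_into:
  assumes "is_biprod K A B S i j p q" "arr x" "cd x = S"
  shows "x = i \<cdot> (p \<cdot> x) \<oplus> j \<cdot> (q \<cdot> x)"
proof -
  have "x = (i \<cdot> p \<oplus> j \<cdot> q) \<cdot> x" using assms by (simp add: biprod_iff)
  also have "\<dots> = i \<cdot> (p \<cdot> x) \<oplus> j \<cdot> (q \<cdot> x)" using assms unfolding biprod_iff by (subst pls_cmp) auto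
  finally show ?thesis .
qed

lemma biprod_zero:
  assumes "zero_obj K Z" "ob A" shows "is_biprod K A Z A (one A) (nul Z A) (one A) (nul A Z)"
  using assms zero_obj_ob[OF assms(1)] by (simp add: biprod_iff zero_obj_iff)

lemma biprod_iso:
  assumes b: "is_biprod K A B S i j p q" and f: "iso_mor K f" "dm f = S"
  obtains g where "arr g" "dm g = cd f" "cd g = S" "g \<cdot> f = one S" "f \<cdot> g = one (cd f)"
    "is_biprod K A B (cd f) (f \<cdot> i) (f \<cdot> j) (p \<cdot> g) (q \<cdot> g)"
proof -
  obtain g where g: "arr g" "dm g = cd f" "cd g = dm f" "g \<cdot> f = one (dm f)" "f \<cdot> g = one (cd f)"
    using f by (auto elim: iso_inv)
  note fa = iso_arr[OF f(1)]
  have ty: "arr i" "arr j" "arr p" "arr q" "cd i = S" "cd j = S" "dm p = S" "dm q = S" "dm i = A" "dm j = B" "cd p = A" "cd q = B"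
    using b by (auto simp: biprod_iff)
  have "f \<cdot> (g \<cdot> f \<cdot> i) \<cdot> p \<cdot> g \<oplus> f \<cdot> (g \<cdot> f \<cdot> j) \<cdot> q \<cdot> g = f \<cdot> (i \<cdot> p \<oplus> j \<cdot> q) \<cdot> g"
    using ty g f fa reassoc[OF g(4)] by simp
  also have "\<dots> = one (cd f)" using b g f fa by (simp add: biprod_iff)
  finally have "f \<cdot> i \<cdot> p \<cdot> g \<oplus> f \<cdot> j \<cdot> q \<cdot> g = one (cd f)"
    using ty g f fa reassoc[OF g(4)] by simp
  then have "is_biprod K A B (cd f) (f \<cdot> i) (f \<cdot> j) (p \<cdot> g) (q \<cdot> g)"
    using b g(1-3) f(2) fa reassoc[OF g(4)] by (simp add: biprod_iff)
  with g(3-5) f(2) show ?thesis by (intro that[OF g(1,2)]) simp_all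
qed

lemma triangle_iff: "is_triangle K (f, g, h) \<longleftrightarrow>
   arr f \<and> arr g \<and> arr h \<and> dm g = cd f \<and> dm h = cd g \<and> cd h = So (dm f)"
  by (auto simp add: is_triangle_def)

end

section \<open>Triangulated categories\<close>

locale triangulated_category = additive_shift_category +
  assumes TR1: "TR1 K" and TR2: "TR2 K" and TR3: "TR3 K" and TR4: "TR4 K"
begin

text \<open>A triple of the axioms carries its objects only through its arrows. Naming the three
  objects lets \<open>triD\<close> pass all typing conditions to the simplifier.\<close>

definition tri where
  "tri A B Z f g h \<longleftrightarrow> (f, g, h) \<in> t_tri K \<and> dm f = A \<and> cd f = B \<and> cd g = Z"

lemma triD:
  assumes "tri A B Z f g h"
  shows "arr f" "dm f = A" "cd f = B" "arr g" "dm g = B" "cd g = Z" "arr h" "dm h = Z" "cd h = So A"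
    "ob A" "ob B" "ob Z"
proof -
  have "is_triangle K (f, g, h)" using assms TR1 unfolding TR1_def tri_def by blast
  then have *: "arr f" "arr g" "arr h" "cd f = dm g" "cd g = dm h" "cd h = So (dm f)"
    by (simp_all add: triangle_iff)
  have **: "dm f = A" "cd f = B" "cd g = Z" using assms by (simp_all add: tri_def)
  show "arr f" "dm f = A" "cd f = B" "arr g" "dm g = B" "cd g = Z" "arr h" "dm h = Z" "cd h = So A"
    using * ** by simp_all
  show "ob A" "ob B" "ob Z" using * ** ob_dm[of f] ob_cd[of f] ob_cd[of g] by simp_all
qed

lemma triI: "(f, g, h) \<in> t_tri K \<Longrightarrow> tri (dm f) (cd f) (cd g) f g h"
  by (simp add: tri_def)

lemma tri_exists: assumes "arr f" obtains Z g h where "tri (dm f) (cd f) Z f g h"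
  using assms TR1 unfolding TR1_def tri_def by blast

lemma tri_id:
  assumes "ob X" "zero_obj K Z" shows "tri X X Z (one X) (nul X Z) (nul Z (So X))"
  using assms TR1 zero_obj_ob[OF assms(2)] unfolding TR1_def tri_def by simp

lemma tri_iso_closed:
  assumes t: "tri A B Z f g h"
    and a: "iso_mor K a" "dm a = A" "cd a = A'" and b: "iso_mor K b" "dm b = B" "cd b = B'"
    and c: "iso_mor K c" "dm c = Z" "cd c = Z'"
    and f: "arr f'" "dm f' = A'" "cd f' = B'" and g: "arr g'" "dm g' = B'" "cd g' = Z'"
    and h: "arr h'" "dm h' = Z'" "cd h' = So A'"
    and eq: "b \<cdot> f = f' \<cdot> a" "c \<cdot> g = g' \<cdot> b" "Sh a \<cdot> h = h' \<cdot> c"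
  shows "tri A' B' Z' f' g' h'"
proof -
  note D = triD[OF t] iso_arr[OF a(1)] iso_arr[OF b(1)] iso_arr[OF c(1)]
  have "tri_iso K (f, g, h) (f', g', h')"
    unfolding tri_iso_def triangle_iff tri_morph_def hom_iff using D a b c f g h eq by auto
  then have "(f', g', h') \<in> t_tri K" using TR1 t unfolding TR1_def tri_def by blast
  then show ?thesis using f g by (simp add: tri_def)
qed

lemma tri_rot: assumes "tri A B Z f g h" shows "tri B Z (So A) g h (mns (Sh f))"
proof -
  note D = triD[OF assms]
  have "is_triangle K (f, g, h)" using D by (simp add: triangle_iff)
  then have "(g, h, mns (Sh f)) \<in> t_tri K" using TR2 assms unfolding TR2_def tri_def by blast
  then show ?thesis using D by (simp add: tri_def)
qed

lemma tri_unrot: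
  assumes "tri B Z (So A) g h (mns (Sh f))" "arr f" "dm f = A" "cd f = B"
  shows "tri A B Z f g h"
proof -
  note D = triD[OF assms(1)]
  have "is_triangle K (f, g, h)" using D assms by (simp add: triangle_iff)
  then have "(f, g, h) \<in> t_tri K" using TR2 assms unfolding TR2_def tri_def by blast
  then show ?thesis using D assms by (simp add: tri_def)
qed

section \<open>Exactness of the hom functors on triangles\<close>

lemma tri_morphism:
  assumes t: "tri A B Z f g h" "tri A' B' Z' f' g' h'"
    and ab: "arr a" "dm a = A" "cd a = A'" "arr b" "dm b = B" "cd b = B'" "b \<cdot> f = f' \<cdot> a"
  obtains c where "arr c" "dm c = Z" "cd c = Z'" "c \<cdot> g = g' \<cdot> b" "Sh a \<cdot> h = h' \<cdot> c"
proof -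
  note D = triD[OF t(1)] triD[OF t(2)]
  have *: "(f, g, h) \<in> t_tri K" "(f', g', h') \<in> t_tri K" using t by (simp_all add: tri_def)
  have "a \<in> hom K (dm f) (dm f')" "b \<in> hom K (dm g) (dm g')" using ab D by (simp_all add: hom_iff)
  then have "\<exists>c. tri_morph K (f, g, h) (f', g', h') a b c"
    using TR3[unfolded TR3_def, rule_format, OF * _ _ ab(7)] by blast
  then show ?thesis using that D unfolding tri_morph_def by (auto simp: hom_iff)
qed

lemma tri_comp_zero: assumes t: "tri A B Z f g h" shows "g \<cdot> f = nul A Z"
proof -
  note D = triD[OF t]
  obtain N0 where N0: "zero_obj K N0" by (rule zero_obj_exists)
  note Oo = zero_obj_ob[OF N0]
  obtain c where "arr c" "dm c = N0" "cd c = Z" "c \<cdot> nul A N0 = g \<cdot> f"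
    using tri_morphism[OF tri_id[OF D(10) N0] t, of "one A" f] D by auto
  then show ?thesis using D Oo by simp
qed

lemma tri_comp_zero2: assumes t: "tri A B Z f g h" shows "h \<cdot> g = nul B (So A)"
  using tri_comp_zero[OF tri_rot[OF t]] .

lemma tri_comp_zero3: assumes t: "tri A B Z f g h" shows "Sh f \<cdot> h = nul Z (So B)"
proof -
  note D = triD[OF t]
  show ?thesis using tri_comp_zero2[OF tri_rot[OF t]] D
    by - (rule mns_eq_nul, auto)
qed

text \<open>TR3 is applied to the rotated identity triangle of the source of \<open>x\<close> and
  the rotated given triangle, with \<open>x\<close> and a zero map as the known components. The
  third component lives between shifts and comes down by fullness.\<close>

lemma tri_lift:
  assumes t: "tri A B Z f g h" and x: "arr x" "cd x = B" "g \<cdot> x = nul (dm x) Z"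
  obtains y where "arr y" "dm y = dm x" "cd y = A" "f \<cdot> y = x"
proof -
  note D = triD[OF t]
  obtain N0 where N0: "zero_obj K N0" by (rule zero_obj_exists)
  note Oo = zero_obj_ob[OF N0]
  have W: "ob (dm x)" using x by simp
  have r: "tri (dm x) N0 (So (dm x)) (nul (dm x) N0) (nul N0 (So (dm x))) (mns (Sh (one (dm x))))"
    by (rule tri_rot[OF tri_id[OF W N0]])
  obtain c where c: "arr c" "dm c = So (dm x)" "cd c = So A" "Sh x \<cdot> mns (Sh (one (dm x))) = mns (Sh f) \<cdot> c"
    using tri_morphism[OF r tri_rot[OF t], of x "nul N0 Z"] D Oo x by auto
  obtain y where y: "arr y" "dm y = dm x" "cd y = A" "c = Sh y" using Sh_full[OF c(1-3)] x D by auto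
  have "mns (Sh x) = mns (Sh (f \<cdot> y))" using c(4) y x D W by simp
  then have "Sh (f \<cdot> y) = Sh x" using x D y by (metis mns_inject arr_Sh arr_cmp)
  then have "f \<cdot> y = x" by (rule Sh_inject) (use x D y in auto)
  then show ?thesis using that y by blast
qed

lemma tri_lift2:
  assumes t: "tri A B Z f g h" and x: "arr x" "cd x = Z" "h \<cdot> x = nul (dm x) (So A)"
  obtains y where "arr y" "dm y = dm x" "cd y = B" "g \<cdot> y = x"
  using tri_lift[OF tri_rot[OF t] x] .

lemma tri_lift3:
  assumes t: "tri A B Z f g h" and x: "arr x" "cd x = So A" "Sh f \<cdot> x = nul (dm x) (So B)"
  obtains y where "arr y" "dm y = dm x" "cd y = Z" "h \<cdot> y = x"
proof -
  note D = triD[OF t]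
  have "mns (Sh f) \<cdot> x = nul (dm x) (So B)" using x D by simp
  from tri_lift2[OF tri_rot[OF t] x(1,2) this] show ?thesis using that by blast
qed

text \<open>The identity triangle rotated back by one step: the target to which
  \<open>tri_extend\<close> maps the given triangle.\<close>

lemma tri_zero_id:
  assumes "ob W" "zero_obj K N0" shows "tri N0 W W (nul N0 W) (one W) (nul W (So N0))"
proof (rule tri_unrot)
  note Oo = zero_obj_ob[OF assms(2)]
  have "nul (So N0) (So W) = mns (Sh (nul N0 W))" using assms Oo by simp
  then show "tri W W (So N0) (one W) (nul W (So N0)) (mns (Sh (nul N0 W)))"
    using tri_id[OF assms(1) zero_obj_So[OF assms(2)]] by simp
qed (use assms zero_obj_ob[OF assms(2)] in simp_all)

lemma tri_extend:
  assumes t: "tri A B Z f g h" and x: "arr x" "dm x = B" "x \<cdot> f = nul A (cd x)"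
  obtains y where "arr y" "dm y = Z" "cd y = cd x" "y \<cdot> g = x"
proof -
  note D = triD[OF t]
  obtain N0 where N0: "zero_obj K N0" by (rule zero_obj_exists)
  note Oo = zero_obj_ob[OF N0]
  have W: "ob (cd x)" using x by simp
  obtain c where "arr c" "dm c = Z" "cd c = cd x" "c \<cdot> g = one (cd x) \<cdot> x"
    using tri_morphism[OF t tri_zero_id[OF W N0], of "nul A N0" x] D Oo x by auto
  then show ?thesis using that x by simp
qed

lemma tri_extend2:
  assumes t: "tri A B Z f g h" and x: "arr x" "dm x = Z" "x \<cdot> g = nul B (cd x)"
  obtains y where "arr y" "dm y = So A" "cd y = cd x" "y \<cdot> h = x"
  using tri_extend[OF tri_rot[OF t] x] .

text \<open>With \<open>m = 1 - e\<close> the hypothesis reads \<open>m m = 0\<close>, so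
  \<open>1 + m\<close> is inverse to \<open>e = 1 - m\<close>.\<close>

lemma nilpotent_iso:
  assumes e: "arr e" "dm e = Z" "cd e = Z" and n: "(one Z \<oplus> mns e) \<cdot> (one Z \<oplus> mns e) = nul Z Z"
  obtains d where "arr d" "dm d = Z" "cd d = Z" "e \<cdot> d = one Z" "d \<cdot> e = one Z"
proof -
  have Z: "ob Z" using e ob_dm by metis
  define m where "m = one Z \<oplus> mns e"
  have m: "arr m" "dm m = Z" "cd m = Z" "m \<cdot> m = nul Z Z" using n e Z by (auto simp: m_def)
  have e': "e = one Z \<oplus> mns m" using e Z by (simp add: m_def mns_pls_distrib)
  have "e \<cdot> (one Z \<oplus> m) = one Z" "(one Z \<oplus> m) \<cdot> e = one Z"
    unfolding e' using m Z by (simp_all add: pls_assoc)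
  then show ?thesis using that[of "one Z \<oplus> m"] m Z by simp
qed

text \<open>An endomorphism compatible with \<open>g\<close> and \<open>h\<close> is unipotent:
  \<open>1 - e\<close> kills \<open>g\<close>, so it has the form \<open>y h\<close>, and it is
  killed by \<open>h\<close> in turn. The extension property is a hypothesis because
  \<open>biprod_cone\<close> uses this for a direct sum of triangles that has not been shown to be
  distinguished.\<close>

lemma cone_unique_aux:
  assumes ty: "arr g" "dm g = B" "cd g = Z" "arr h" "dm h = Z" "cd h = Y"
    and ext: "\<And>x. arr x \<Longrightarrow> dm x = Z \<Longrightarrow> cd x = Z \<Longrightarrow> x \<cdot> g = nul B Z \<Longrightarrow> \<exists>y. arr y \<and> dm y = Y \<and> cd y = Z \<and> y \<cdot> h = x"
    and e: "arr e" "dm e = Z" "cd e = Z" "e \<cdot> g = g" "h \<cdot> e = h"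
  obtains d where "arr d" "dm d = Z" "cd d = Z" "e \<cdot> d = one Z" "d \<cdot> e = one Z"
proof -
  define m where "m = one Z \<oplus> mns e"
  have Z: "ob Z" using e ob_dm by metis
  have m: "arr m" "dm m = Z" "cd m = Z" "m \<cdot> g = nul B Z" "h \<cdot> m = nul Z Y" using e ty Z by (simp_all add: m_def)
  obtain y where y: "arr y" "dm y = Y" "cd y = Z" "y \<cdot> h = m" using ext[OF m(1-4)] by auto
  have "m \<cdot> m = y \<cdot> h \<cdot> m" using y(4) m(1-3) y(1-3) ty by (metis assoc)
  also have "\<dots> = nul Z Z" using m(5) y Z by simp
  finally show ?thesis using nilpotent_iso[OF e(1-3)] that unfolding m_def by blast
qed

text \<open>The fill-ins in both directions have composites that fix the maps of the triangles, so
  these composites are unipotent and hence invertible.\<close>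

lemma cone_unique:
  assumes t: "tri A B Z f g h" and t': "tri A B Z' f g' h'"
  obtains c where "iso_mor K c" "arr c" "dm c = Z" "cd c = Z'" "c \<cdot> g = g'" "h' \<cdot> c = h"
proof -
  note D = triD[OF t] and D' = triD[OF t']
  obtain c where c: "arr c" "dm c = Z" "cd c = Z'" "c \<cdot> g = g'" "h' \<cdot> c = h"
    using tri_morphism[OF t t', of "one A" "one B"] D D' by auto
  obtain c' where c': "arr c'" "dm c' = Z'" "cd c' = Z" "c' \<cdot> g' = g" "h \<cdot> c' = h'"
    using tri_morphism[OF t' t, of "one A" "one B"] D D' by auto
  obtain d where d: "arr d" "dm d = Z" "cd d = Z" "d \<cdot> (c' \<cdot> c) = one Z"
  proof (rule cone_unique_aux[of g B Z h "So A" "c' \<cdot> c"])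
    show "\<exists>y. arr y \<and> dm y = So A \<and> cd y = Z \<and> y \<cdot> h = x" if "arr x" "dm x = Z" "cd x = Z" "x \<cdot> g = nul B Z" for x
      using tri_extend2[OF t that(1,2)] that by metis
  qed (use D c c' reassoc[OF c'(5), of c] in \<open>simp_all\<close>)
  obtain d' where d': "arr d'" "dm d' = Z'" "cd d' = Z'" "(c \<cdot> c') \<cdot> d' = one Z'"
  proof (rule cone_unique_aux[of g' B Z' h' "So A" "c \<cdot> c'"])
    show "\<exists>y. arr y \<and> dm y = So A \<and> cd y = Z' \<and> y \<cdot> h' = x" if "arr x" "dm x = Z'" "cd x = Z'" "x \<cdot> g' = nul B Z'" for x
      using tri_extend2[OF t' that(1,2)] that by metis
  qed (use D' c c' reassoc[OF c(5), of c'] in \<open>simp_all\<close>)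
  have "iso_mor K c"
    by (rule iso_from_left_right[of c "d \<cdot> c'" "c' \<cdot> d'"]) (use c c' d d' in simp_all)
  then show ?thesis using that c by blast
qed

text \<open>Rotating the cone of \<open>m\<close> backwards requires its third object to be a shift.
  It is only isomorphic to one, and the triangle is transported along that isomorphism.\<close>

lemma fiber_exists:
  assumes m: "arr m" "dm m = A" "cd m = T"
  obtains F u w where "tri F A T u m w"
proof -
  obtain N n k where t: "tri A T N m n k" using tri_exists[OF m(1)] m by metis
  note D = triD[OF t]
  obtain F \<theta> where th: "ob F" "iso_mor K \<theta>" "arr \<theta>" "dm \<theta> = So F" "cd \<theta> = N" using desuspend[OF D(12)] by blast
  obtain \<phi> where ph: "arr \<phi>" "dm \<phi> = N" "cd \<phi> = So F" "\<phi> \<cdot> \<theta> = one (So F)" "\<theta> \<cdot> \<phi> = one N" "iso_mor K \<phi>"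
    using iso_inv[OF th(2)] th by metis
  \<comment> \<open>The sign anticipates the rotation axiom, in which \<open>u\<close> returns as
    \<open>mns (Sh u)\<close>.\<close>
  obtain u where u: "arr u" "dm u = F" "cd u = A" "mns (k \<cdot> \<theta>) = Sh u"
    using Sh_full[of "mns (k \<cdot> \<theta>)" F A] D th by auto
  have su: "mns (Sh u) = k \<cdot> \<theta>" using D th u(4)[symmetric] by simp
  have "tri F A T u m (\<phi> \<cdot> n)"
  proof (rule tri_unrot)
    show "tri A T (So F) m (\<phi> \<cdot> n) (mns (Sh u))" unfolding su
      by (rule tri_iso_closed[OF t, of "one A" A "one T" T \<phi>])
        (use D th ph in simp_all)
  qed (use u in auto)
  then show ?thesis using that by blast
qed

lemma octahedron:
  assumes "tri A B Q1 f u u'" "tri B Z Q3 g v v'" "tri A Z Q2 (g \<cdot> f) w w'"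
  obtains a b where "tri Q1 Q2 Q3 a b (Sh u \<cdot> v')" "a \<cdot> u = w \<cdot> g" "w' \<cdot> a = u'" "b \<cdot> w = v" "v' \<cdot> b = Sh f \<cdot> w'"
proof -
  note D = triD[OF assms(1)] triD[OF assms(2)] triD[OF assms(3)]
  have fgc: "cd f = dm g" using D by simp
  have *: "(f, u, u') \<in> t_tri K" "(g, v, v') \<in> t_tri K" "(g \<cdot> f, w, w') \<in> t_tri K"
    using assms by (simp_all add: tri_def)
  obtain a b where ab: "(a, b, Sh u \<cdot> v') \<in> t_tri K" "a \<cdot> u = w \<cdot> g" "w' \<cdot> a = u'" "b \<cdot> w = v" "v' \<cdot> b = Sh f \<cdot> w'"
    using TR4[unfolded TR4_def, rule_format, OF * fgc] by blast
  \<comment> \<open>The axiom does not type a and b; their end points are read off the last two identities.\<close>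
  note E = triD[OF triI[OF ab(1)]]
  have "dm (Sh u \<cdot> v') = Q3" using D by simp
  then have cb: "cd b = Q3" using E by simp
  have "dm (v' \<cdot> b) = dm b" using E cb D by (intro dm_cmp) simp_all
  moreover have "dm (Sh f \<cdot> w') = Q2" using D by simp
  ultimately have ca: "cd a = Q2" using ab(5) E by simp
  have "dm (w' \<cdot> a) = dm a" using E ca D by (intro dm_cmp) simp_all
  then have "dm a = Q1" using ab(3) D by simp
  then have "tri Q1 Q2 Q3 a b (Sh u \<cdot> v')" using ab(1) ca cb by (simp add: tri_def)
  then show ?thesis using that ab by blast
qed

end

context additive_shift_category begin

lemma biprodD:
  assumes "is_biprod K A B S i j p q"
  shows "ob A" "ob B" "ob S" "arr i" "dm i = A" "cd i = S" "arr j" "dm j = B" "cd j = S"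
    "arr p" "dm p = S" "cd p = A" "arr q" "dm q = S" "cd q = B"
    "p \<cdot> i = one A" "q \<cdot> j = one B" "q \<cdot> i = nul A B" "p \<cdot> j = nul B A"
    "arr x \<Longrightarrow> cd x = A \<Longrightarrow> p \<cdot> i \<cdot> x = x" "arr y \<Longrightarrow> cd y = B \<Longrightarrow> q \<cdot> j \<cdot> y = y"
    "arr x \<Longrightarrow> cd x = A \<Longrightarrow> q \<cdot> i \<cdot> x = nul (dm x) B" "arr y \<Longrightarrow> cd y = B \<Longrightarrow> p \<cdot> j \<cdot> y = nul (dm y) A"
proof -
  show D: "ob A" "ob B" "ob S" "arr i" "dm i = A" "cd i = S" "arr j" "dm j = B" "cd j = S"
    "arr p" "dm p = S" "cd p = A" "arr q" "dm q = S" "cd q = B"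
    "p \<cdot> i = one A" "q \<cdot> j = one B" "q \<cdot> i = nul A B" "p \<cdot> j = nul B A"
    using assms by (simp_all add: biprod_iff)
  show "p \<cdot> i \<cdot> x = x" if "arr x" "cd x = A" using reassoc[OF D(16)] D that by simp
  show "q \<cdot> j \<cdot> y = y" if "arr y" "cd y = B" using reassoc[OF D(17)] D that by simp
  show "q \<cdot> i \<cdot> x = nul (dm x) B" if "arr x" "cd x = A" using reassoc[OF D(18)] D that by simp
  show "p \<cdot> j \<cdot> y = nul (dm y) A" if "arr y" "cd y = B" using reassoc[OF D(19)] D that by simp
qed

lemma biprod_sum: "is_biprod K A B S i j p q \<Longrightarrow> i \<cdot> p \<oplus> j \<cdot> q = one S"
  by (simp add: biprod_iff)

lemma biprod_Sh:
  assumes "is_biprod K A B S i j p q"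
  shows "is_biprod K (So A) (So B) (So S) (Sh i) (Sh j) (Sh p) (Sh q)"
proof -
  note D = biprodD[OF assms]
  have "Sh i \<cdot> Sh p \<oplus> Sh j \<cdot> Sh q = Sh (i \<cdot> p \<oplus> j \<cdot> q)" using D by simp
  then show ?thesis using D biprod_sum[OF assms] by (simp add: biprod_iff flip: Sh_cmp)
qed

end

section \<open>Biproducts and triangles\<close>

context triangulated_category begin

lemma tri_neg: assumes t: "tri A B Z f g h" shows "tri A B Z f (mns g) (mns h)"
proof -
  note D = triD[OF t]
  show ?thesis
    by (rule tri_iso_closed[OF t, of "one A" _ "one B" _ "mns (one Z)"]) (use D iso_mns[of "one Z"] in simp_all)
qed

lemma tri_Sh: assumes t: "tri A B Z f g h" shows "tri (So A) (So B) (So Z) (Sh f) (Sh g) (mns (Sh h))"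
proof -
  note D = triD[OF t]
  show ?thesis
    by (rule tri_iso_closed[OF tri_rot[OF tri_rot[OF tri_rot[OF t]]], of "one (So A)" _ "mns (one (So B))" _ "one (So Z)"])
      (use D iso_mns[of "one (So B)"] in simp_all)
qed

text \<open>The cone of \<open>i\<close> is compared with \<open>B\<close>. The retraction
  \<open>p\<close> forces the connecting map to vanish, so a map on the cone that kills
  \<open>g\<close> is zero; this makes \<open>c\<close> and \<open>g j\<close> mutually
  inverse.\<close>

lemma biprod_tri: assumes b: "is_biprod K A B S i j p q" shows "tri A S B i q (nul B (So A))"
proof -
  note D = biprodD[OF b]
  obtain Z g h where t: "tri A S Z i g h" using tri_exists[OF D(4)] D by auto
  note E = triD[OF t]
  have "Sh p \<cdot> Sh i \<cdot> h = h" using E D by (simp flip: assoc Sh_cmp)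
  then have h0: "h = nul Z (So A)" using tri_comp_zero3[OF t] E D by simp
  obtain c where c: "arr c" "dm c = Z" "cd c = B" "c \<cdot> g = q" using tri_extend[OF t, of q] D by auto
  have gi: "g \<cdot> i = nul A Z" by (rule tri_comp_zero[OF t])
  have "g = g \<cdot> (i \<cdot> p \<oplus> j \<cdot> q)" using biprod_sum[OF b] E by simp
  also have "\<dots> = (g \<cdot> j) \<cdot> q" using D E reassoc[OF gi, of p] by simp
  finally have g: "g \<cdot> j \<cdot> q = g" using D E by simp
  define m where "m = (g \<cdot> j) \<cdot> c \<oplus> mns (one Z)"
  have "m \<cdot> g = nul S Z" using c D E g by (simp add: m_def)
  then obtain y where "arr y" "dm y = So A" "cd y = Z" "y \<cdot> h = m"
    using tri_extend2[OF t, of m] c D E by (auto simp: m_def)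
  then have "m = nul Z Z" using h0 E by simp
  then have 1: "(g \<cdot> j) \<cdot> c = one Z" unfolding m_def by (rule eq_if_diff_nul) (use c D E in simp_all)
  have 2: "c \<cdot> (g \<cdot> j) = one B" using c D E reassoc[OF c(4), of j] by simp
  have ci: "iso_mor K c" unfolding iso_iff using 1 2 c D E by (intro conjI exI[of _ "g \<cdot> j"]) simp_all
  show ?thesis
    by (rule tri_iso_closed[OF t, of "one A" _ "one S" _ c]) (use D E c ci h0 in simp_all)
qed

text \<open>The retraction makes the connecting map zero, hence \<open>q\<close> an epimorphism. The
  complementary projection \<open>1 - i p\<close> kills \<open>i\<close> and so factors as
  \<open>j q\<close>; the remaining biproduct identities are tested after \<open>q\<close>.\<close>

lemma tri_retract_biprod:
  assumes t: "tri A S B i q h" and p: "arr p" "dm p = S" "cd p = A" "p \<cdot> i = one A"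
  obtains j where "is_biprod K A B S i j p q"
proof -
  note D = triD[OF t]
  have "Sh p \<cdot> Sh i \<cdot> h = h" using D p by (simp flip: assoc Sh_cmp)
  then have h0: "h = nul B (So A)" using tri_comp_zero3[OF t] D p by simp
  have epi: "x = nul B (cd x)" if "arr x" "dm x = B" "x \<cdot> q = nul S (cd x)" for x
    using tri_extend2[OF t that] h0 D by (metis cmp_nul)
  have qi: "q \<cdot> i = nul A B" by (rule tri_comp_zero[OF t])
  define e where "e = one S \<oplus> mns (i \<cdot> p)"
  have e: "arr e" "dm e = S" "cd e = S" using D p by (simp_all add: e_def)
  have "e \<cdot> i = nul A S" using D p by (simp add: e_def)
  then obtain j where j: "arr j" "dm j = B" "cd j = S" "j \<cdot> q = e" using tri_extend[OF t e(1,2)] e by metis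
  have pe: "p \<cdot> e = nul S A" using D p reassoc[OF p(4), of p] by (simp add: e_def)
  have qe: "q \<cdot> e = q" using D p reassoc[OF qi, of p] by (simp add: e_def)
  have "(q \<cdot> j \<oplus> mns (one B)) \<cdot> q = nul S B" using D j qe by simp
  then have "q \<cdot> j \<oplus> mns (one B) = nul B B" using epi[of "q \<cdot> j \<oplus> mns (one B)"] D j by simp
  then have 1: "q \<cdot> j = one B" by (rule eq_if_diff_nul) (use D j in simp_all)
  have "(p \<cdot> j) \<cdot> q = nul S A" using D j p pe by simp
  then have 2: "p \<cdot> j = nul B A" using epi[of "p \<cdot> j"] D j p by simp
  have 3: "i \<cdot> p \<oplus> j \<cdot> q = one S" unfolding j(4) e_def using D p by (simp add: pls_comm[of "one S"])
  show ?thesis by (rule that[of j]) (use D j p 1 2 3 qi in \<open>simp add: biprod_iff\<close>)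
qed

text \<open>Componentwise fill-ins compare the sum of the two triangles with a chosen cone of the
  sum of \<open>f1\<close> and \<open>f2\<close>, in both directions. Their composites are
  unipotent. This later makes the rank of morphisms additive.\<close>

lemma biprod_cone:
  assumes t1: "tri A1 B1 Z1 f1 g1 h1" and t2: "tri A2 B2 Z2 f2 g2 h2"
    and bA: "is_biprod K A1 A2 A i1 i2 p1 p2" and bB: "is_biprod K B1 B2 B j1 j2 q1 q2"
    and bZ: "is_biprod K Z1 Z2 Z k1 k2 r1 r2"
    and t: "tri A B Z' (j1 \<cdot> f1 \<cdot> p1 \<oplus> j2 \<cdot> f2 \<cdot> p2) g' h'"
  shows "isomorphic K Z Z'"
proof -
  note T1 = triD[OF t1] and T2 = triD[OF t2] and T = triD[OF t]
  note A = biprodD[OF bA] and B = biprodD[OF bB] and Z = biprodD[OF bZ]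
  note SA = biprodD[OF biprod_Sh[OF bA]]
  define f where "f = j1 \<cdot> f1 \<cdot> p1 \<oplus> j2 \<cdot> f2 \<cdot> p2"
  define g where "g = k1 \<cdot> g1 \<cdot> q1 \<oplus> k2 \<cdot> g2 \<cdot> q2"
  define h where "h = Sh i1 \<cdot> h1 \<cdot> r1 \<oplus> Sh i2 \<cdot> h2 \<cdot> r2"
  note t' = t[folded f_def]
  have f: "arr f" "dm f = A" "cd f = B" and g: "arr g" "dm g = B" "cd g = Z" and h: "arr h" "dm h = Z" "cd h = So A"
    using T1 T2 A B Z by (simp_all add: f_def g_def h_def)
  have fi: "f \<cdot> i1 = j1 \<cdot> f1" "f \<cdot> i2 = j2 \<cdot> f2" "q1 \<cdot> f = f1 \<cdot> p1" "q2 \<cdot> f = f2 \<cdot> p2"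
    using A B T1 T2 by (simp_all add: f_def)
  have gj: "g \<cdot> j1 = k1 \<cdot> g1" "g \<cdot> j2 = k2 \<cdot> g2" using B Z T1 T2 by (simp_all add: g_def)
  obtain c1 where c1: "arr c1" "dm c1 = Z1" "cd c1 = Z'" "c1 \<cdot> g1 = g' \<cdot> j1" "Sh i1 \<cdot> h1 = h' \<cdot> c1"
    using tri_morphism[OF t1 t', of i1 j1] A B fi by auto
  obtain c2 where c2: "arr c2" "dm c2 = Z2" "cd c2 = Z'" "c2 \<cdot> g2 = g' \<cdot> j2" "Sh i2 \<cdot> h2 = h' \<cdot> c2"
    using tri_morphism[OF t2 t', of i2 j2] A B fi by auto
  obtain d1 where d1: "arr d1" "dm d1 = Z'" "cd d1 = Z1" "d1 \<cdot> g' = g1 \<cdot> q1" "Sh p1 \<cdot> h' = h1 \<cdot> d1"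
    using tri_morphism[OF t' t1, of p1 q1] A B fi by auto
  obtain d2 where d2: "arr d2" "dm d2 = Z'" "cd d2 = Z2" "d2 \<cdot> g' = g2 \<cdot> q2" "Sh p2 \<cdot> h' = h2 \<cdot> d2"
    using tri_morphism[OF t' t2, of p2 q2] A B fi by auto
  define c where "c = c1 \<cdot> r1 \<oplus> c2 \<cdot> r2"
  define d where "d = k1 \<cdot> d1 \<oplus> k2 \<cdot> d2"
  have c: "arr c" "dm c = Z" "cd c = Z'" and d: "arr d" "dm d = Z'" "cd d = Z"
    using Z c1 c2 d1 d2 by (simp_all add: c_def d_def)
  have "c \<cdot> g = (c1 \<cdot> g1) \<cdot> q1 \<oplus> (c2 \<cdot> g2) \<cdot> q2" using T1 T2 Z B c1(1-3) c2(1-3) by (simp add: c_def g_def)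
  also have "\<dots> = g' \<cdot> (j1 \<cdot> q1 \<oplus> j2 \<cdot> q2)" unfolding c1(4) c2(4) using B T by simp
  finally have cg: "c \<cdot> g = g'" using biprod_sum[OF bB] T by simp
  have "h' \<cdot> c = (h' \<cdot> c1) \<cdot> r1 \<oplus> (h' \<cdot> c2) \<cdot> r2" using T Z c1(1-3) c2(1-3) by (simp add: c_def)
  then have hc: "h' \<cdot> c = h" unfolding c1(5)[symmetric] c2(5)[symmetric] h_def using T1 T2 A Z by simp
  have dg: "d \<cdot> g' = g" unfolding d_def g_def using T Z d1 d2 by simp
  have "h \<cdot> d = Sh i1 \<cdot> (h1 \<cdot> d1) \<oplus> Sh i2 \<cdot> (h2 \<cdot> d2)"
    unfolding h_def d_def using T1 T2 Z d1(1-3) d2(1-3) A T(12) by simp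
  also have "\<dots> = (Sh i1 \<cdot> Sh p1 \<oplus> Sh i2 \<cdot> Sh p2) \<cdot> h'"
    unfolding d1(5)[symmetric] d2(5)[symmetric] using A T by simp
  finally have hd: "h \<cdot> d = h'" using biprod_sum[OF biprod_Sh[OF bA]] T by simp
  \<comment> \<open>Here the third corner is the sum \<open>Z\<close>, so the extension property is
    assembled from the two given triangles.\<close>
  obtain u where u: "arr u" "dm u = Z" "cd u = Z" "u \<cdot> (d \<cdot> c) = one Z"
  proof (rule cone_unique_aux[of g B Z h "So A" "d \<cdot> c"])
    fix x assume x: "arr x" "dm x = Z" "cd x = Z" "x \<cdot> g = nul B Z"
    have "(x \<cdot> k1) \<cdot> g1 = (x \<cdot> g) \<cdot> j1" "(x \<cdot> k2) \<cdot> g2 = (x \<cdot> g) \<cdot> j2"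
      using x(1-3) g Z B gj T1 T2 by simp_all
    then have xg: "(x \<cdot> k1) \<cdot> g1 = nul B1 Z" "(x \<cdot> k2) \<cdot> g2 = nul B2 Z" unfolding x(4) using B Z by simp_all
    have xk: "arr (x \<cdot> k1)" "dm (x \<cdot> k1) = Z1" "cd (x \<cdot> k1) = Z" "arr (x \<cdot> k2)" "dm (x \<cdot> k2) = Z2" "cd (x \<cdot> k2) = Z"
      using x(1-3) Z by simp_all
    obtain y1 where y1: "arr y1" "dm y1 = So A1" "cd y1 = Z" "y1 \<cdot> h1 = x \<cdot> k1"
      using tri_extend2[OF t1 xk(1,2)] xg(1) xk(3) by metis
    obtain y2 where y2: "arr y2" "dm y2 = So A2" "cd y2 = Z" "y2 \<cdot> h2 = x \<cdot> k2"
      using tri_extend2[OF t2 xk(4,5)] xg(2) xk(6) by metis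
    define y where "y = y1 \<cdot> Sh p1 \<oplus> y2 \<cdot> Sh p2"
    have "y \<cdot> h = (y1 \<cdot> h1) \<cdot> r1 \<oplus> (y2 \<cdot> h2) \<cdot> r2"
      unfolding y_def h_def using y1(1-3) y2(1-3) SA A T1 T2 Z by simp
    also have "\<dots> = x" unfolding y1(4) y2(4) using biprod_split[OF bZ x(1,2)] by simp
    finally show "\<exists>y. arr y \<and> dm y = So A \<and> cd y = Z \<and> y \<cdot> h = x"
      using y1(1-3) y2(1-3) A by (intro exI[of _ y]) (simp add: y_def)
  qed (use c d g h cg hc dg hd reassoc[OF hd, of c] in \<open>simp_all\<close>)
  obtain v where v: "arr v" "dm v = Z'" "cd v = Z'" "(c \<cdot> d) \<cdot> v = one Z'"
  proof (rule cone_unique_aux[of g' B Z' h' "So A" "c \<cdot> d"])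
    show "\<exists>y. arr y \<and> dm y = So A \<and> cd y = Z' \<and> y \<cdot> h' = x" if "arr x" "dm x = Z'" "cd x = Z'" "x \<cdot> g' = nul B Z'" for x
      using tri_extend2[OF t that(1,2)] that by metis
  qed (use T c d g h cg hc dg hd reassoc[OF hc, of d] in \<open>simp_all\<close>)
  have "iso_mor K c"
    by (rule iso_from_left_right[of c "u \<cdot> d" "d \<cdot> v"]) (use c d u v in simp_all)
  then show ?thesis using isomorphicI[of c] c by simp
qed

end

section \<open>Triangulated and thick subcategories\<close>

context triangulated_category begin

text \<open>Rotation reduces the other two closure conditions to closure under cones, since
  membership is invariant under the shift in both directions.\<close>

lemma tri_subcatI:
  assumes "T \<subseteq> t_ob K" "T \<noteq> {}"
    and iso: "\<And>X Y. X \<in> T \<Longrightarrow> isomorphic K X Y \<Longrightarrow> Y \<in> T"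
    and sh: "\<And>X. ob X \<Longrightarrow> So X \<in> T \<longleftrightarrow> X \<in> T"
    and cone: "\<And>A B Z f g h. tri A B Z f g h \<Longrightarrow> A \<in> T \<Longrightarrow> B \<in> T \<Longrightarrow> Z \<in> T"
  shows "tri_subcat K T"
proof -
  have *: "(A \<in> T \<and> B \<in> T \<longrightarrow> Z \<in> T) \<and> (A \<in> T \<and> Z \<in> T \<longrightarrow> B \<in> T) \<and> (B \<in> T \<and> Z \<in> T \<longrightarrow> A \<in> T)"
    if t: "tri A B Z f g h" for A B Z f g h
    using cone[OF t] cone[OF tri_rot[OF t]] cone[OF tri_rot[OF tri_rot[OF t]]] sh triD(10-12)[OF t] by blast
  have "let X = dm f; Y = dm g; Z = dm h in
          (X \<in> T \<and> Y \<in> T \<longrightarrow> Z \<in> T) \<and> (X \<in> T \<and> Z \<in> T \<longrightarrow> Y \<in> T) \<and> (Y \<in> T \<and> Z \<in> T \<longrightarrow> X \<in> T)"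
    if "(f, g, h) \<in> t_tri K" for f g h
    unfolding Let_def triD(5)[OF triI[OF that]] triD(8)[OF triI[OF that]] by (rule *[OF triI[OF that]])
  then show ?thesis unfolding tri_subcat_def using assms(1,2) iso sh by (intro conjI allI ballI impI) blast+
qed

end

locale triangulated_subcategory = triangulated_category +
  fixes S assumes sub: "tri_subcat K S"
begin

abbreviation W where "W s \<equiv> cone_in K S s"

lemma sub_ob: "X \<in> S \<Longrightarrow> ob X"
  using sub by (auto simp: tri_subcat_def)

lemma sub_iso: "X \<in> S \<Longrightarrow> isomorphic K X Y \<Longrightarrow> Y \<in> S"
  using sub unfolding tri_subcat_def by blast

lemma sub_So: "ob X \<Longrightarrow> So X \<in> S \<longleftrightarrow> X \<in> S"
  using sub by (simp add: tri_subcat_def)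

lemma sub_tri:
  assumes t: "tri A B Z f g h"
  shows "A \<in> S \<Longrightarrow> B \<in> S \<Longrightarrow> Z \<in> S" "A \<in> S \<Longrightarrow> Z \<in> S \<Longrightarrow> B \<in> S" "B \<in> S \<Longrightarrow> Z \<in> S \<Longrightarrow> A \<in> S"
proof -
  have "(f, g, h) \<in> t_tri K" using t by (simp add: tri_def)
  with sub triD[OF t]
  have "(A \<in> S \<and> B \<in> S \<longrightarrow> Z \<in> S) \<and> (A \<in> S \<and> Z \<in> S \<longrightarrow> B \<in> S) \<and> (B \<in> S \<and> Z \<in> S \<longrightarrow> A \<in> S)"
    unfolding tri_subcat_def Let_def by metis
  then show "A \<in> S \<Longrightarrow> B \<in> S \<Longrightarrow> Z \<in> S" "A \<in> S \<Longrightarrow> Z \<in> S \<Longrightarrow> B \<in> S" "B \<in> S \<Longrightarrow> Z \<in> S \<Longrightarrow> A \<in> S"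
    by blast+
qed

lemma sub_zero: assumes "zero_obj K Z" shows "Z \<in> S"
proof -
  obtain X where "X \<in> S" using sub by (auto simp: tri_subcat_def)
  then show ?thesis using sub_tri(1)[OF tri_id[OF sub_ob assms]] by blast
qed

lemma sub_biprod: "is_biprod K A B X i j p q \<Longrightarrow> A \<in> S \<Longrightarrow> B \<in> S \<Longrightarrow> X \<in> S"
  using sub_tri(2)[OF biprod_tri] by blast

text \<open>\<open>cone_in\<close> asks for some cone in \<open>S\<close>. Since cones are unique up
  to isomorphism and \<open>S\<close> is replete, any one cone decides.\<close>

lemma W_iff: assumes t: "tri A B Z s g h" shows "W s \<longleftrightarrow> Z \<in> S"
proof
  assume "W s"
  then obtain g' h' where gh: "(s, g', h') \<in> t_tri K" "cd g' \<in> S" by (auto simp: cone_in_def)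
  have t': "tri A B (cd g') s g' h'" using gh(1) triD[OF t] by (simp add: tri_def)
  obtain c where "iso_mor K c" "dm c = cd g'" "cd c = Z" using cone_unique[OF t' t] by metis
  then show "Z \<in> S" using sub_iso[OF gh(2)] isomorphicI[of c] by simp
next
  assume "Z \<in> S" then show "W s" using t by (auto simp: cone_in_def tri_def)
qed

lemma W_arr: "W s \<Longrightarrow> arr s"
  by (auto simp: cone_in_def dest!: triI triD(1))

lemma W_tri:
  assumes "W s" obtains Z g h where "tri (dm s) (cd s) Z s g h" "Z \<in> S"
  using tri_exists[OF W_arr[OF assms]] W_iff assms by metis

lemma W_fiber:
  assumes "W s" obtains F u w where "tri F (dm s) (cd s) u s w" "F \<in> S"
proof -
  obtain F u w where t: "tri F (dm s) (cd s) u s w" using fiber_exists[of s] W_arr[OF assms] by metis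
  moreover have "F \<in> S" using W_iff[OF tri_rot[OF t]] assms sub_So triD(10)[OF t] by simp
  ultimately show ?thesis using that by blast
qed

lemma W_iso: assumes "iso_mor K f" shows "W f"
proof -
  obtain N0 where z: "zero_obj K N0" by (rule zero_obj_exists)
  note fa = iso_arr[OF assms]
  obtain g where g: "arr g" "dm g = cd f" "cd g = dm f" "g \<cdot> f = one (dm f)" "f \<cdot> g = one (cd f)" "iso_mor K g"
    using assms by (rule iso_inv)
  have "tri (dm f) (cd f) N0 f (nul (cd f) N0) (nul N0 (So (dm f)))"
    by (rule tri_iso_closed[OF tri_id[OF ob_dm[OF fa] z], of "one (dm f)" _ f _ "one N0"])
      (use fa assms zero_obj_ob[OF z] in simp_all)
  then show ?thesis using W_iff sub_zero[OF z] by blast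
qed

lemma W_one [simp]: "ob X \<Longrightarrow> W (one X)" by (rule W_iso) simp

text \<open>The octahedral axiom puts the cones of \<open>f\<close>, \<open>g f\<close> and
  \<open>g\<close> into one triangle, and two corners in \<open>S\<close> force the third.\<close>

lemma W_2of3:
  assumes "arr f" "arr g" "dm g = cd f"
  shows "W f \<Longrightarrow> W g \<Longrightarrow> W (g \<cdot> f)" "W (g \<cdot> f) \<Longrightarrow> W g \<Longrightarrow> W f" "W (g \<cdot> f) \<Longrightarrow> W f \<Longrightarrow> W g"
proof -
  obtain Q1 u u' where 1: "tri (dm f) (cd f) Q1 f u u'" using tri_exists[OF assms(1)] .
  obtain Q3 v v' where 3: "tri (cd f) (cd g) Q3 g v v'" using tri_exists[OF assms(2)] assms(3) by metis
  have "arr (g \<cdot> f)" using assms by simp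
  then obtain Q2 w w' where 2: "tri (dm f) (cd g) Q2 (g \<cdot> f) w w'" using tri_exists[of "g \<cdot> f"] assms by auto
  obtain a b where "tri Q1 Q2 Q3 a b (Sh u \<cdot> v')" using octahedron[OF 1 3 2] by metis
  from sub_tri[OF this] W_iff[OF 1] W_iff[OF 2] W_iff[OF 3]
  show "W f \<Longrightarrow> W g \<Longrightarrow> W (g \<cdot> f)" "W (g \<cdot> f) \<Longrightarrow> W g \<Longrightarrow> W f" "W (g \<cdot> f) \<Longrightarrow> W f \<Longrightarrow> W g" by blast+
qed

lemma W_cmp: "W f \<Longrightarrow> W g \<Longrightarrow> dm g = cd f \<Longrightarrow> W (g \<cdot> f)"
  using W_2of3(1) W_arr by blast

lemma W_Sh: assumes "arr s" shows "W (Sh s) \<longleftrightarrow> W s"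
proof -
  obtain Z g h where t: "tri (dm s) (cd s) Z s g h" using tri_exists[OF assms] .
  show ?thesis using W_iff[OF t] W_iff[OF tri_Sh[OF t]] sub_So triD(12)[OF t] by simp
qed

text \<open>These are the morphisms that become zero in the Verdier quotient, see
  \<open>q_zero_iff\<close>. The notion keeps questions of vanishing inside the original
  category.\<close>

definition factors where
  "factors f \<longleftrightarrow> (\<exists>Z u v. Z \<in> S \<and> arr u \<and> arr v \<and> cd u = Z \<and> dm v = Z \<and> f = v \<cdot> u)"

text \<open>Let \<open>c\<close> map to the cone of \<open>t\<close> and let \<open>u\<close> be the
  fiber of \<open>c f\<close>. The cone of \<open>u\<close> is then the cone of \<open>t\<close>,
  and \<open>f u\<close> lifts along \<open>t\<close> because \<open>c f u = 0\<close>.\<close>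

lemma W_Ore:
  assumes f: "arr f" and t: "W t" "cd t = cd f"
  obtains u h where "W u" "arr u" "cd u = dm f" "arr h" "dm h = dm u" "cd h = dm t" "f \<cdot> u = t \<cdot> h"
proof -
  obtain Z c d where tr: "tri (dm t) (cd f) Z t c d" "Z \<in> S" using W_tri[OF t(1)] t(2) by metis
  note D = triD[OF tr(1)]
  obtain F u w where tr2: "tri F (dm f) Z u (c \<cdot> f) w" by (rule fiber_exists[of "c \<cdot> f" "dm f" Z]) (use D f in simp_all)
  note E = triD[OF tr2]
  have "c \<cdot> f \<cdot> u = nul F Z" using tri_comp_zero[OF tr2] D E f by simp
  moreover have "dm (f \<cdot> u) = F" using E f by simp
  ultimately obtain h where "arr h" "dm h = F" "cd h = dm t" "t \<cdot> h = f \<cdot> u"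
    using tri_lift[OF tr(1), of "f \<cdot> u"] E f by auto
  moreover have "W u" using W_iff[OF tr2] tr(2) by simp
  ultimately show ?thesis using that[of u h] E by simp
qed

lemma factors_pre: assumes "factors f" "arr x" "cd x = dm f" shows "factors (f \<cdot> x)"
proof -
  obtain Z u v where *: "Z \<in> S" "arr u" "arr v" "cd u = Z" "dm v = Z" "f = v \<cdot> u"
    using assms(1) unfolding factors_def by blast
  show ?thesis unfolding factors_def using * assms(2,3) by (intro exI[of _ Z] exI[of _ "u \<cdot> x"] exI[of _ v]) simp
qed

lemma factors_post: assumes "factors f" "arr x" "dm x = cd f" shows "factors (x \<cdot> f)"
proof -
  obtain Z u v where *: "Z \<in> S" "arr u" "arr v" "cd u = Z" "dm v = Z" "f = v \<cdot> u"
    using assms(1) unfolding factors_def by blast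
  show ?thesis unfolding factors_def using * assms(2,3) by (intro exI[of _ Z] exI[of _ u] exI[of _ "x \<cdot> v"]) simp
qed

text \<open>The fiber of the first factor kills \<open>f\<close>, and its cone is the object of
  \<open>S\<close> in the middle. Conversely, a morphism killed by \<open>u\<close> extends over the
  cone of \<open>u\<close>, which gives \<open>factors_if_pre\<close>; the \<open>post\<close>
  versions are dual.\<close>

lemma factors_kill_pre:
  assumes "factors f"
  obtains u where "W u" "arr u" "cd u = dm f" "f \<cdot> u = nul (dm u) (cd f)"
proof -
  obtain Z x v where *: "Z \<in> S" "arr x" "arr v" "cd x = Z" "dm v = Z" "f = v \<cdot> x"
    using assms(1) unfolding factors_def by blast
  obtain F u w where t: "tri F (dm x) Z u x w" using fiber_exists[of x] * by metis
  note D = triD[OF t]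
  have "f \<cdot> u = nul F (cd f)" using tri_comp_zero[OF t] * D by simp
  then show ?thesis using that[of u] W_iff[OF t] * D by simp
qed

lemma factors_kill_post:
  assumes "factors f"
  obtains t where "W t" "arr t" "dm t = cd f" "t \<cdot> f = nul (dm f) (cd t)"
proof -
  obtain Z x v where *: "Z \<in> S" "arr x" "arr v" "cd x = Z" "dm v = Z" "f = v \<cdot> x"
    using assms(1) unfolding factors_def by blast
  obtain N t w where t: "tri Z (cd v) N v t w" using tri_exists[of v] * by metis
  note D = triD[OF t]
  have "t \<cdot> f = nul (dm f) N" using reassoc[OF tri_comp_zero[OF t], of x] * D by simp
  moreover have "W t" using W_iff[OF tri_rot[OF t]] sub_So[OF D(10)] *(1) by simp
  ultimately show ?thesis using that[of t] * D by simp
qed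

lemma factors_if_pre: assumes "W u" "arr f" "cd u = dm f" "f \<cdot> u = nul (dm u) (cd f)" shows "factors f"
proof -
  obtain Z g h where t: "tri (dm u) (dm f) Z u g h" "Z \<in> S" using W_tri[OF assms(1)] assms(3) by metis
  obtain y where "arr y" "dm y = Z" "cd y = cd f" "y \<cdot> g = f" using tri_extend[OF t(1), of f] assms by auto
  then show ?thesis unfolding factors_def using t triD[OF t(1)] by blast
qed

lemma factors_if_post: assumes "W t" "arr f" "dm t = cd f" "t \<cdot> f = nul (dm f) (cd t)" shows "factors f"
proof -
  obtain F u w where t: "tri F (cd f) (cd t) u t w" "F \<in> S" using W_fiber[OF assms(1)] assms(3) by metis
  obtain y where "arr y" "dm y = dm f" "cd y = F" "u \<cdot> y = f" using tri_lift[OF t(1), of f] assms by auto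
  then show ?thesis unfolding factors_def using t triD[OF t(1)] by blast
qed

text \<open>The cancellation half of the calculus of fractions. The difference of the two morphisms
  is killed by composing with \<open>t\<close> afterwards, so it factors through \<open>S\<close>,
  so it is killed by composing with some \<open>u\<close> beforehand.\<close>

lemma W_cancel:
  assumes t: "W t" and f: "arr f" "arr g" "dm g = dm f" "cd g = cd f" "dm t = cd f" and eq: "t \<cdot> f = t \<cdot> g"
  obtains u where "W u" "arr u" "cd u = dm f" "f \<cdot> u = g \<cdot> u"
proof -
  define m where "m = f \<oplus> mns g"
  have m: "arr m" "dm m = dm f" "cd m = cd f" using f by (simp_all add: m_def)
  have "t \<cdot> m = nul (dm m) (cd t)" using f W_arr[OF t] eq by (simp add: m_def)
  then have "factors m" using factors_if_post[OF t, of m] m f by simp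
  then obtain u where u: "W u" "arr u" "cd u = dm f" "m \<cdot> u = nul (dm u) (cd m)"
    using factors_kill_pre m by metis
  have "f \<cdot> u \<oplus> mns (g \<cdot> u) = nul (dm u) (cd f)" using u(2-4) m f by (simp add: m_def)
  then have "f \<cdot> u = g \<cdot> u" by (rule eq_if_diff_nul) (use f u in simp_all)
  then show ?thesis using that u by blast
qed

end

locale thick_subcategory = triangulated_category +
  fixes S assumes thk: "thick K S"

sublocale thick_subcategory \<subseteq> triangulated_subcategory
  using thk by unfold_locales (simp add: thick_def)

context thick_subcategory begin

lemma sub_summand: "is_biprod K A B X i j p q \<Longrightarrow> X \<in> S \<Longrightarrow> A \<in> S \<and> B \<in> S"
  using thk unfolding thick_def by blast

text \<open>Such an \<open>X\<close> is a retract of an object of \<open>S\<close>, and by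
  \<open>tri_retract_biprod\<close> a retract is a direct summand. This is where closure under
  summands enters.\<close>

lemma factors_one: assumes "ob X" "factors (one X)" shows "X \<in> S"
proof -
  obtain Z u v where *: "Z \<in> S" "arr u" "arr v" "cd u = Z" "dm v = Z" "one X = v \<cdot> u"
    using assms unfolding factors_def by blast
  have uX: "dm u = X" "cd v = X" using *(2-5) dm_cmp[of u v] cd_cmp[of u v] assms(1) unfolding *(6)[symmetric] by simp_all
  obtain N q h where t: "tri X Z N u q h" using tri_exists[of u] * uX by metis
  obtain j where "is_biprod K X N Z u j v q" using tri_retract_biprod[OF t, of v] * uX by metis
  then show ?thesis using sub_summand *(1) by blast
qed

end

section \<open>Calculus of roofs\<close>

text \<open>The operations of the quotient are defined as unions of result classes over all
  representatives. Well-definedness means that all these classes coincide, and then the union is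
  that class.\<close>

lemma Union_eq_singleton: "c \<in> A \<Longrightarrow> (\<And>x. x \<in> A \<Longrightarrow> x = c) \<Longrightarrow> \<Union>A = c"
  by (metis Sup_insert Union_empty insert_absorb subsetI subset_singletonD sup_bot.right_neutral insertI1 empty_iff)

context triangulated_subcategory begin

definition roof where
  "roof X Y s f \<longleftrightarrow> W s \<and> arr f \<and> cd s = X \<and> dm f = dm s \<and> cd f = Y"

lemma roofD: "roof X Y s f \<Longrightarrow> W s" "roof X Y s f \<Longrightarrow> arr s" "roof X Y s f \<Longrightarrow> arr f" "roof X Y s f \<Longrightarrow> cd s = X"
   "roof X Y s f \<Longrightarrow> dm f = dm s" "roof X Y s f \<Longrightarrow> cd f = Y" "roof X Y s f \<Longrightarrow> ob X" "roof X Y s f \<Longrightarrow> ob Y" "roof X Y s f \<Longrightarrow> ob (dm s)"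
  using W_arr by (auto simp: roof_def)

lemma roofs_iff: "(s, f) \<in> roofs K S X Y \<longleftrightarrow> roof X Y s f"
  using W_arr by (auto simp: roof_def roofs_def)

abbreviation roof_class where "roof_class s f \<equiv> qclass K S (s, f)"

lemma roof_eq_iff: "roof_eq K S (s, f) (t, g) \<longleftrightarrow>
  (\<exists>u v. arr u \<and> arr v \<and> cd u = dm s \<and> cd v = dm t \<and> dm u = dm v \<and> s \<cdot> u = t \<cdot> v \<and> W (s \<cdot> u) \<and> f \<cdot> u = g \<cdot> v)"
  by (simp add: roof_eq_def)

text \<open>Equivalent roofs agree, after refinement, over any pair \<open>a\<close>,
  \<open>b\<close> that equalizes the denominators, not only over the witnesses \<open>u\<close>,
  \<open>v\<close> of the equivalence. Ore matches \<open>a\<close> with \<open>u\<close>;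
  cancelling \<open>s\<close> and then \<open>s1\<close> gives the two refinements \<open>c1\<close>
  and \<open>c2\<close>. Neither \<open>a\<close> nor \<open>b\<close> has to lie in
  \<open>W\<close>, which the well-definedness of composition relies on.\<close>

lemma roof_eq_common:
  assumes r: "roof X Y s f" "roof X Y s1 f1" "roof_eq K S (s, f) (s1, f1)"
    and ab: "arr a" "arr b" "cd a = dm s" "cd b = dm s1" "dm b = dm a" "s \<cdot> a = s1 \<cdot> b"
  obtains c where "W c" "arr c" "cd c = dm a" "f \<cdot> a \<cdot> c = f1 \<cdot> b \<cdot> c"
proof -
  note R = roofD[OF r(1)] roofD[OF r(2)]
  obtain u v where uv: "arr u" "arr v" "cd u = dm s" "cd v = dm s1" "dm u = dm v" "s \<cdot> u = s1 \<cdot> v" "W (s \<cdot> u)" "f \<cdot> u = f1 \<cdot> v"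
    using r(3) unfolding roof_eq_iff by blast
  have sa: "arr (s \<cdot> a)" "cd (s \<cdot> u) = cd (s \<cdot> a)" using R ab uv(1-4) by simp_all
  obtain n m where nm: "W n" "arr n" "cd n = dm (s \<cdot> a)" "arr m" "dm m = dm n" "cd m = dm (s \<cdot> u)" "(s \<cdot> a) \<cdot> n = (s \<cdot> u) \<cdot> m"
    using W_Ore[OF sa(1) uv(7) sa(2)] by blast
  have nm': "cd n = dm a" "cd m = dm u" using nm R ab uv(1-4) by simp_all
  have 1: "s \<cdot> (a \<cdot> n) = s \<cdot> (u \<cdot> m)" using nm nm' R ab(1-5) uv(1-5) by simp
  have an: "arr (a \<cdot> n)" "arr (u \<cdot> m)" "dm (u \<cdot> m) = dm (a \<cdot> n)" "cd (u \<cdot> m) = cd (a \<cdot> n)" "dm s = cd (a \<cdot> n)"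
    using nm nm' R ab(1-5) uv(1-5) by simp_all
  obtain c1 where c1: "W c1" "arr c1" "cd c1 = dm (a \<cdot> n)" "(a \<cdot> n) \<cdot> c1 = (u \<cdot> m) \<cdot> c1"
    using W_cancel[OF R(1) an 1] by blast
  have c1': "cd c1 = dm n" using c1 nm nm' ab by simp
  have 2: "s1 \<cdot> (v \<cdot> (m \<cdot> c1)) = s1 \<cdot> (b \<cdot> (n \<cdot> c1))"
  proof -
    have "s1 \<cdot> (v \<cdot> (m \<cdot> c1)) = (s \<cdot> u) \<cdot> m \<cdot> c1" using uv(6) uv(1-5) nm nm' c1(2) c1' R by simp
    also have "\<dots> = (s \<cdot> a) \<cdot> n \<cdot> c1" using nm nm' c1(2) c1' R ab(1-5) uv(1-5) 1 c1(4) by simp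
    also have "\<dots> = s1 \<cdot> (b \<cdot> (n \<cdot> c1))" unfolding ab(6) using nm nm' c1(2) c1' R ab(1-5) by simp
    finally show ?thesis .
  qed
  have vm: "arr (v \<cdot> (m \<cdot> c1))" "arr (b \<cdot> (n \<cdot> c1))" "dm (b \<cdot> (n \<cdot> c1)) = dm (v \<cdot> (m \<cdot> c1))"
     "cd (b \<cdot> (n \<cdot> c1)) = cd (v \<cdot> (m \<cdot> c1))" "dm s1 = cd (v \<cdot> (m \<cdot> c1))"
    using nm nm' c1(2) c1' R ab(1-5) uv(1-5) by simp_all
  obtain c2 where c2: "W c2" "arr c2" "cd c2 = dm (v \<cdot> (m \<cdot> c1))" "(v \<cdot> (m \<cdot> c1)) \<cdot> c2 = (b \<cdot> (n \<cdot> c1)) \<cdot> c2"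
    using W_cancel[OF R(10) vm 2] by blast
  have c2': "cd c2 = dm c1" using c2(3) nm nm' c1(2) c1' R ab(1-5) uv(1-5) by simp
  note T = nm(2,4,5) nm' c1(2) c1' c2(2) c2' R(2-9) R(11-) ab(1-5) uv(1-5)
  have "f \<cdot> a \<cdot> (n \<cdot> c1 \<cdot> c2) = f \<cdot> ((a \<cdot> n) \<cdot> c1) \<cdot> c2" using T by simp
  also have "\<dots> = (f \<cdot> u) \<cdot> (m \<cdot> c1) \<cdot> c2" unfolding c1(4) using T by simp
  also have "\<dots> = f1 \<cdot> (v \<cdot> (m \<cdot> c1)) \<cdot> c2" unfolding uv(8) using T by simp
  also have "\<dots> = f1 \<cdot> b \<cdot> (n \<cdot> c1 \<cdot> c2)" unfolding c2(4) using T by simp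
  finally have 3: "f \<cdot> a \<cdot> (n \<cdot> c1 \<cdot> c2) = f1 \<cdot> b \<cdot> (n \<cdot> c1 \<cdot> c2)" .
  have "W (n \<cdot> c1 \<cdot> c2)" using W_cmp nm(1) c1(1) c2(1) T by simp
  then show ?thesis using that[of "n \<cdot> c1 \<cdot> c2"] 3 T by simp
qed

lemma roof_eqI:
  assumes "arr u" "arr v" "cd u = dm s" "cd v = dm t" "dm v = dm u" "s \<cdot> u = t \<cdot> v" "W (s \<cdot> u)" "f \<cdot> u = g \<cdot> v"
  shows "roof_eq K S (s, f) (t, g)"
  using assms unfolding roof_eq_iff by metis

lemma roof_eq_refl: "roof X Y s f \<Longrightarrow> roof_eq K S (s, f) (s, f)"
  by (rule roof_eqI[of "one (dm s)" "one (dm s)"]) (use roofD[of X Y s f] in simp_all)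

lemma roof_eq_sym: "roof_eq K S (s, f) (t, g) \<Longrightarrow> roof_eq K S (t, g) (s, f)"
  unfolding roof_eq_iff by metis

text \<open>Ore for \<open>s1 v\<close> and \<open>s2\<close> yields a refinement shared by all
  three denominators, and \<open>roof_eq_common\<close> then equalizes the last two
  numerators.\<close>

lemma roof_eq_trans:
  assumes r: "roof X Y s f" "roof X Y s1 f1" "roof X Y s2 f2"
    and e: "roof_eq K S (s, f) (s1, f1)" "roof_eq K S (s1, f1) (s2, f2)"
  shows "roof_eq K S (s, f) (s2, f2)"
proof -
  note R = roofD[OF r(1)] roofD[OF r(2)] roofD[OF r(3)]
  obtain u v where uv: "arr u" "arr v" "cd u = dm s" "cd v = dm s1" "dm u = dm v" "s \<cdot> u = s1 \<cdot> v" "W (s \<cdot> u)" "f \<cdot> u = f1 \<cdot> v"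
    using e(1) unfolding roof_eq_iff by blast
  obtain n m where nm: "W n" "arr n" "cd n = dm (s1 \<cdot> v)" "arr m" "dm m = dm n" "cd m = dm s2" "(s1 \<cdot> v) \<cdot> n = s2 \<cdot> m"
    by (rule W_Ore[of "s1 \<cdot> v" s2]) (use R uv in simp_all)
  have nm': "cd n = dm v" using nm(3) R uv by simp
  note T = R uv(1-5) nm(2,4,5,6) nm'
  obtain c where c: "W c" "arr c" "cd c = dm (v \<cdot> n)" "f1 \<cdot> (v \<cdot> n) \<cdot> c = f2 \<cdot> m \<cdot> c"
    by (rule roof_eq_common[OF r(2,3) e(2), of "v \<cdot> n" m]) (use T nm(7) in simp_all)
  have c': "cd c = dm n" using c(3) T by simp
  have su: "arr (s1 \<cdot> v)" "W (s1 \<cdot> v)" using uv T by simp_all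
  show ?thesis
  proof (rule roof_eqI[of "u \<cdot> n \<cdot> c" "m \<cdot> c"])
    have "s \<cdot> u \<cdot> n \<cdot> c = (s \<cdot> u) \<cdot> n \<cdot> c" using T c(2) c' by simp
    also have "\<dots> = ((s1 \<cdot> v) \<cdot> n) \<cdot> c" unfolding uv(6) using T c(2) c' by simp
    finally have 1: "s \<cdot> u \<cdot> n \<cdot> c = ((s1 \<cdot> v) \<cdot> n) \<cdot> c" .
    also have "\<dots> = s2 \<cdot> m \<cdot> c" unfolding nm(7) using T c(2) c' by simp
    finally show "s \<cdot> u \<cdot> n \<cdot> c = s2 \<cdot> m \<cdot> c" .
    have "W (((s1 \<cdot> v) \<cdot> n) \<cdot> c)" by (intro W_cmp c nm su) (use T c(2) c' in simp_all)
    then show "W (s \<cdot> u \<cdot> n \<cdot> c)" using 1 by simp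
    have "f \<cdot> u \<cdot> n \<cdot> c = (f \<cdot> u) \<cdot> n \<cdot> c" using T c(2) c' by simp
    also have "\<dots> = f1 \<cdot> (v \<cdot> n) \<cdot> c" unfolding uv(8) using T c(2) c' by simp
    finally show "f \<cdot> u \<cdot> n \<cdot> c = f2 \<cdot> m \<cdot> c" using c(4) by simp
  qed (use T c(2) c' in simp_all)
qed

lemma roof_class_iff: "roof X Y s f \<Longrightarrow> (t, g) \<in> roof_class s f \<longleftrightarrow> roof X Y t g \<and> roof_eq K S (s, f) (t, g)"
  by (simp add: qclass_def roofs_iff roofD)

lemma roof_class_self: "roof X Y s f \<Longrightarrow> (s, f) \<in> roof_class s f"
  by (simp add: roof_class_iff roof_eq_refl)

lemma roof_class_eq: "roof X Y s f \<Longrightarrow> roof X Y t g \<Longrightarrow> roof_class s f = roof_class t g \<longleftrightarrow> roof_eq K S (s, f) (t, g)"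
proof
  assume r: "roof X Y s f" "roof X Y t g"
  show "roof_eq K S (s, f) (t, g)" if "roof_class s f = roof_class t g" using roof_class_self[OF r(2)] roof_class_iff[OF r(1)] that by blast
  show "roof_class s f = roof_class t g" if e: "roof_eq K S (s, f) (t, g)"
  proof (rule set_eqI)
    fix x :: "'b \<times> 'b"
    obtain a b where x: "x = (a, b)" by (cases x)
    show "x \<in> roof_class s f \<longleftrightarrow> x \<in> roof_class t g" unfolding x roof_class_iff[OF r(1)] roof_class_iff[OF r(2)]
      using roof_eq_trans[OF r] roof_eq_trans[OF r(2,1)] e roof_eq_sym[OF e] by blast
  qed
qed

lemma roof_class_eqI:
  assumes "roof X Y s f" "roof X Y t g"
    "arr u" "arr v" "cd u = dm s" "cd v = dm t" "dm v = dm u" "s \<cdot> u = t \<cdot> v" "W (s \<cdot> u)" "f \<cdot> u = g \<cdot> v"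
  shows "roof_class s f = roof_class t g"
  using roof_class_eq[OF assms(1,2)] roof_eqI assms by blast

lemma roof_refine: "roof X Y s f \<Longrightarrow> W u \<Longrightarrow> cd u = dm s \<Longrightarrow> roof X Y (s \<cdot> u) (f \<cdot> u)"
  using W_cmp[of u s] W_arr[of u] by (auto simp: roof_def W_arr)

lemma roof_class_refine: assumes "roof X Y s f" "W u" "cd u = dm s" shows "roof_class (s \<cdot> u) (f \<cdot> u) = roof_class s f"
  using roofD[OF assms(1)] W_arr[OF assms(2)] assms
  by (intro roof_class_eqI[OF roof_refine[OF assms] assms(1), of "one (dm u)" u]) (simp_all add: W_cmp)

section \<open>Operations on classes of roofs\<close>

lemma q_mor_iff: "\<alpha> \<in> q_mor K S \<longleftrightarrow> (\<exists>X Y s f. roof X Y s f \<and> \<alpha> = roof_class s f)"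
proof
  assume "\<alpha> \<in> q_mor K S" then show "\<exists>X Y s f. roof X Y s f \<and> \<alpha> = roof_class s f"
    unfolding q_mor_def by (auto simp: roofs_iff)
next
  assume "\<exists>X Y s f. roof X Y s f \<and> \<alpha> = roof_class s f"
  then show "\<alpha> \<in> q_mor K S" unfolding q_mor_def using roofs_iff roofD(7,8) by blast
qed

lemma q_dom_roof_class: assumes "roof X Y s f" shows "q_dom K (roof_class s f) = X" "q_cod K (roof_class s f) = Y"
proof -
  have "(SOME r. r \<in> roof_class s f) \<in> roof_class s f" using roof_class_self[OF assms] by (rule someI)
  then obtain t g where "(SOME r. r \<in> roof_class s f) = (t, g)" "roof X Y t g"
    using roof_class_iff[OF assms] by (metis surj_pair)
  then show "q_dom K (roof_class s f) = X" "q_cod K (roof_class s f) = Y"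
    by (simp_all add: q_dom_def q_cod_def roofD)
qed

text \<open>Independence of the representatives and of the Ore completion. Ore matches
  \<open>s u\<close> with \<open>s1 u1\<close>; the refinement \<open>c\<close> reconciles the
  numerators \<open>f\<close> and \<open>f1\<close>, and then \<open>d\<close> reconciles
  \<open>g\<close> and \<open>g1\<close> along \<open>h\<close> and \<open>h1\<close>, which are
  arbitrary morphisms.\<close>

lemma q_comp_roof_class:
  assumes r: "roof X Y s f" "roof Y Z t g" and u: "W u" "cd u = dm s" and h: "arr h" "dm h = dm u" "cd h = dm t"
    and eq: "f \<cdot> u = t \<cdot> h"
  shows "q_comp K S (roof_class t g) (roof_class s f) = roof_class (s \<cdot> u) (g \<cdot> h)" and "roof X Z (s \<cdot> u) (g \<cdot> h)"
proof -
  have rr: "roof X Z (s \<cdot> u) (g \<cdot> h)" if "roof X Y s f" "roof Y Z t g" "W u" "cd u = dm s" "arr h" "dm h = dm u" "cd h = dm t"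
    for s f t g u h
    using roofD[OF that(1)] roofD[OF that(2)] W_arr[OF that(3)] that(3-) by (simp add: roof_def W_cmp)
  show rf1: "roof X Z (s \<cdot> u) (g \<cdot> h)" by (rule rr[OF r u h])
  have "roof_class (s1 \<cdot> u1) (g1 \<cdot> h1) = roof_class (s \<cdot> u) (g \<cdot> h)"
    if "(s1, f1) \<in> roof_class s f" "(t1, g1) \<in> roof_class t g" and
      u1: "W u1" "cd u1 = dm s1" and h1: "arr h1" "dm h1 = dm u1" "cd h1 = dm t1" and eq1: "f1 \<cdot> u1 = t1 \<cdot> h1"
    for s1 f1 t1 g1 u1 h1
  proof -
    have r1: "roof X Y s1 f1" "roof Y Z t1 g1" and e: "roof_eq K S (s, f) (s1, f1)" "roof_eq K S (t, g) (t1, g1)"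
      using that(1,2) roof_class_iff r by blast+
    have rf2: "roof X Z (s1 \<cdot> u1) (g1 \<cdot> h1)" by (rule rr[OF r1 u1 h1])
    note R = roofD[OF r(1)] roofD[OF r(2)] roofD[OF r1(1)] roofD[OF r1(2)] W_arr[OF u(1)] W_arr[OF u1(1)] u(2) h u1(2) h1
    obtain a b where ab: "W a" "arr a" "cd a = dm (s \<cdot> u)" "arr b" "dm b = dm a" "cd b = dm (s1 \<cdot> u1)" "(s \<cdot> u) \<cdot> a = (s1 \<cdot> u1) \<cdot> b"
      by (rule W_Ore[of "s \<cdot> u" "s1 \<cdot> u1"]) (use R roofD(1)[OF rf2] in simp_all)
    have ab': "cd a = dm u" "cd b = dm u1" using ab R by simp_all
    note T = R ab(2,4,5) ab'
    obtain c where c: "W c" "arr c" "cd c = dm (u \<cdot> a)" "f \<cdot> (u \<cdot> a) \<cdot> c = f1 \<cdot> (u1 \<cdot> b) \<cdot> c"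
      by (rule roof_eq_common[OF r(1) r1(1) e(1), of "u \<cdot> a" "u1 \<cdot> b"]) (use T ab(7) in simp_all)
    have c': "cd c = dm a" using c T by simp
    have "t \<cdot> (h \<cdot> a \<cdot> c) = (f \<cdot> u) \<cdot> a \<cdot> c" unfolding eq using T c(2) c' by simp
    also have "\<dots> = (f1 \<cdot> u1) \<cdot> b \<cdot> c" using c(4) T c(2) c' by simp
    also have "\<dots> = t1 \<cdot> (h1 \<cdot> b \<cdot> c)" unfolding eq1 using T c(2) c' by simp
    finally have 1: "t \<cdot> (h \<cdot> a \<cdot> c) = t1 \<cdot> (h1 \<cdot> b \<cdot> c)" .
    obtain d where d: "W d" "arr d" "cd d = dm (h \<cdot> a \<cdot> c)" "g \<cdot> (h \<cdot> a \<cdot> c) \<cdot> d = g1 \<cdot> (h1 \<cdot> b \<cdot> c) \<cdot> d"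
      by (rule roof_eq_common[OF r(2) r1(2) e(2), of "h \<cdot> a \<cdot> c" "h1 \<cdot> b \<cdot> c"]) (use T c(2) c' 1 in simp_all)
    have d': "cd d = dm c" using d T c(2) c' by simp
    note T' = T c(2) c' d(2) d'
    have "roof_class (s \<cdot> u) (g \<cdot> h) = roof_class (s1 \<cdot> u1) (g1 \<cdot> h1)"
    proof (rule roof_class_eqI[OF rf1 rf2, of "a \<cdot> c \<cdot> d" "b \<cdot> c \<cdot> d"])
      have "(s \<cdot> u) \<cdot> (a \<cdot> c \<cdot> d) = ((s \<cdot> u) \<cdot> a) \<cdot> c \<cdot> d" using T' by simp
      also have "\<dots> = (s1 \<cdot> u1) \<cdot> (b \<cdot> c \<cdot> d)" unfolding ab(7) using T' by simp
      finally show "(s \<cdot> u) \<cdot> (a \<cdot> c \<cdot> d) = (s1 \<cdot> u1) \<cdot> (b \<cdot> c \<cdot> d)" .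
      show "W ((s \<cdot> u) \<cdot> (a \<cdot> c \<cdot> d))" by (intro W_cmp ab c d roofD(1)[OF rf1]) (use T' in simp_all)
      show "(g \<cdot> h) \<cdot> (a \<cdot> c \<cdot> d) = (g1 \<cdot> h1) \<cdot> (b \<cdot> c \<cdot> d)" using d(4) T' by simp
    qed (use T' in simp_all)
    then show ?thesis by simp
  qed
  then show "q_comp K S (roof_class t g) (roof_class s f) = roof_class (s \<cdot> u) (g \<cdot> h)"
    unfolding q_comp_def
  proof (intro Union_eq_singleton, goal_cases)
    case 1
    then show ?case using roof_class_self[OF r(1)] roof_class_self[OF r(2)] u W_arr[OF u(1)] h eq by blast
  next
    case (2 x)
    then show ?case by auto
  qed
qed

text \<open>The comparison runs as for composition: \<open>c\<close> reconciles the first summands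
  and \<open>d\<close> the second ones.\<close>

lemma q_add_roof_class:
  assumes r: "roof X Y s f" "roof X Y t g" and u: "arr u" "cd u = dm s" and v: "arr v" "dm v = dm u" "cd v = dm t"
    and eq: "s \<cdot> u = t \<cdot> v" "W (s \<cdot> u)"
  shows "q_add K S (roof_class s f) (roof_class t g) = roof_class (s \<cdot> u) (f \<cdot> u \<oplus> g \<cdot> v)" and "roof X Y (s \<cdot> u) (f \<cdot> u \<oplus> g \<cdot> v)"
proof -
  have rr: "roof X Y (s \<cdot> u) (f \<cdot> u \<oplus> g \<cdot> v)" if "roof X Y s f" "roof X Y t g" "arr u" "cd u = dm s" "arr v" "dm v = dm u" "cd v = dm t"
    "s \<cdot> u = t \<cdot> v" "W (s \<cdot> u)" for s f t g u v
    using roofD[OF that(1)] roofD[OF that(2)] that(3-) by (auto simp: roof_def)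
  show rf1: "roof X Y (s \<cdot> u) (f \<cdot> u \<oplus> g \<cdot> v)" by (rule rr[OF r u v eq])
  have "roof_class (s1 \<cdot> u1) (f1 \<cdot> u1 \<oplus> g1 \<cdot> v1) = roof_class (s \<cdot> u) (f \<cdot> u \<oplus> g \<cdot> v)"
    if "(s1, f1) \<in> roof_class s f" "(t1, g1) \<in> roof_class t g" and
      u1: "arr u1" "cd u1 = dm s1" and v1: "arr v1" "dm v1 = dm u1" "cd v1 = dm t1" and eq1: "s1 \<cdot> u1 = t1 \<cdot> v1" "W (s1 \<cdot> u1)"
    for s1 f1 t1 g1 u1 v1
  proof -
    have r1: "roof X Y s1 f1" "roof X Y t1 g1" and e: "roof_eq K S (s, f) (s1, f1)" "roof_eq K S (t, g) (t1, g1)"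
      using that(1,2) roof_class_iff r by blast+
    have rf2: "roof X Y (s1 \<cdot> u1) (f1 \<cdot> u1 \<oplus> g1 \<cdot> v1)" by (rule rr[OF r1 u1 v1 eq1])
    note R = roofD[OF r(1)] roofD[OF r(2)] roofD[OF r1(1)] roofD[OF r1(2)] u v u1 v1
    obtain a b where ab: "W a" "arr a" "cd a = dm (s \<cdot> u)" "arr b" "dm b = dm a" "cd b = dm (s1 \<cdot> u1)" "(s \<cdot> u) \<cdot> a = (s1 \<cdot> u1) \<cdot> b"
      by (rule W_Ore[of "s \<cdot> u" "s1 \<cdot> u1"]) (use R roofD(1)[OF rf2] in simp_all)
    have ab': "cd a = dm u" "cd b = dm u1" using ab R by simp_all
    note T = R ab(2,4,5) ab'
    obtain c where c: "W c" "arr c" "cd c = dm (u \<cdot> a)" "f \<cdot> (u \<cdot> a) \<cdot> c = f1 \<cdot> (u1 \<cdot> b) \<cdot> c"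
      by (rule roof_eq_common[OF r(1) r1(1) e(1), of "u \<cdot> a" "u1 \<cdot> b"]) (use T ab(7) in simp_all)
    have c': "cd c = dm a" using c T by simp
    have "t \<cdot> (v \<cdot> a \<cdot> c) = (s \<cdot> u) \<cdot> a \<cdot> c" unfolding eq using T c(2) c' by simp
    also have "\<dots> = ((s \<cdot> u) \<cdot> a) \<cdot> c" using T c(2) c' by simp
    also have "\<dots> = (s1 \<cdot> u1) \<cdot> b \<cdot> c" unfolding ab(7) using T c(2) c' by simp
    also have "\<dots> = t1 \<cdot> (v1 \<cdot> b \<cdot> c)" unfolding eq1 using T c(2) c' by simp
    finally have 1: "t \<cdot> (v \<cdot> a \<cdot> c) = t1 \<cdot> (v1 \<cdot> b \<cdot> c)" .
    obtain d where d: "W d" "arr d" "cd d = dm (v \<cdot> a \<cdot> c)" "g \<cdot> (v \<cdot> a \<cdot> c) \<cdot> d = g1 \<cdot> (v1 \<cdot> b \<cdot> c) \<cdot> d"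
      by (rule roof_eq_common[OF r(2) r1(2) e(2), of "v \<cdot> a \<cdot> c" "v1 \<cdot> b \<cdot> c"]) (use T c(2) c' 1 in simp_all)
    have d': "cd d = dm c" using d T c(2) c' by simp
    note T' = T c(2) c' d(2) d'
    have "roof_class (s \<cdot> u) (f \<cdot> u \<oplus> g \<cdot> v) = roof_class (s1 \<cdot> u1) (f1 \<cdot> u1 \<oplus> g1 \<cdot> v1)"
    proof (rule roof_class_eqI[OF rf1 rf2, of "a \<cdot> c \<cdot> d" "b \<cdot> c \<cdot> d"])
      have "(s \<cdot> u) \<cdot> (a \<cdot> c \<cdot> d) = ((s \<cdot> u) \<cdot> a) \<cdot> c \<cdot> d" using T' by simp
      also have "\<dots> = (s1 \<cdot> u1) \<cdot> (b \<cdot> c \<cdot> d)" unfolding ab(7) using T' by simp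
      finally show "(s \<cdot> u) \<cdot> (a \<cdot> c \<cdot> d) = (s1 \<cdot> u1) \<cdot> (b \<cdot> c \<cdot> d)" .
      show "W ((s \<cdot> u) \<cdot> (a \<cdot> c \<cdot> d))" by (intro W_cmp ab c d roofD(1)[OF rf1]) (use T' in simp_all)
      have 2: "g \<cdot> v \<cdot> a \<cdot> c \<cdot> d = g1 \<cdot> v1 \<cdot> b \<cdot> c \<cdot> d" using d(4) T' by simp
      have "(f \<cdot> (u \<cdot> a) \<cdot> c) \<cdot> d = (f1 \<cdot> (u1 \<cdot> b) \<cdot> c) \<cdot> d" using c(4) by simp
      then have 3: "f \<cdot> u \<cdot> a \<cdot> c \<cdot> d = f1 \<cdot> u1 \<cdot> b \<cdot> c \<cdot> d" using T' by simp
      show "(f \<cdot> u \<oplus> g \<cdot> v) \<cdot> (a \<cdot> c \<cdot> d) = (f1 \<cdot> u1 \<oplus> g1 \<cdot> v1) \<cdot> (b \<cdot> c \<cdot> d)" using 2 3 T' by simp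
    qed (use T' in simp_all)
    then show ?thesis by simp
  qed
  then show "q_add K S (roof_class s f) (roof_class t g) = roof_class (s \<cdot> u) (f \<cdot> u \<oplus> g \<cdot> v)"
    unfolding q_add_def
  proof (intro Union_eq_singleton, goal_cases)
    case 1
    then show ?case using roof_class_self[OF r(1)] roof_class_self[OF r(2)] u v eq by (smt (verit) mem_Collect_eq)
  next
    case (2 x)
    then show ?case by (smt (verit) mem_Collect_eq)
  qed
qed

lemma q_neg_roof_class:
  assumes r: "roof X Y s f"
  shows "q_neg K S (roof_class s f) = roof_class s (mns f)" and "roof X Y s (mns f)"
proof -
  have rr: "roof X Y s (mns f)" if "roof X Y s f" for s f
    using roofD[OF that] by (simp add: roof_def)
  show "roof X Y s (mns f)" by (rule rr[OF r])
  have "roof_class s1 (mns f1) = roof_class s (mns f)" if "(s1, f1) \<in> roof_class s f" for s1 f1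
  proof -
    have r1: "roof X Y s1 f1" and e: "roof_eq K S (s, f) (s1, f1)"
      using that roof_class_iff r by blast+
    obtain u v where uv: "arr u" "arr v" "cd u = dm s" "cd v = dm s1" "dm u = dm v" "s \<cdot> u = s1 \<cdot> v" "W (s \<cdot> u)" "f \<cdot> u = f1 \<cdot> v"
      using e(1) unfolding roof_eq_iff by blast
    have "roof_class s (mns f) = roof_class s1 (mns f1)"
      by (rule roof_class_eqI[OF rr[OF r] rr[OF r1] uv(1,2,3,4) uv(5)[symmetric] uv(6,7)]) (use roofD[OF r] roofD[OF r1] uv in simp)
    then show ?thesis by simp
  qed
  then show "q_neg K S (roof_class s f) = roof_class s (mns f)"
    unfolding q_neg_def by (intro Union_eq_singleton) (use roof_class_self[OF r] in blast)+
qed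

lemma q_shM_roof_class:
  assumes r: "roof X Y s f"
  shows "q_shM K S (roof_class s f) = roof_class (Sh s) (Sh f)" and "roof (So X) (So Y) (Sh s) (Sh f)"
proof -
  have rr: "roof (So X) (So Y) (Sh s) (Sh f)" if "roof X Y s f" for s f
    using roofD[OF that] W_Sh by (simp add: roof_def)
  show "roof (So X) (So Y) (Sh s) (Sh f)" by (rule rr[OF r])
  have "roof_class (Sh s1) (Sh f1) = roof_class (Sh s) (Sh f)" if "(s1, f1) \<in> roof_class s f" for s1 f1
  proof -
    have r1: "roof X Y s1 f1" and e: "roof_eq K S (s, f) (s1, f1)"
      using that roof_class_iff r by blast+
    note R = roofD[OF r] roofD[OF r1]
    obtain u v where uv: "arr u" "arr v" "cd u = dm s" "cd v = dm s1" "dm u = dm v" "s \<cdot> u = s1 \<cdot> v" "W (s \<cdot> u)" "f \<cdot> u = f1 \<cdot> v"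
      using e(1) unfolding roof_eq_iff by blast
    have "arr (s \<cdot> u)" using R uv(1-5) by simp
    then have "W (Sh (s \<cdot> u))" using W_Sh uv(7) by blast
    moreover have "Sh (s \<cdot> u) = Sh (s1 \<cdot> v)" "Sh (f \<cdot> u) = Sh (f1 \<cdot> v)" using uv by simp_all
    ultimately have "roof_class (Sh s) (Sh f) = roof_class (Sh s1) (Sh f1)"
      by (intro roof_class_eqI[OF rr[OF r] rr[OF r1], of "Sh u" "Sh v"]) (use R uv(1-5) in simp_all)
    then show ?thesis by simp
  qed
  then show "q_shM K S (roof_class s f) = roof_class (Sh s) (Sh f)"
    unfolding q_shM_def by (intro Union_eq_singleton) (use roof_class_self[OF r] in blast)+
qed

end

section \<open>The Verdier quotient as an additive category with shift\<close>

context triangulated_subcategory begin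

abbreviation V where "V \<equiv> verdier K S"
abbreviation q where "q \<equiv> q_fun K S"

lemma verdier_sel:
  "t_ob V = t_ob K" "t_mor V = q_mor K S" "t_dom V = q_dom K" "t_cod V = q_cod K" "t_comp V = q_comp K S"
  "t_id V X = q (one X)" "t_add V = q_add K S" "t_neg V = q_neg K S" "t_zero V X Y = q (nul X Y)"
  "t_shO V = So" "t_shM V = q_shM K S"
  by (simp_all add: verdier_def verdier_pre_def)

lemma V_hom: "\<alpha> \<in> hom V X Y \<longleftrightarrow> (\<exists>s f. roof X Y s f \<and> \<alpha> = roof_class s f)"
  by (simp add: hom_def verdier_sel q_mor_iff) (metis q_dom_roof_class)

lemma V_homE: assumes "\<alpha> \<in> hom V X Y" obtains s f where "roof X Y s f" "\<alpha> = roof_class s f"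
  using assms V_hom by blast

lemma V_mor_hom: "\<alpha> \<in> t_mor V \<Longrightarrow> \<alpha> \<in> hom V (t_dom V \<alpha>) (t_cod V \<alpha>)"
  by (simp add: hom_def)

lemma roof_one: "arr f \<Longrightarrow> roof (dm f) (cd f) (one (dm f)) f"
  by (simp add: roof_def)

lemma q_def: "q f = roof_class (one (dm f)) f"
  by (simp add: q_fun_def)

lemma q_hom: "arr f \<Longrightarrow> q f \<in> hom V (dm f) (cd f)"
  using V_hom roof_one q_def by blast

lemma q_cmp: assumes "arr f" "arr g" "dm g = cd f" shows "q_comp K S (q g) (q f) = q (g \<cdot> f)"
  using q_comp_roof_class(1)[OF roof_one[OF assms(1)] roof_one[OF assms(2), unfolded assms(3)], of "one (dm f)" f] assms
  by (simp add: q_def)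

text \<open>Over one denominator, addition of classes is addition of numerators
  (\<open>q_add_common\<close>). This reduces the group laws of the quotient to those of the
  original category.\<close>

lemma common_denominator:
  assumes "roof X Y s f" "roof X Y' t g"
  obtains r f' g' where "roof X Y r f'" "roof X Y' r g'" "roof_class s f = roof_class r f'" "roof_class t g = roof_class r g'"
proof -
  note R = roofD[OF assms(1)] roofD[OF assms(2)]
  obtain u h where u: "W u" "arr u" "cd u = dm s" "arr h" "dm h = dm u" "cd h = dm t" "s \<cdot> u = t \<cdot> h"
    by (rule W_Ore[of s t]) (use R in simp_all)
  have "W (t \<cdot> h)" unfolding u(7)[symmetric] by (intro W_cmp u R) (use u in simp)
  then have h: "W h" using W_2of3(2)[of h t] R u by simp
  show ?thesis
    using that[of "s \<cdot> u" "f \<cdot> u" "g \<cdot> h"] roof_class_refine[OF assms(1) u(1,3)] roof_class_refine[OF assms(2) h u(6)]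
      roof_refine[OF assms(1) u(1,3)] roof_refine[OF assms(2) h u(6)] u(7) by simp
qed

lemma common_denominator3:
  assumes "roof X Y s f" "roof X Y t g" "roof X Y r h"
  obtains r' f' g' h' where "roof X Y r' f'" "roof X Y r' g'" "roof X Y r' h'" "roof_class s f = roof_class r' f'" "roof_class t g = roof_class r' g'" "roof_class r h = roof_class r' h'"
proof -
  obtain a f1 g1 where 1: "roof X Y a f1" "roof X Y a g1" "roof_class s f = roof_class a f1" "roof_class t g = roof_class a g1"
    by (rule common_denominator[OF assms(1,2)])
  note R = roofD[OF 1(1)] roofD[OF 1(2)] roofD[OF assms(3)]
  obtain u k where u: "W u" "arr u" "cd u = dm a" "arr k" "dm k = dm u" "cd k = dm r" "a \<cdot> u = r \<cdot> k"
    by (rule W_Ore[of a r]) (use R in simp_all)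
  have "W (r \<cdot> k)" unfolding u(7)[symmetric] by (intro W_cmp u R) (use u in simp)
  then have k: "W k" using W_2of3(2)[of k r] R u by simp
  show ?thesis
    using that[of "a \<cdot> u" "f1 \<cdot> u" "g1 \<cdot> u" "h \<cdot> k"] roof_class_refine[OF 1(1) u(1,3)] roof_class_refine[OF 1(2) u(1,3)] roof_class_refine[OF assms(3) k u(6)]
      roof_refine[OF 1(1) u(1,3)] roof_refine[OF 1(2) u(1,3)] roof_refine[OF assms(3) k u(6)] u(7) 1(3,4) by simp
qed

lemma q_add_common:
  assumes "roof X Y s f" "roof X Y s g" shows "q_add K S (roof_class s f) (roof_class s g) = roof_class s (f \<oplus> g)" "roof X Y s (f \<oplus> g)"
  using q_add_roof_class[OF assms, of "one (dm s)" "one (dm s)"] roofD[OF assms(1)] roofD[OF assms(2)] by simp_all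

lemma q_nul_roof_class: assumes "W s" "ob Y" shows "q (nul (cd s) Y) = roof_class s (nul (dm s) Y)"
proof -
  have "roof (cd s) Y (one (cd s)) (nul (cd s) Y)" using assms W_arr by (simp add: roof_def)
  from roof_class_refine[OF this assms(1)] show ?thesis using assms W_arr by (simp add: q_def)
qed

text \<open>Equivalence with the zero roof says that a refinement in \<open>W\<close> kills the
  numerator, and such refinements exist precisely for morphisms that factor through
  \<open>S\<close>.\<close>

lemma roof_class_eq_nul: assumes r: "roof X Y s f" shows "roof_class s f = q (nul X Y) \<longleftrightarrow> factors f"
proof -
  note R = roofD[OF r]
  have r0: "roof X Y s (nul (dm s) Y)" using R by (simp add: roof_def)
  have *: "q (nul X Y) = roof_class s (nul (dm s) Y)" using q_nul_roof_class[of s Y] R by simp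
  show ?thesis
  proof
    assume "roof_class s f = q (nul X Y)"
    then have "roof_eq K S (s, f) (s, nul (dm s) Y)" unfolding * using roof_class_eq[OF r r0] by simp
    then obtain u v where uv: "arr u" "arr v" "cd u = dm s" "cd v = dm s" "dm u = dm v" "W (s \<cdot> u)" "f \<cdot> u = nul (dm s) Y \<cdot> v"
      unfolding roof_eq_iff by blast
    have "W u" using W_2of3(2)[of u s] R uv by simp
    then show "factors f" using factors_if_pre[of u f] R uv by simp
  next
    assume "factors f"
    then obtain u where u: "W u" "arr u" "cd u = dm f" "f \<cdot> u = nul (dm u) (cd f)" by (rule factors_kill_pre)
    show "roof_class s f = q (nul X Y)" unfolding *
      by (rule roof_class_eqI[OF r r0, of u u]) (use R u W_cmp in simp_all)
  qed
qed

lemma q_eq_nul: "arr f \<Longrightarrow> dm f = X \<Longrightarrow> cd f = Y \<Longrightarrow> q f = q (nul X Y) \<longleftrightarrow> factors f"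
  using roof_class_eq_nul[OF roof_one[of f]] by (simp add: q_def)

lemma V_cmp_hom: assumes "\<alpha> \<in> hom V X Y" "\<beta> \<in> hom V Y Z" shows "q_comp K S \<beta> \<alpha> \<in> hom V X Z"
proof -
  obtain s f where r: "roof X Y s f" and a: "\<alpha> = roof_class s f" using assms(1) by (rule V_homE)
  obtain t g where r': "roof Y Z t g" and b: "\<beta> = roof_class t g" using assms(2) by (rule V_homE)
  obtain u h where u: "W u" "arr u" "cd u = dm s" "arr h" "dm h = dm u" "cd h = dm t" "f \<cdot> u = t \<cdot> h"
    by (rule W_Ore[of f t]) (use roofD[OF r] roofD[OF r'] in simp_all)
  show ?thesis using q_comp_roof_class[OF r r' u(1,3,4,5,6,7)] V_hom a b by auto
qed

lemma V_assoc:
  assumes "\<alpha> \<in> hom V X Y" "\<beta> \<in> hom V Y Z" "\<gamma> \<in> hom V Z A"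
  shows "q_comp K S \<gamma> (q_comp K S \<beta> \<alpha>) = q_comp K S (q_comp K S \<gamma> \<beta>) \<alpha>"
proof -
  obtain s f where 1: "roof X Y s f" and a: "\<alpha> = roof_class s f" using assms(1) by (rule V_homE)
  obtain t g where 2: "roof Y Z t g" and b: "\<beta> = roof_class t g" using assms(2) by (rule V_homE)
  obtain r k where 3: "roof Z A r k" and c: "\<gamma> = roof_class r k" using assms(3) by (rule V_homE)
  note R = roofD[OF 1] roofD[OF 2] roofD[OF 3]
  obtain w l where w: "W w" "arr w" "cd w = dm t" "arr l" "dm l = dm w" "cd l = dm r" "g \<cdot> w = r \<cdot> l"
    by (rule W_Ore[of g r]) (use R in simp_all)
  have gb: "q_comp K S \<gamma> \<beta> = roof_class (t \<cdot> w) (k \<cdot> l)" "roof Y A (t \<cdot> w) (k \<cdot> l)"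
    unfolding b c by (rule q_comp_roof_class[OF 2 3 w(1,3-7)])+
  obtain u h where u: "W u" "arr u" "cd u = dm s" "arr h" "dm h = dm u" "cd h = dm w" "f \<cdot> u = (t \<cdot> w) \<cdot> h"
    by (rule W_Ore[of f "t \<cdot> w"]) (use R w roofD[OF gb(2)] in simp_all)
  note T = R w(2-6) u(2-6)
  have gba: "q_comp K S (q_comp K S \<gamma> \<beta>) \<alpha> = roof_class (s \<cdot> u) ((k \<cdot> l) \<cdot> h)"
    unfolding gb(1) a by (rule q_comp_roof_class(1)[OF 1 gb(2) u(1,3,4,5)]) (use T u(7) in simp_all)
  have ba: "q_comp K S \<beta> \<alpha> = roof_class (s \<cdot> u) (g \<cdot> w \<cdot> h)" "roof X Z (s \<cdot> u) (g \<cdot> w \<cdot> h)"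
    unfolding a b by (rule q_comp_roof_class[OF 1 2 u(1,3)]; use T u(7) in simp)+
  have "q_comp K S \<gamma> (q_comp K S \<beta> \<alpha>) = roof_class ((s \<cdot> u) \<cdot> one (dm u)) (k \<cdot> l \<cdot> h)"
    unfolding c ba(1)
    by (rule q_comp_roof_class(1)[OF ba(2) 3]) (use T reassoc[OF w(7), of h] in simp_all)
  then show ?thesis unfolding gba using T by simp
qed

lemma V_cmp_one: assumes "\<alpha> \<in> hom V X Y" shows "q_comp K S \<alpha> (q (one X)) = \<alpha>" "q_comp K S (q (one Y)) \<alpha> = \<alpha>"
proof -
  obtain s f where 1: "roof X Y s f" and a: "\<alpha> = roof_class s f" using assms(1) by (rule V_homE)
  note R = roofD[OF 1]
  have qX: "q (one X) = roof_class (one X) (one X)" "roof X X (one X) (one X)" using q_def[of "one X"] roof_one[of "one X"] R by simp_all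
  have qY: "q (one Y) = roof_class (one Y) (one Y)" "roof Y Y (one Y) (one Y)" using q_def[of "one Y"] roof_one[of "one Y"] R by simp_all
  show "q_comp K S \<alpha> (q (one X)) = \<alpha>"
    unfolding a qX(1) by (subst q_comp_roof_class(1)[OF qX(2) 1, of s "one (dm s)"]) (use R in simp_all)
  show "q_comp K S (q (one Y)) \<alpha> = \<alpha>"
    unfolding a qY(1) by (subst q_comp_roof_class(1)[OF 1 qY(2), of "one (dm s)" f]) (use R in simp_all)
qed

lemma V_category: "category_ax V"
  unfolding category_ax_def
proof (intro conjI ballI impI)
  show "t_dom V f \<in> t_ob V" "t_cod V f \<in> t_ob V" if fV: "f \<in> t_mor V" for f
  proof -
    obtain X Y s g where r: "roof X Y s g" "f = roof_class s g" using fV unfolding verdier_sel q_mor_iff by blast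
    show "t_dom V f \<in> t_ob V" "t_cod V f \<in> t_ob V" using q_dom_roof_class[OF r(1)] r(2) roofD[OF r(1)] by (simp_all add: verdier_sel)
  qed
  show "t_id V X \<in> hom V X X" if "X \<in> t_ob V" for X
    using q_hom[of "one X"] that by (simp add: verdier_sel)
  show "t_comp V g f \<in> hom V X Z" if "f \<in> hom V X Y" "g \<in> hom V Y Z" for X Y Z f g
    using V_cmp_hom[OF that] by (simp add: verdier_sel)
  show "t_comp V f (t_id V (t_dom V f)) = f" "t_comp V (t_id V (t_cod V f)) f = f" if "f \<in> t_mor V" for f
    using V_cmp_one[OF V_mor_hom[OF that]] by (simp_all add: verdier_sel)
  show "t_comp V h (t_comp V g f) = t_comp V (t_comp V h g) f"
    if "f \<in> t_mor V" "g \<in> t_mor V" "h \<in> t_mor V" "t_cod V f = t_dom V g" "t_cod V g = t_dom V h" for f g h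
    using V_assoc V_mor_hom[OF that(1)] V_mor_hom[OF that(2)] V_mor_hom[OF that(3)] that(4,5) by (simp add: verdier_sel)
qed

lemma V_distrib:
  assumes "\<alpha> \<in> hom V X Y" "\<alpha>' \<in> hom V X Y" "\<beta> \<in> hom V Y Z" "\<beta>' \<in> hom V Y Z"
  shows "q_comp K S \<beta> (q_add K S \<alpha> \<alpha>') = q_add K S (q_comp K S \<beta> \<alpha>) (q_comp K S \<beta> \<alpha>')" (is ?A)
    and "q_comp K S (q_add K S \<beta> \<beta>') \<alpha> = q_add K S (q_comp K S \<beta> \<alpha>) (q_comp K S \<beta>' \<alpha>)" (is ?B)
proof -
  obtain s0 f0 s1 f1 where "roof X Y s0 f0" "roof X Y s1 f1" "\<alpha> = roof_class s0 f0" "\<alpha>' = roof_class s1 f1"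
    using assms(1,2) by (elim V_homE)
  then obtain s f f' where 1: "roof X Y s f" "roof X Y s f'" and a: "\<alpha> = roof_class s f" "\<alpha>' = roof_class s f'"
    using common_denominator by metis
  obtain t0 g0 t1 g1 where "roof Y Z t0 g0" "roof Y Z t1 g1" "\<beta> = roof_class t0 g0" "\<beta>' = roof_class t1 g1"
    using assms(3,4) by (elim V_homE)
  then obtain t g g' where 2: "roof Y Z t g" "roof Y Z t g'" and b: "\<beta> = roof_class t g" "\<beta>' = roof_class t g'"
    using common_denominator by metis
  note R = roofD[OF 1(1)] roofD[OF 1(2)] roofD[OF 2(1)] roofD[OF 2(2)]
  \<comment> \<open>One refinement \<open>u w\<close> of the denominator serves both numerators:
    \<open>u\<close> completes the square for \<open>f\<close>, and \<open>w\<close> then repairs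
    the one for \<open>f'\<close>.\<close>
  obtain u h where u: "W u" "arr u" "cd u = dm s" "arr h" "dm h = dm u" "cd h = dm t" "f \<cdot> u = t \<cdot> h"
    by (rule W_Ore[of f t]) (use R in simp_all)
  note T = R u(2-6)
  obtain w k where w: "W w" "arr w" "cd w = dm u" "arr k" "dm k = dm w" "cd k = dm t" "(f' \<cdot> u) \<cdot> w = t \<cdot> k"
    by (rule W_Ore[of "f' \<cdot> u" t]) (use T in simp_all)
  note T = T w(2-6)
  have uw: "W (u \<cdot> w)" using u w W_cmp by simp
  have e1: "f \<cdot> (u \<cdot> w) = t \<cdot> (h \<cdot> w)" using T reassoc[OF u(7), of w] by simp
  have e2: "f' \<cdot> (u \<cdot> w) = t \<cdot> k" using T w(7) by simp
  have ba: "q_comp K S \<beta> \<alpha> = roof_class (s \<cdot> u \<cdot> w) (g \<cdot> h \<cdot> w)" "roof X Z (s \<cdot> u \<cdot> w) (g \<cdot> h \<cdot> w)"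
    unfolding a b by (rule q_comp_roof_class[OF 1(1) 2(1) uw]; use T e1 in simp)+
  have ba': "q_comp K S \<beta> \<alpha>' = roof_class (s \<cdot> u \<cdot> w) (g \<cdot> k)" "roof X Z (s \<cdot> u \<cdot> w) (g \<cdot> k)"
    unfolding a b by (rule q_comp_roof_class[OF 1(2) 2(1) uw]; use T e2 in simp)+
  have b'a: "q_comp K S \<beta>' \<alpha> = roof_class (s \<cdot> u \<cdot> w) (g' \<cdot> h \<cdot> w)" "roof X Z (s \<cdot> u \<cdot> w) (g' \<cdot> h \<cdot> w)"
    unfolding a b by (rule q_comp_roof_class[OF 1(1) 2(2) uw]; use T e1 in simp)+
  have "q_comp K S \<beta> (q_add K S \<alpha> \<alpha>') = roof_class (s \<cdot> u \<cdot> w) (g \<cdot> (h \<cdot> w \<oplus> k))"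
    unfolding a b q_add_common(1)[OF 1]
    by (rule q_comp_roof_class(1)[OF q_add_common(2)[OF 1] 2(1) uw]) (use T e1 e2 in simp_all)
  then show ?A unfolding ba(1) ba'(1) q_add_common(1)[OF ba(2) ba'(2)] using T by simp
  have "q_comp K S (q_add K S \<beta> \<beta>') \<alpha> = roof_class (s \<cdot> u \<cdot> w) ((g \<oplus> g') \<cdot> h \<cdot> w)"
    unfolding a b q_add_common(1)[OF 2]
    by (rule q_comp_roof_class(1)[OF 1(1) q_add_common(2)[OF 2] uw]) (use T e1 in simp_all)
  then show ?B unfolding ba(1) b'a(1) q_add_common(1)[OF ba(2) b'a(2)] using T by simp
qed

lemma V_preadditive: "preadditive_ax V"
  unfolding preadditive_ax_def
proof (intro conjI ballI)
  fix X Y assume "X \<in> t_ob V" "Y \<in> t_ob V"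
  then have XY: "ob X" "ob Y" by (simp_all add: verdier_sel)
  show "t_zero V X Y \<in> hom V X Y" using q_hom[of "nul X Y"] XY by (simp add: verdier_sel)
  have nul_roof_class: "t_zero V X Y = roof_class s (nul (dm s) Y)" if "roof X Y s f" for s f
    using q_nul_roof_class[of s Y] roofD[OF that] by (simp add: verdier_sel)
  show "t_add V f g \<in> hom V X Y" "t_add V f g = t_add V g f" if fg: "f \<in> hom V X Y" "g \<in> hom V X Y" for f g
  proof -
    obtain s0 f0 s1 f1 where "roof X Y s0 f0" "roof X Y s1 f1" "f = roof_class s0 f0" "g = roof_class s1 f1"
      using fg by (elim V_homE)
    then obtain s f1 g1 where 1: "roof X Y s f1" "roof X Y s g1" and a: "f = roof_class s f1" "g = roof_class s g1"
      using common_denominator by metis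
    show "t_add V f g \<in> hom V X Y" unfolding V_hom verdier_sel a q_add_common(1)[OF 1] using q_add_common(2)[OF 1] by blast
    show "t_add V f g = t_add V g f" unfolding verdier_sel a q_add_common(1)[OF 1] q_add_common(1)[OF 1(2,1)]
      using roofD[OF 1(1)] roofD[OF 1(2)] by (simp add: pls_comm)
  qed
  show "t_neg V f \<in> hom V X Y" "t_add V f (t_zero V X Y) = f" "t_add V f (t_neg V f) = t_zero V X Y" if fg: "f \<in> hom V X Y" for f
  proof -
    obtain s f1 where 1: "roof X Y s f1" and a: "f = roof_class s f1" using fg by (rule V_homE)
    show "t_neg V f \<in> hom V X Y" unfolding V_hom verdier_sel a q_neg_roof_class(1)[OF 1] using q_neg_roof_class(2)[OF 1] by blast
    have 2: "roof X Y s (nul (dm s) Y)" using roofD[OF 1] by (simp add: roof_def)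
    show "t_add V f (t_zero V X Y) = f"
      unfolding nul_roof_class[OF 1] unfolding a verdier_sel q_add_common(1)[OF 1 2] using roofD[OF 1] by simp
    show "t_add V f (t_neg V f) = t_zero V X Y"
      unfolding nul_roof_class[OF 1] unfolding a verdier_sel q_neg_roof_class(1)[OF 1] q_add_common(1)[OF 1 q_neg_roof_class(2)[OF 1]]
      using roofD[OF 1] by simp
  qed
  show "t_add V (t_add V f g) h = t_add V f (t_add V g h)" if fg: "f \<in> hom V X Y" "g \<in> hom V X Y" "h \<in> hom V X Y" for f g h
  proof -
    obtain s0 f0 s1 f1 s2 f2 where "roof X Y s0 f0" "roof X Y s1 f1" "roof X Y s2 f2" "f = roof_class s0 f0" "g = roof_class s1 f1" "h = roof_class s2 f2"
      using fg by (elim V_homE)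
    then obtain s f1 g1 h1 where 1: "roof X Y s f1" "roof X Y s g1" "roof X Y s h1" and a: "f = roof_class s f1" "g = roof_class s g1" "h = roof_class s h1"
      using common_denominator3 by metis
    show ?thesis unfolding verdier_sel a q_add_common(1)[OF 1(1,2)] q_add_common(1)[OF 1(2,3)]
       q_add_common(1)[OF q_add_common(2)[OF 1(1,2)] 1(3)] q_add_common(1)[OF 1(1) q_add_common(2)[OF 1(2,3)]]
      using roofD[OF 1(1)] roofD[OF 1(2)] roofD[OF 1(3)] by (simp add: pls_assoc)
  qed
next
  fix X Y Z f f' g g' assume "f \<in> hom V X Y" "f' \<in> hom V X Y" "g \<in> hom V Y Z" "g' \<in> hom V Y Z"
  from V_distrib[OF this]
  show "t_comp V g (t_add V f f') = t_add V (t_comp V g f) (t_comp V g f')"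
    "t_comp V (t_add V g g') f = t_add V (t_comp V g f) (t_comp V g' f)"
    by (simp_all add: verdier_sel)
qed

lemma q_pls: assumes "arr f" "arr g" "dm g = dm f" "cd g = cd f" shows "q (f \<oplus> g) = q_add K S (q f) (q g)"
  using q_add_common(1)[of "dm f" "cd f" "one (dm f)" f g] roof_one[of f] roof_one[of g] assms by (simp add: q_def)

lemma q_mns: assumes "arr f" shows "q (mns f) = q_neg K S (q f)"
  using q_neg_roof_class(1)[OF roof_one[OF assms]] assms by (simp add: q_def)

lemma q_Sh: assumes "arr f" shows "q (Sh f) = q_shM K S (q f)"
  using q_shM_roof_class(1)[OF roof_one[OF assms]] assms by (simp add: q_def)

lemma V_zero_obj: assumes "zero_obj K Z" shows "zero_obj V Z"
proof -
  note Z = zero_obj_ob[OF assms]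
  have *: "q (one Z) = q (nul Z Z)" using assms by (simp add: zero_obj_iff)
  have "f = t_zero V Z X" if fg: "f \<in> hom V Z X" for f X
  proof -
    obtain s f1 where 1: "roof Z X s f1" and a: "f = roof_class s f1" using fg by (rule V_homE)
    have n: "roof Z Z (one Z) (nul Z Z)" using Z by (simp add: roof_def)
    have "f = q_comp K S f (q (one Z))" using V_cmp_one(1)[OF fg] by simp
    also have "\<dots> = q_comp K S (roof_class s f1) (roof_class (one Z) (nul Z Z))" using * Z by (simp add: a q_def)
    also have "\<dots> = roof_class (one Z \<cdot> one Z) (f1 \<cdot> nul Z (dm s))"
      by (rule q_comp_roof_class(1)[OF n 1]) (use Z roofD[OF 1] in simp_all)
    finally show ?thesis using Z roofD[OF 1] by (simp add: verdier_sel q_def)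
  qed
  moreover have "f = t_zero V X Z" if fg: "f \<in> hom V X Z" for f X
  proof -
    obtain s f1 where 1: "roof X Z s f1" and a: "f = roof_class s f1" using fg by (rule V_homE)
    have "f1 = nul (dm s) Z" using into_zero[OF assms, of f1] roofD[OF 1] by simp
    then show ?thesis using q_nul_roof_class[of s Z] roofD[OF 1] Z by (simp add: verdier_sel a)
  qed
  ultimately show ?thesis using Z by (simp add: zero_obj_def verdier_sel(1))
qed

lemma V_biprod: assumes b: "is_biprod K A B X i j p r" shows "is_biprod V A B X (q i) (q j) (q p) (q r)"
proof -
  note D = biprodD[OF b]
  have "q_add K S (q_comp K S (q i) (q p)) (q_comp K S (q j) (q r)) = q (i \<cdot> p \<oplus> j \<cdot> r)"
    using D by (simp add: q_cmp q_pls)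
  then show ?thesis unfolding is_biprod_def verdier_sel
    using D biprod_sum[OF b] q_hom[of i] q_hom[of j] q_hom[of p] q_hom[of r]
    by (simp add: q_cmp)
qed

text \<open>The inverse of \<open>q s\<close> is the roof with denominator \<open>s\<close> and an
  identity as numerator. The second claim allows a general numerator: it turns any morphism of the
  quotient into some \<open>q f\<close> by composing with an invertible \<open>q s\<close>.\<close>

lemma V_iso: assumes "W s" shows "iso_mor V (q s)" "\<And>f Y. roof (cd s) Y s f \<Longrightarrow> q_comp K S (roof_class s f) (q s) = q f"
proof -
  have key: "q_comp K S (roof_class s f) (q s) = q f" if r: "roof (cd s) Y s f" for f Y
  proof -
    have "q_comp K S (roof_class s f) (roof_class (one (dm s)) s) = roof_class (one (dm s) \<cdot> one (dm s)) (f \<cdot> one (dm s))"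
      by (rule q_comp_roof_class(1)[OF roof_one r]) (use roofD[OF r] in simp_all)
    then show ?thesis using roofD[OF r] by (simp add: q_def)
  qed
  then show "\<And>f Y. roof (cd s) Y s f \<Longrightarrow> q_comp K S (roof_class s f) (q s) = q f" .
  note s = W_arr[OF assms]
  have r: "roof (cd s) (dm s) s (one (dm s))" using assms s by (simp add: roof_def)
  have 1: "q_comp K S (roof_class s (one (dm s))) (q s) = q (one (dm s))" by (rule key[OF r])
  have "q_comp K S (q s) (roof_class s (one (dm s))) = roof_class (s \<cdot> one (dm s)) (s \<cdot> one (dm s))"
    unfolding q_def by (rule q_comp_roof_class(1)[OF r roof_one]) (use s in simp_all)
  moreover have "roof_class s s = q (one (cd s))"
  proof -
    have "roof (cd s) (cd s) (one (cd s)) (one (cd s))" using s by (simp add: roof_def)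
    from roof_class_refine[OF this assms] show ?thesis using s by (simp add: q_def)
  qed
  ultimately have 2: "q_comp K S (q s) (roof_class s (one (dm s))) = q (one (cd s))" using s by simp
  have h: "q s \<in> hom V (dm s) (cd s)" "roof_class s (one (dm s)) \<in> hom V (cd s) (dm s)"
    using q_hom[OF s] r V_hom by auto
  then have *: "q s \<in> t_mor V" "t_dom V (q s) = dm s" "t_cod V (q s) = cd s" by (auto simp: hom_def)
  show "iso_mor V (q s)" unfolding iso_mor_def * using * 1 2 h(2) by (auto simp: verdier_sel)
qed

lemma V_additive: "additive_ax V"
proof -
  obtain Z where "zero_obj K Z" by (rule zero_obj_exists)
  moreover have "\<exists>X i j p r. is_biprod V A B X i j p r" if "A \<in> t_ob V" "B \<in> t_ob V" for A B
    using biprod_exists[of A B] V_biprod that unfolding verdier_sel by metis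
  ultimately show ?thesis unfolding additive_ax_def using V_preadditive V_zero_obj by blast
qed

text \<open>The object in the middle is a shift only up to isomorphism. Composing both factors with
  that isomorphism and its inverse makes them maps between shifts, and fullness brings them
  down.\<close>

lemma factors_Sh: assumes "arr f" "factors (Sh f)" shows "factors f"
proof -
  obtain Z u v where *: "Z \<in> S" "arr u" "arr v" "cd u = Z" "dm v = Z" "Sh f = v \<cdot> u"
    using assms(2) unfolding factors_def by blast
  have uv: "dm u = So (dm f)" "cd v = So (cd f)"
    using *(2-5) dm_cmp[of u v] cd_cmp[of u v] assms(1) unfolding *(6)[symmetric] by simp_all
  obtain Z1 t where Z1: "ob Z1" "iso_mor K t" "arr t" "dm t = So Z1" "cd t = Z" using desuspend[OF sub_ob[OF *(1)]] by blast
  obtain t' where t': "arr t'" "dm t' = Z" "cd t' = So Z1" "t \<cdot> t' = one Z" "iso_mor K t'" using iso_inv[OF Z1(2)] Z1 by metis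
  obtain u1 where u1: "arr u1" "dm u1 = dm f" "cd u1 = Z1" "t' \<cdot> u = Sh u1"
    using Sh_full[of "t' \<cdot> u" "dm f" Z1] t' Z1 * uv assms by auto
  obtain v1 where v1: "arr v1" "dm v1 = Z1" "cd v1 = cd f" "v \<cdot> t = Sh v1"
    using Sh_full[of "v \<cdot> t" Z1 "cd f"] t' Z1 * uv assms by auto
  have "Sh (v1 \<cdot> u1) = (v \<cdot> t) \<cdot> (t' \<cdot> u)" unfolding u1(4) v1(4) using u1 v1 by simp
  also have "\<dots> = Sh f" using * t' Z1 reassoc[OF t'(4), of u] by simp
  finally have "v1 \<cdot> u1 = f" by (rule Sh_inject) (use u1 v1 assms in simp_all)
  moreover have "Z1 \<in> S" using sub_iso[OF *(1)] isomorphicI[OF t'(5)] t' sub_So[OF Z1(1)] by simp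
  ultimately show ?thesis unfolding factors_def using u1 v1 by blast
qed

lemma V_shift: "shift_ax V"
  unfolding shift_ax_def
proof (intro conjI ballI impI)
  show "t_shO V X \<in> t_ob V" "t_shM V (t_id V X) = t_id V (t_shO V X)" if "X \<in> t_ob V" for X
    using that q_Sh[of "one X"] by (simp_all add: verdier_sel)
  show "\<exists>X\<in>t_ob V. isomorphic V (t_shO V X) Y" if Y: "Y \<in> t_ob V" for Y
  proof -
    obtain X f where X: "ob X" "iso_mor K f" "arr f" "dm f = So X" "cd f = Y"
      using desuspend[of Y] Y by (auto simp: verdier_sel)
    have "isomorphic V (So X) Y" unfolding isomorphic_def using V_iso(1)[OF W_iso[OF X(2)]] q_hom[of f] X by auto
    then show ?thesis using X by (auto simp: verdier_sel)
  qed
  show "t_shM V (t_comp V g f) = t_comp V (t_shM V g) (t_shM V f)"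
    if fg: "f \<in> t_mor V" "g \<in> t_mor V" "t_cod V f = t_dom V g" for f g
  proof -
    obtain s f1 where 1: "roof (t_dom V f) (t_dom V g) s f1" and a: "f = roof_class s f1" using V_mor_hom[OF fg(1), unfolded fg(3)] by (rule V_homE)
    obtain t g1 where 2: "roof (t_dom V g) (t_cod V g) t g1" and b: "g = roof_class t g1" using V_mor_hom[OF fg(2)] by (rule V_homE)
    note R = roofD[OF 1] roofD[OF 2]
    obtain u h where u: "W u" "arr u" "cd u = dm s" "arr h" "dm h = dm u" "cd h = dm t" "f1 \<cdot> u = t \<cdot> h"
      by (rule W_Ore[of f1 t]) (use R in simp_all)
    have ba: "q_comp K S g f = roof_class (s \<cdot> u) (g1 \<cdot> h)" "roof (t_dom V f) (t_cod V g) (s \<cdot> u) (g1 \<cdot> h)"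
      unfolding a b by (rule q_comp_roof_class[OF 1[unfolded a b] 2[unfolded a b] u(1,3,4,5,6,7)])+
    note 3 = q_shM_roof_class[OF 1] and 4 = q_shM_roof_class[OF 2]
    have "Sh f1 \<cdot> Sh u = Sh (f1 \<cdot> u)" using R u(2-6) by simp
    also have "\<dots> = Sh t \<cdot> Sh h" unfolding u(7) using R u(2-6) by simp
    finally have e: "Sh f1 \<cdot> Sh u = Sh t \<cdot> Sh h" .
    have "q_comp K S (roof_class (Sh t) (Sh g1)) (roof_class (Sh s) (Sh f1)) = roof_class (Sh s \<cdot> Sh u) (Sh g1 \<cdot> Sh h)"
      by (intro q_comp_roof_class(1)[OF 3(2) 4(2)]) (use R u(1-6) e W_Sh in simp_all)
    then show ?thesis unfolding verdier_sel ba(1) q_shM_roof_class(1)[OF ba(2)] unfolding a b 3(1) 4(1)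
      using R u by simp
  qed
  fix X Y assume "X \<in> t_ob V" "Y \<in> t_ob V"
  then have XY: "ob X" "ob Y" by (simp_all add: verdier_sel)
  show "t_shM V (t_add V f g) = t_add V (t_shM V f) (t_shM V g)" if fg: "f \<in> hom V X Y" "g \<in> hom V X Y" for f g
  proof -
    obtain s0 f0 s1 f1 where "roof X Y s0 f0" "roof X Y s1 f1" "f = roof_class s0 f0" "g = roof_class s1 f1"
      using fg by (elim V_homE)
    then obtain s f1 g1 where 1: "roof X Y s f1" "roof X Y s g1" and a: "f = roof_class s f1" "g = roof_class s g1"
      using common_denominator by metis
    show ?thesis unfolding verdier_sel a q_add_common(1)[OF 1] q_shM_roof_class(1)[OF q_add_common(2)[OF 1]]
       q_shM_roof_class(1)[OF 1(1)] q_shM_roof_class(1)[OF 1(2)] q_add_common(1)[OF q_shM_roof_class(2)[OF 1(1)] q_shM_roof_class(2)[OF 1(2)]]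
      using roofD[OF 1(1)] roofD[OF 1(2)] by simp
  qed
  show "bij_betw (t_shM V) (hom V X Y) (hom V (t_shO V X) (t_shO V Y))"
    unfolding bij_betw_def
  proof (intro conjI)
    show "inj_on (t_shM V) (hom V X Y)"
    proof (rule inj_onI)
      fix f g assume fg: "f \<in> hom V X Y" "g \<in> hom V X Y" and eq: "t_shM V f = t_shM V g"
      obtain s0 f0 s1 f1 where "roof X Y s0 f0" "roof X Y s1 f1" "f = roof_class s0 f0" "g = roof_class s1 f1"
        using fg by (elim V_homE)
      then obtain s f1 g1 where 1: "roof X Y s f1" "roof X Y s g1" and a: "f = roof_class s f1" "g = roof_class s g1"
        using common_denominator by metis
      note R = roofD[OF 1(1)] roofD[OF 1(2)]
      have "roof_class (Sh s) (Sh f1) = roof_class (Sh s) (Sh g1)"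
        using eq unfolding verdier_sel a q_shM_roof_class(1)[OF 1(1)] q_shM_roof_class(1)[OF 1(2)] .
      then have "roof_eq K S (Sh s, Sh f1) (Sh s, Sh g1)" using roof_class_eq[OF q_shM_roof_class(2)[OF 1(1)] q_shM_roof_class(2)[OF 1(2)]] by simp
      from roof_eq_common[OF q_shM_roof_class(2)[OF 1(1)] q_shM_roof_class(2)[OF 1(2)] this, of "one (So (dm s))" "one (So (dm s))"]
      obtain c where c: "W c" "arr c" "cd c = So (dm s)" "Sh f1 \<cdot> one (So (dm s)) \<cdot> c = Sh g1 \<cdot> one (So (dm s)) \<cdot> c"
        using R by auto
      \<comment> \<open>Injectivity over a common denominator: the difference of the numerators dies
        after shifting, and \<open>factors_Sh\<close> brings this down.\<close>
      have "factors (Sh (f1 \<oplus> mns g1))" by (rule factors_if_pre[OF c(1)]) (use R c in simp_all)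
      then have "factors (f1 \<oplus> mns g1)" by (rule factors_Sh[rotated]) (use R in simp)
      then obtain u where u: "W u" "arr u" "cd u = dm (f1 \<oplus> mns g1)" "(f1 \<oplus> mns g1) \<cdot> u = nul (dm u) (cd (f1 \<oplus> mns g1))" by (rule factors_kill_pre)
      have u': "cd u = dm s" using u(3) R by simp
      have "f1 \<cdot> u \<oplus> mns (g1 \<cdot> u) = nul (dm u) Y" using u(2,4) u' R by simp
      then have "f1 \<cdot> u = g1 \<cdot> u" by (rule eq_if_diff_nul) (use R u(2) u' in simp_all)
      then show "f = g" unfolding a by (intro roof_class_eqI[OF 1, of u u]) (use R u(1,2) u' W_cmp in simp_all)
    qed
    show "t_shM V ` hom V X Y = hom V (t_shO V X) (t_shO V Y)"
    proof (intro equalityI subsetI)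
      fix \<alpha> assume "\<alpha> \<in> t_shM V ` hom V X Y"
      then obtain s f where 1: "roof X Y s f" "\<alpha> = t_shM V (roof_class s f)" by (auto simp: V_hom)
      then have "\<alpha> = roof_class (Sh s) (Sh f)" using q_shM_roof_class(1)[OF 1(1)] by (simp add: verdier_sel)
      then show "\<alpha> \<in> hom V (t_shO V X) (t_shO V Y)" unfolding V_hom verdier_sel using q_shM_roof_class(2)[OF 1(1)] by blast
    next
      fix \<alpha> assume "\<alpha> \<in> hom V (t_shO V X) (t_shO V Y)"
      then obtain s f where 1: "roof (So X) (So Y) s f" and a: "\<alpha> = roof_class s f" unfolding verdier_sel by (rule V_homE)
      note R = roofD[OF 1]
      \<comment> \<open>The apex of the roof need not be a shift, so the roof is refined along an
        isomorphism from one.\<close>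
      obtain B t where B: "ob B" "iso_mor K t" "arr t" "dm t = So B" "cd t = dm s" by (rule desuspend[OF R(9)])
      obtain s1 where s1: "arr s1" "dm s1 = B" "cd s1 = X" "s \<cdot> t = Sh s1" by (rule Sh_full[of "s \<cdot> t" B X]) (use R B XY in simp_all)
      obtain f1 where f1: "arr f1" "dm f1 = B" "cd f1 = Y" "f \<cdot> t = Sh f1" by (rule Sh_full[of "f \<cdot> t" B Y]) (use R B XY in simp_all)
      have "W (s \<cdot> t)" using W_cmp[OF W_iso[OF B(2)] R(1)] B by simp
      then have "W s1" unfolding s1(4) using W_Sh[OF s1(1)] by simp
      then have 2: "roof X Y s1 f1" using s1 f1 by (simp add: roof_def)
      have "roof_class (s \<cdot> t) (f \<cdot> t) = \<alpha>" unfolding a by (rule roof_class_refine[OF 1 W_iso[OF B(2)] B(5)])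
      then have "\<alpha> = t_shM V (roof_class s1 f1)" unfolding verdier_sel q_shM_roof_class(1)[OF 2] s1(4) f1(4) by simp
      then show "\<alpha> \<in> t_shM V ` hom V X Y" using 2 V_hom by blast
    qed
  qed
qed

end

sublocale triangulated_subcategory \<subseteq> V: additive_shift_category "verdier K S"
  using V_category V_additive V_shift by unfold_locales

context additive_shift_category begin

lemma tri_iso_refl:
  assumes "is_triangle K (f, g, h)" shows "tri_iso K (f, g, h) (f, g, h)"
proof -
  have t: "arr f" "arr g" "arr h" "dm g = cd f" "dm h = cd g" "cd h = So (dm f)"
    using assms by (simp_all add: triangle_iff)
  have "tri_morph K (f, g, h) (f, g, h) (one (dm f)) (one (dm g)) (one (dm h))"
    using t by (simp add: tri_morph_def hom_iff)
  moreover have "iso_mor K (one (dm f))" "iso_mor K (one (dm g))" "iso_mor K (one (dm h))" using t(1-3) by simp_all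
  ultimately show ?thesis unfolding tri_iso_def using assms by blast
qed

end

section \<open>The quotient functor and its exactness\<close>

context triangulated_subcategory begin

abbreviation cmpV (infixr "\<bullet>" 70) where "\<beta> \<bullet> \<alpha> \<equiv> t_comp V \<beta> \<alpha>"

lemma V_ob [simp]: "t_ob V = t_ob K" and V_So [simp]: "t_shO V = So"
  by (simp_all add: verdier_sel)

lemma q_type [simp]: "arr f \<Longrightarrow> V.arr (q f)" "arr f \<Longrightarrow> V.dm (q f) = dm f" "arr f \<Longrightarrow> V.cd (q f) = cd f"
  using q_hom[of f] by (auto simp: hom_def)

lemma q_comp: "arr f \<Longrightarrow> arr g \<Longrightarrow> dm g = cd f \<Longrightarrow> q (g \<cdot> f) = q g \<bullet> q f"
  using q_cmp by (simp add: verdier_sel)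

lemma q_one: "q (one X) = V.one X" and q_nul: "q (nul X Y) = V.nul X Y"
  by (simp_all add: verdier_sel)

lemma q_shift: "arr f \<Longrightarrow> q (Sh f) = V.Sh (q f)"
  using q_Sh by (simp add: verdier_sel)

lemma q_minus: "arr f \<Longrightarrow> q (mns f) = V.mns (q f)"
  using q_mns by (simp add: verdier_sel)

lemma q_zero_iff: "arr f \<Longrightarrow> dm f = X \<Longrightarrow> cd f = Y \<Longrightarrow> q f = V.nul X Y \<longleftrightarrow> factors f"
  using q_eq_nul by (simp add: verdier_sel)

lemma q_iso: "W s \<Longrightarrow> iso_mor V (q s)"
  by (rule V_iso)

lemma q_inv:
  assumes "W s" obtains t where "V.arr t" "V.dm t = cd s" "V.cd t = dm s" "t \<bullet> q s = V.one (dm s)" "q s \<bullet> t = V.one (cd s)"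
  by (rule V.iso_inv[OF q_iso[OF assms]]) (rule that; use W_arr[OF assms] in simp)

text \<open>Clearing denominators: \<open>q s\<close> is invertible, so vanishing and splitting of
  \<alpha> become questions about the single morphism \<open>f\<close> of the original
  category.\<close>

lemma V_roof:
  assumes "V.arr \<alpha>"
  obtains s f where "W s" "arr s" "cd s = V.dm \<alpha>" "arr f" "dm f = dm s" "cd f = V.cd \<alpha>" "\<alpha> \<bullet> q s = q f"
proof -
  obtain s f where r: "roof (V.dm \<alpha>) (V.cd \<alpha>) s f" and a: "\<alpha> = roof_class s f" using V_mor_hom[OF assms] by (rule V_homE)
  note R = roofD[OF r]
  have "roof (cd s) (V.cd \<alpha>) s f" using r R by simp
  then have "roof_class s f \<bullet> q s = q f" using V_iso(2)[OF R(1)] by (simp add: verdier_sel)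
  then show ?thesis using that R a by blast
qed

lemma V_cancel_W:
  assumes "W s" "V.arr x" "V.arr y" "V.dm x = cd s" "V.dm y = cd s" "V.cd y = V.cd x" "x \<bullet> q s = y \<bullet> q s"
  shows "x = y"
proof -
  obtain t where t: "V.arr t" "V.dm t = cd s" "V.cd t = dm s" "q s \<bullet> t = V.one (cd s)" using q_inv[OF assms(1)] .
  have "x = (x \<bullet> q s) \<bullet> t" using assms(1-6) t W_arr[OF assms(1)] by simp
  also have "\<dots> = y" unfolding assms(7) using assms(1-6) t W_arr[OF assms(1)] by simp
  finally show ?thesis .
qed

lemma roof_zero:
  assumes "V.arr \<alpha>" "W s" "cd s = V.dm \<alpha>" "arr f" "dm f = dm s" "cd f = V.cd \<alpha>" "\<alpha> \<bullet> q s = q f"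
  shows "\<alpha> = V.nul (V.dm \<alpha>) (V.cd \<alpha>) \<longleftrightarrow> factors f"
proof -
  note s = W_arr[OF assms(2)]
  have "\<alpha> = V.nul (V.dm \<alpha>) (V.cd \<alpha>) \<longleftrightarrow> q f = V.nul (dm s) (V.cd \<alpha>)"
  proof
    assume "\<alpha> = V.nul (V.dm \<alpha>) (V.cd \<alpha>)"
    then have "q f = V.nul (V.dm \<alpha>) (V.cd \<alpha>) \<bullet> q s" using assms(7) by simp
    then show "q f = V.nul (dm s) (V.cd \<alpha>)" using assms(1-6) s V.ob_cd[OF assms(1)] by simp
  next
    assume "q f = V.nul (dm s) (V.cd \<alpha>)"
    then show "\<alpha> = V.nul (V.dm \<alpha>) (V.cd \<alpha>)"
      by - (rule V_cancel_W[OF assms(2)], use assms s V.ob_dm[OF assms(1)] V.ob_cd[OF assms(1)] in simp_all)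
  qed
  then show ?thesis using q_zero_iff[of f] assms by simp
qed

lemma roof_left_inverse:
  assumes a: "V.arr \<alpha>" and r: "W s" "cd s = V.dm \<alpha>" "arr f" "dm f = dm s" "cd f = V.cd \<alpha>" "\<alpha> \<bullet> q s = q f"
    and k: "V.arr k" "V.dm k = cd f" "V.cd k = dm f" "k \<bullet> q f = V.one (dm f)"
  shows "(q s \<bullet> k) \<bullet> \<alpha> = V.one (V.dm \<alpha>)"
proof -
  note s = W_arr[OF r(1)]
  obtain v where v: "V.arr v" "V.dm v = cd s" "V.cd v = dm s" "v \<bullet> q s = V.one (dm s)" "q s \<bullet> v = V.one (cd s)"
    using q_inv[OF r(1)] .
  have "\<alpha> = (\<alpha> \<bullet> q s) \<bullet> v" using r(1-5) s a(1) v by simp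
  then have av: "\<alpha> = q f \<bullet> v" unfolding r(6) .
  have "(q s \<bullet> k) \<bullet> q f \<bullet> v = q s \<bullet> (k \<bullet> q f) \<bullet> v" using k(1-3) v(1-3) r(1-5) s by simp
  also have "\<dots> = V.one (V.dm \<alpha>)" unfolding k(4) using v r(1-5) s by simp
  finally show "(q s \<bullet> k) \<bullet> \<alpha> = V.one (V.dm \<alpha>)" unfolding av[symmetric] .
qed

text \<open>After clearing denominators \<open>g f'\<close> factors through \<open>S\<close>, so a
  further refinement kills it outright. The lift then exists in the original category, and the
  denominators are inverted again.\<close>

lemma V_exact:
  assumes t: "tri A B Z f g h" and x: "V.arr x" "V.cd x = B" "q g \<bullet> x = V.nul (V.dm x) Z"
  obtains y where "V.arr y" "V.dm y = V.dm x" "V.cd y = A" "q f \<bullet> y = x"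
proof -
  note D = triD[OF t]
  obtain s f' where r: "W s" "arr s" "cd s = V.dm x" "arr f'" "dm f' = dm s" "cd f' = V.cd x" "x \<bullet> q s = q f'"
    using V_roof[OF x(1)] .
  have "q (g \<cdot> f') = q g \<bullet> x \<bullet> q s" using r D x(2) by (simp add: q_comp)
  also have "\<dots> = (q g \<bullet> x) \<bullet> q s" using r D x(1,2) by simp
  also have "\<dots> = V.nul (dm s) Z" unfolding x(3) using r(1-6) D by simp
  finally have "factors (g \<cdot> f')" using q_zero_iff[of "g \<cdot> f'"] r D x(2) by simp
  then obtain u where u: "W u" "arr u" "cd u = dm (g \<cdot> f')" "(g \<cdot> f') \<cdot> u = nul (dm u) (cd (g \<cdot> f'))" by (rule factors_kill_pre)
  have u': "cd u = dm s" using u(3) r D x(2) by simp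
  have "g \<cdot> (f' \<cdot> u) = nul (dm (f' \<cdot> u)) Z" using u(2,4) u' r D x(2) by simp
  then obtain y where y: "arr y" "dm y = dm u" "cd y = A" "f \<cdot> y = f' \<cdot> u"
    using tri_lift[OF t, of "f' \<cdot> u"] u(2) u' r x(2) by auto
  have "W (s \<cdot> u)" using W_cmp[OF u(1) r(1)] u' by simp
  then obtain v where v: "V.arr v" "V.dm v = cd (s \<cdot> u)" "V.cd v = dm (s \<cdot> u)" "q (s \<cdot> u) \<bullet> v = V.one (cd (s \<cdot> u))"
    using q_inv by blast
  have v': "V.dm v = V.dm x" "V.cd v = dm u" using v r u' u(2) by simp_all
  have "q f \<bullet> (q y \<bullet> v) = q (f \<cdot> y) \<bullet> v" using y(1-3) v(1) v' D by (simp add: q_comp)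
  also have "\<dots> = (x \<bullet> q s) \<bullet> q u \<bullet> v" unfolding y(4) r(7) using u(2) u' r(1-6) v(1) v' x(2) by (simp add: q_comp)
  also have "\<dots> = x \<bullet> (q (s \<cdot> u) \<bullet> v)" using u(2) u' r(1-6) v(1) v' x(1,2) by (simp add: q_comp)
  also have "\<dots> = x" unfolding v(4) using x r u' u(2) by simp
  finally show ?thesis using that[of "q y \<bullet> v"] y v(1) v' by simp
qed

lemma V_exact2:
  assumes t: "tri A B Z f g h" and x: "V.arr x" "V.cd x = Z" "q h \<bullet> x = V.nul (V.dm x) (So A)"
  obtains y where "V.arr y" "V.dm y = V.dm x" "V.cd y = B" "q g \<bullet> y = x"
  using V_exact[OF tri_rot[OF t] x] .

lemma V_exact3:
  assumes t: "tri A B Z f g h" and x: "V.arr x" "V.cd x = So A" "V.Sh (q f) \<bullet> x = V.nul (V.dm x) (So B)"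
  obtains y where "V.arr y" "V.dm y = V.dm x" "V.cd y = Z" "q h \<bullet> y = x"
proof -
  note D = triD[OF t]
  have "q (mns (Sh f)) \<bullet> x = V.nul (V.dm x) (So B)" using x D V.ob_dm[OF x(1)] by (simp add: q_minus q_shift)
  from V_exact2[OF tri_rot[OF t] x(1,2) this] show ?thesis using that by blast
qed

text \<open>Some \<open>t'\<close> in \<open>W\<close> kills \<open>f\<close> from the left and
  therefore extends over \<open>g\<close>. Inverting \<open>q t'\<close> turns the extension into a
  retraction of \<open>q g\<close>.\<close>

lemma next_split_mono:
  assumes t: "tri A B Z f g h" and "factors f"
  obtains k where "V.arr k" "V.dm k = Z" "V.cd k = B" "k \<bullet> q g = V.one B"
proof -
  note D = triD[OF t]
  obtain t' where t': "W t'" "arr t'" "dm t' = cd f" "t' \<cdot> f = nul (dm f) (cd t')" using factors_kill_post[OF assms(2)] .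
  obtain y where y: "arr y" "dm y = Z" "cd y = cd t'" "y \<cdot> g = t'" using tri_extend[OF t, of t'] t' D by auto
  obtain v where v: "V.arr v" "V.dm v = cd t'" "V.cd v = dm t'" "v \<bullet> q t' = V.one (dm t')" using q_inv[OF t'(1)] .
  have "(v \<bullet> q y) \<bullet> q g = v \<bullet> q (y \<cdot> g)" using v(1-3) t'(2,3) y(1-3) D by (simp add: q_comp)
  also have "\<dots> = V.one B" unfolding y(4) v(4) using t'(3) D by simp
  finally have "(v \<bullet> q y) \<bullet> q g = V.one B" .
  then show ?thesis using that[of "v \<bullet> q y"] v y t' D by simp
qed

text \<open>The definition tests isomorphism in \<open>verdier_pre\<close>, whose class of triangles
  is empty. Isomorphism of triangles reads only the other fields, and on those both records
  agree.\<close>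

lemma V_tri: "T \<in> t_tri V \<longleftrightarrow> (\<exists>f g h. (f, g, h) \<in> t_tri K \<and> tri_iso V (q f, q g, q h) T)"
proof -
  have "t_mor (verdier_pre K S) = t_mor V" "t_dom (verdier_pre K S) = t_dom V" "t_cod (verdier_pre K S) = t_cod V"
    "t_comp (verdier_pre K S) = t_comp V" "t_id (verdier_pre K S) = t_id V" "t_shO (verdier_pre K S) = t_shO V"
    "t_shM (verdier_pre K S) = t_shM V"
    by (simp_all add: verdier_def)
  then have eq: "tri_iso (verdier_pre K S) T1 T2 = tri_iso V T1 T2" for T1 T2
    unfolding tri_iso_def is_triangle_def tri_morph_def iso_mor_def hom_def by simp
  have "t_tri V = {T'. \<exists>f g h. (f, g, h) \<in> t_tri K \<and> tri_iso (verdier_pre K S) (q f, q g, q h) T'}"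
    by (simp add: verdier_def)
  then show ?thesis by (simp only: eq mem_Collect_eq)
qed

lemma q_isomorphic: "isomorphic K X Y \<Longrightarrow> isomorphic V X Y"
  using q_iso[OF W_iso] V.isomorphicI by (metis isomorphicE q_type(2,3))

lemma W_isomorphic: "W s \<Longrightarrow> isomorphic V (dm s) (cd s)"
  using V.isomorphicI[OF q_iso] W_arr by fastforce

lemma tri_V: assumes "tri A B Z f g h" shows "(q f, q g, q h) \<in> t_tri V"
proof -
  note D = triD[OF assms]
  have "(f, g, h) \<in> t_tri K" using assms by (simp add: tri_def)
  moreover have "is_triangle V (q f, q g, q h)" using D by (simp add: V.triangle_iff)
  ultimately show ?thesis using V_tri V.tri_iso_refl by blast
qed

end

section \<open>Zero objects, isomorphisms and subcategories of the quotient\<close>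

context thick_subcategory begin

lemma V_zero_iff: "ob Z \<Longrightarrow> zero_obj V Z \<longleftrightarrow> Z \<in> S"
proof
  assume o: "ob Z"
  have "zero_obj V Z \<longleftrightarrow> factors (one Z)" using q_zero_iff[of "one Z"] o by (simp add: V.zero_obj_iff flip: q_one)
  moreover have "factors (one Z)" if "Z \<in> S" unfolding factors_def using that o by (intro exI[of _ Z] exI[of _ "one Z"]) simp
  ultimately show "zero_obj V Z \<Longrightarrow> Z \<in> S" "Z \<in> S \<Longrightarrow> zero_obj V Z" using factors_one[OF o] by blast+
qed

text \<open>Since \<open>q h = 0\<close>, the identity of \<open>Z\<close> lifts along
  \<open>q g\<close>, which is zero as well. So \<open>Z\<close> vanishes in the quotient.\<close>

lemma S_if_factors:
  assumes t: "tri A B Z f g h" and "factors g" "factors h" shows "Z \<in> S"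
proof -
  note D = triD[OF t]
  have h0: "q h = V.nul Z (So A)" and g0: "q g = V.nul B Z" using q_zero_iff[of h] q_zero_iff[of g] D assms by simp_all
  obtain y where y: "V.arr y" "V.dm y = Z" "V.cd y = B" "q g \<bullet> y = V.one Z"
    using V_exact2[OF t, of "V.one Z"] D h0 by auto
  then have "V.one Z = V.nul Z Z" using g0 D by simp
  then show ?thesis using V_zero_iff[of Z] D by (simp add: V.zero_obj_iff)
qed

text \<open>Cancelling the invertible \<open>q f\<close> in the vanishing composites of its triangle
  gives \<open>q g = 0\<close> and \<open>q h = 0\<close>, so the cone lies in \<open>S\<close>.
  Thus \<open>W\<close> is saturated.\<close>

lemma W_if_V_iso: assumes "arr f" "iso_mor V (q f)" shows "W f"
proof -
  obtain Z g h where t: "tri (dm f) (cd f) Z f g h" using tri_exists[OF assms(1)] .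
  note D = triD[OF t]
  obtain k where k': "V.arr k" "V.dm k = V.cd (q f)" "V.cd k = V.dm (q f)" "k \<bullet> q f = V.one (V.dm (q f))" "q f \<bullet> k = V.one (V.cd (q f))"
    by (rule V.iso_inv[OF assms(2)])
  note k = k'[unfolded q_type(2,3)[OF assms(1)]]
  have "q g \<bullet> q f = V.nul (dm f) Z" using tri_comp_zero[OF t] D by (simp add: q_nul flip: q_comp)
  then have "(q g \<bullet> q f) \<bullet> k = V.nul (cd f) Z" using k D by simp
  then have "q g = V.nul (cd f) Z" using k D by simp
  then have 1: "factors g" using q_zero_iff[of g] D by simp
  have "q (Sh f) \<bullet> q h = V.nul Z (So (cd f))" using tri_comp_zero3[OF t] D by (simp add: q_nul flip: q_comp)
  then have "V.Sh k \<bullet> V.Sh (q f) \<bullet> q h = V.nul Z (So (dm f))" using k D by (simp add: q_shift)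
  moreover have "V.Sh k \<bullet> V.Sh (q f) \<bullet> q h = q h"
  proof -
    have "V.Sh k \<bullet> V.Sh (q f) = V.one (So (dm f))" using k D V.Sh_cmp[of "q f" k] by simp
    from V.reassoc[OF this, of "q h"] show ?thesis using k D by simp
  qed
  ultimately have "factors h" using q_zero_iff[of h] D by simp
  then show ?thesis using S_if_factors[OF t 1] W_iff[OF t] by simp
qed

lemma V_isomorphic_roof:
  assumes "isomorphic V X Y"
  obtains s f where "W s" "arr s" "cd s = X" "W f" "arr f" "dm f = dm s" "cd f = Y"
proof -
  obtain \<alpha> where a: "iso_mor V \<alpha>" "V.arr \<alpha>" "V.dm \<alpha> = X" "V.cd \<alpha> = Y" using assms by (rule V.isomorphicE)
  obtain s f where r: "W s" "arr s" "cd s = V.dm \<alpha>" "arr f" "dm f = dm s" "cd f = V.cd \<alpha>" "\<alpha> \<bullet> q s = q f"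
    using V_roof[OF a(2)] .
  have "iso_mor V (q f)" unfolding r(7)[symmetric] by (rule V.iso_cmp[OF q_iso[OF r(1)] a(1)]) (use r in simp)
  then have "W f" by (rule W_if_V_iso[OF r(4)])
  then show ?thesis using that r a by blast
qed

text \<open>Lets generation in the quotient be tested in the original category. From left to right,
  \<open>T\<close> contains the zero objects of the quotient and hence \<open>S\<close>. From right
  to left, closure under isomorphism holds because an isomorphism of the quotient is a roof with
  both legs in \<open>W\<close>.\<close>

lemma V_subcat_iff:
  shows "tri_subcat V T \<longleftrightarrow> tri_subcat K T \<and> S \<subseteq> T"
proof
  assume T: "tri_subcat V T"
  have To: "T \<subseteq> t_ob K" "T \<noteq> {}" using T by (simp_all add: tri_subcat_def)
  have iso: "Y \<in> T" if "X \<in> T" "isomorphic V X Y" for X Y using T that unfolding tri_subcat_def by blast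
  have ST: "S \<subseteq> T"
  proof
    fix Z assume Z: "Z \<in> S"
    have z: "zero_obj V Z" using V_zero_iff[OF sub_ob[OF Z]] Z by simp
    obtain X where X: "X \<in> T" using To by blast
    obtain N0 where N0: "zero_obj K N0" by (rule zero_obj_exists)
    have t: "tri X X N0 (one X) (nul X N0) (nul N0 (So X))" using tri_id[OF _ N0] X To by blast
    have "N0 \<in> T" using T tri_V[OF t] X To zero_obj_ob[OF N0] triD[OF t]
      unfolding tri_subcat_def Let_def by (metis q_type(2))
    moreover have "isomorphic V N0 Z"
    proof -
      have o: "ob N0" "ob Z" using zero_obj_ob[OF N0] sub_ob[OF Z] .
      have "zero_obj V N0" by (rule V_zero_obj[OF N0])
      then have "iso_mor V (V.nul N0 Z)" using z o
        by (auto simp: V.iso_iff V.zero_obj_iff intro!: exI[of _ "V.nul Z N0"])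
      from V.isomorphicI[OF this] show ?thesis using o by simp
    qed
    ultimately show "Z \<in> T" using iso by blast
  qed
  have "tri_subcat K T"
  proof (rule tri_subcatI[OF To])
    show "Y \<in> T" if "X \<in> T" "isomorphic K X Y" for X Y using iso q_isomorphic that by blast
    show "So X \<in> T \<longleftrightarrow> X \<in> T" if "ob X" for X using T that unfolding tri_subcat_def by simp
    show "Z \<in> T" if t: "tri A B Z f g h" and AB: "A \<in> T" "B \<in> T" for A B Z f g h
      using T tri_V[OF t] AB triD[OF t] unfolding tri_subcat_def Let_def by (metis q_type(2))
  qed
  then show "tri_subcat K T \<and> S \<subseteq> T" using ST by blast
next
  assume a: "tri_subcat K T \<and> S \<subseteq> T"
  interpret T: triangulated_subcategory K T using a by unfold_locales simp
  have iso: "Y \<in> T" if X: "X \<in> T" and XY: "isomorphic V X Y" for X Y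
  proof -
    obtain s f where r: "W s" "arr s" "cd s = X" "W f" "arr f" "dm f = dm s" "cd f = Y"
      using V_isomorphic_roof[OF XY] .
    obtain Z g h where t: "tri (dm s) (cd s) Z s g h" "Z \<in> S" using W_tri[OF r(1)] .
    obtain Z' g' h' where t': "tri (dm f) (cd f) Z' f g' h'" "Z' \<in> S" using W_tri[OF r(4)] .
    have "dm s \<in> T" using T.sub_tri(3)[OF t(1)] t(2) a r X by blast
    then show ?thesis using T.sub_tri(2)[OF t'(1)] t'(2) a r by auto
  qed
  have tr: "(A \<in> T \<and> B \<in> T \<longrightarrow> Z \<in> T) \<and> (A \<in> T \<and> Z \<in> T \<longrightarrow> B \<in> T) \<and> (B \<in> T \<and> Z \<in> T \<longrightarrow> A \<in> T)"
    if t: "(f, g, h) \<in> t_tri V" "A = V.dm f" "B = V.dm g" "Z = V.dm h" for f g h A B Z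
  proof -
    obtain f' g' h' where k: "(f', g', h') \<in> t_tri K" and i: "tri_iso V (q f', q g', q h') (f, g, h)"
      using t(1) V_tri by auto
    note t' = triI[OF k]
    note D = triD[OF t']
    obtain a b c where abc: "tri_morph V (q f', q g', q h') (f, g, h) a b c" "iso_mor V a" "iso_mor V b" "iso_mor V c"
      using i unfolding tri_iso_def by blast
    have "isomorphic V (dm f') A" "isomorphic V (cd f') B" "isomorphic V (cd g') Z"
      using abc V.isomorphicI[of a] V.isomorphicI[of b] V.isomorphicI[of c] D t(2-4)
      by (auto simp: tri_morph_def V.hom_iff)
    then have "dm f' \<in> T \<longleftrightarrow> A \<in> T" "cd f' \<in> T \<longleftrightarrow> B \<in> T" "cd g' \<in> T \<longleftrightarrow> Z \<in> T"
      using iso V.isomorphic_sym by blast+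
    then show ?thesis using T.sub_tri[OF t'] by blast
  qed
  show "tri_subcat V T"
    unfolding tri_subcat_def Let_def V_ob V_So
  proof (intro conjI allI impI ballI)
    show "T \<subseteq> t_ob K" using T.sub_ob by blast
    show "T \<noteq> {}" using a by (simp add: tri_subcat_def)
    show "Y \<in> T" if "X \<in> T" "isomorphic V X Y" for X Y using iso that .
    show "X \<in> T \<longleftrightarrow> So X \<in> T" if "ob X" for X using T.sub_So that by simp
  qed (use tr in blast)+
qed

end

section \<open>Split triangles\<close>

context additive_shift_category begin

text \<open>Regroups \<open>U + (M + M')\<close> as \<open>(U + M) + M'\<close> with explicit
  structure maps, so that \<open>U\<close> can be added to either part of a normal form.\<close>

lemma biprod_assoc:
  assumes a: "is_biprod K U A1 A i s r x" and m: "is_biprod K M M' A1 m m' p p'" and l: "is_biprod K U M L l1 l2 c1 c2"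
  shows "is_biprod K L M' A (i \<cdot> c1 \<oplus> s \<cdot> m \<cdot> c2) (s \<cdot> m') (l1 \<cdot> r \<oplus> l2 \<cdot> p \<cdot> x) (p' \<cdot> x)"
proof -
  note D = biprodD[OF a] biprodD[OF m] biprodD[OF l]
  have 1: "i \<cdot> r \<oplus> s \<cdot> x = one A" and 2: "m \<cdot> p \<oplus> m' \<cdot> p' = one A1" and 3: "l1 \<cdot> c1 \<oplus> l2 \<cdot> c2 = one L"
    using a m l by (simp_all add: biprod_iff)
  have "i \<cdot> r \<oplus> s \<cdot> (m \<cdot> p \<oplus> m' \<cdot> p') \<cdot> x = one A" unfolding 2 by (simp add: 1 D)
  then have 4: "i \<cdot> r \<oplus> s \<cdot> m \<cdot> p \<cdot> x \<oplus> s \<cdot> m' \<cdot> p' \<cdot> x = one A" using D by (simp add: pls_assoc)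
  show ?thesis unfolding biprod_iff by (simp add: D 3 4)
qed

text \<open>A normal form: up to isomorphisms of source and target, the morphism is the identity of
  \<open>M\<close> plus the zero map from \<open>M'\<close> to \<open>N'\<close>.\<close>

definition splits where
  "splits \<alpha> \<longleftrightarrow> (\<exists>M M' N' m m' p p' j n j' n'. is_biprod K M M' (dm \<alpha>) m m' p p' \<and>
     is_biprod K M N' (cd \<alpha>) j n j' n' \<and> \<alpha> = j \<cdot> p)"

lemma splits_nul:
  assumes "ob A" "ob B" shows "splits (nul A B)"
proof -
  obtain Z where Z: "zero_obj K Z" by (rule zero_obj_exists)
  have "nul A B = nul Z B \<cdot> nul A Z" by (simp add: assms zero_obj_ob[OF Z])
  moreover have "dm (nul A B) = A" "cd (nul A B) = B" by (simp_all add: assms)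
  ultimately show ?thesis unfolding splits_def
    using biprod_swap[OF biprod_zero[OF Z assms(1)]] biprod_swap[OF biprod_zero[OF Z assms(2)]] by metis
qed

text \<open>The killed summand \<open>U\<close> joins the kernel part \<open>M'\<close> of the
  normal form on \<open>A1\<close>.\<close>

lemma splits_kernel_summand:
  assumes a: "is_biprod K U A1 A i s r x" and \<alpha>: "arr \<alpha>" "dm \<alpha> = A" "\<alpha> \<cdot> i = nul U (cd \<alpha>)" and sp: "splits (\<alpha> \<cdot> s)"
  shows "splits \<alpha>"
proof -
  note A = biprodD[OF a]
  have t: "dm (\<alpha> \<cdot> s) = A1" "cd (\<alpha> \<cdot> s) = cd \<alpha>" by (simp_all add: A \<alpha>)
  obtain M M' N' m m' p p' j n j' n' where M: "is_biprod K M M' A1 m m' p p'" and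
     N: "is_biprod K M N' (cd \<alpha>) j n j' n'" and e: "\<alpha> \<cdot> s = j \<cdot> p"
    using sp unfolding splits_def t by blast
  note D = A biprodD[OF M] biprodD[OF N]
  obtain L l1 l2 c1 c2 where L: "is_biprod K U M' L l1 l2 c1 c2" by (rule biprod_exists[OF D(1) D(25)])
  have b: "is_biprod K M L A (s \<cdot> m) (i \<cdot> c1 \<oplus> s \<cdot> m' \<cdot> c2) (p \<cdot> x) (l1 \<cdot> r \<oplus> l2 \<cdot> p' \<cdot> x)"
    by (rule biprod_swap[OF biprod_assoc[OF a biprod_swap[OF M] L]])
  have "\<alpha> = (\<alpha> \<cdot> i) \<cdot> r \<oplus> (\<alpha> \<cdot> s) \<cdot> x" by (rule biprod_split[OF a \<alpha>(1,2)])
  also have "\<dots> = j \<cdot> p \<cdot> x" unfolding \<alpha>(3) e by (simp add: D \<alpha>(1,2))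
  finally show ?thesis unfolding splits_def \<alpha>(2) using b N by blast
qed

text \<open>Now \<open>U\<close> is carried isomorphically onto a summand of the target and joins
  the common part \<open>M\<close>. The condition that \<beta> after \<alpha> is the projection
  \<open>r\<close> excludes a mixed term from \<open>A1\<close> to \<open>U\<close>.\<close>

lemma splits_iso_summand:
  assumes a: "is_biprod K U A1 A i s r x" and b: "is_biprod K U B1 B b b1 \<beta> y"
    and \<alpha>: "arr \<alpha>" "dm \<alpha> = A" "cd \<alpha> = B" "\<alpha> \<cdot> i = b" "\<beta> \<cdot> \<alpha> = r" and sp: "splits (y \<cdot> \<alpha> \<cdot> s)"
  shows "splits \<alpha>"
proof -
  note A = biprodD[OF a] and B = biprodD[OF b]
  have t: "dm (y \<cdot> \<alpha> \<cdot> s) = A1" "cd (y \<cdot> \<alpha> \<cdot> s) = B1" by (simp_all add: A B \<alpha>(1-3))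
  obtain M M' N' m m' p p' j n j' n' where M: "is_biprod K M M' A1 m m' p p'" and
     N: "is_biprod K M N' B1 j n j' n'" and e: "y \<cdot> \<alpha> \<cdot> s = j \<cdot> p"
    using sp unfolding splits_def t by blast
  note D = A B biprodD[OF M] biprodD[OF N]
  obtain L l1 l2 c1 c2 where L: "is_biprod K U M L l1 l2 c1 c2" by (rule biprod_exists[OF D(1) D(47)])
  have bA: "is_biprod K L M' A (i \<cdot> c1 \<oplus> s \<cdot> m \<cdot> c2) (s \<cdot> m') (l1 \<cdot> r \<oplus> l2 \<cdot> p \<cdot> x) (p' \<cdot> x)"
    by (rule biprod_assoc[OF a M L])
  have bB: "is_biprod K L N' B (b \<cdot> c1 \<oplus> b1 \<cdot> j \<cdot> c2) (b1 \<cdot> n) (l1 \<cdot> \<beta> \<oplus> l2 \<cdot> j' \<cdot> y) (n' \<cdot> y)"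
    by (rule biprod_assoc[OF b N L])
  note D = D biprodD[OF L]
  have as: "arr (\<alpha> \<cdot> s)" "cd (\<alpha> \<cdot> s) = B" by (simp_all add: \<alpha>(1-3) A)
  have "\<beta> \<cdot> \<alpha> \<cdot> s = nul A1 U" by (simp add: reassoc[OF \<alpha>(5), of s] D \<alpha>(1-3))
  moreover have "\<alpha> \<cdot> s = b \<cdot> (\<beta> \<cdot> \<alpha> \<cdot> s) \<oplus> b1 \<cdot> (y \<cdot> \<alpha> \<cdot> s)" by (rule biprod_split_into[OF b as])
  ultimately have as': "\<alpha> \<cdot> s = b1 \<cdot> j \<cdot> p" unfolding e by (simp add: D)
  have "\<alpha> = (\<alpha> \<cdot> i) \<cdot> r \<oplus> (\<alpha> \<cdot> s) \<cdot> x" by (rule biprod_split[OF a \<alpha>(1,2)])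
  also have "\<dots> = b \<cdot> r \<oplus> b1 \<cdot> j \<cdot> p \<cdot> x" unfolding \<alpha>(4) as' by (simp add: D)
  also have "\<dots> = (b \<cdot> c1 \<oplus> b1 \<cdot> j \<cdot> c2) \<cdot> (l1 \<cdot> r \<oplus> l2 \<cdot> p \<cdot> x)" by (simp add: D)
  finally show ?thesis unfolding splits_def \<alpha>(2,3) using bA bB by blast
qed

lemma tri_sumI:
  assumes "is_triangle K (f1, g1, h1)" "is_triangle K (f2, g2, h2)" "is_triangle K (f, g, h)"
    "is_biprod K (dm f1) (dm f2) (dm f) a1 a2 x1 x2" "is_biprod K (dm g1) (dm g2) (dm g) b1 b2 y1 y2"
    "is_biprod K (dm h1) (dm h2) (dm h) c1 c2 z1 z2"
    "f = b1 \<cdot> f1 \<cdot> x1 \<oplus> b2 \<cdot> f2 \<cdot> x2" "g = c1 \<cdot> g1 \<cdot> y1 \<oplus> c2 \<cdot> g2 \<cdot> y2"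
    "h = Sh a1 \<cdot> h1 \<cdot> z1 \<oplus> Sh a2 \<cdot> h2 \<cdot> z2"
  shows "tri_sum K (f1, g1, h1) (f2, g2, h2) (f, g, h)"
  unfolding tri_sum_def prod.case using assms by blast

lemma split_sum_eq:
  assumes "split_tri K T1" "split_tri K T2" "tri_sum K T1 T2 (f, g, h)" shows "split_tri K (f, g, h)"
proof -
  have "is_triangle K (f, g, h)" using assms(3) by (simp add: tri_sum_def)
  then show ?thesis using split_sum[OF assms(1,2,3) tri_iso_refl] by blast
qed

text \<open>If \<open>f\<close> is in normal form, the third object has to be \<open>So M'\<close>
  plus \<open>N'\<close>, and the triangle is the sum of three trivial ones, on \<open>M\<close>,
  \<open>M'\<close> and \<open>N'\<close>. Exactness is stated through the lifting properties
  \<open>ex1\<close> to \<open>ex3\<close>, the form in which it is available in the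
  quotient.\<close>

lemma split_tri_if_splits:
  assumes ty: "arr f" "dm f = A" "cd f = B" "arr g" "dm g = B" "cd g = Z" "arr h" "dm h = Z" "cd h = So A"
    and ze: "g \<cdot> f = nul A Z" "h \<cdot> g = nul B (So A)" "Sh f \<cdot> h = nul Z (So B)"
    and ex1: "\<And>x. arr x \<Longrightarrow> cd x = B \<Longrightarrow> g \<cdot> x = nul (dm x) Z \<Longrightarrow> \<exists>y. arr y \<and> dm y = dm x \<and> cd y = A \<and> f \<cdot> y = x"
    and ex2: "\<And>x. arr x \<Longrightarrow> cd x = Z \<Longrightarrow> h \<cdot> x = nul (dm x) (So A) \<Longrightarrow> \<exists>y. arr y \<and> dm y = dm x \<and> cd y = B \<and> g \<cdot> y = x"
    and ex3: "\<And>x. arr x \<Longrightarrow> cd x = So A \<Longrightarrow> Sh f \<cdot> x = nul (dm x) (So B) \<Longrightarrow> \<exists>y. arr y \<and> dm y = dm x \<and> cd y = Z \<and> h \<cdot> y = x"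
    and sp: "splits f"
  shows "split_tri K (f, g, h)"
proof -
  obtain M M' N' m m' p p' j n j' n' where M: "is_biprod K M M' A m m' p p'" and
     N: "is_biprod K M N' B j n j' n'" and fe: "f = j \<cdot> p"
    using sp unfolding splits_def ty(2,3) by blast
  note D = biprodD[OF M] biprodD[OF N] biprodD[OF biprod_Sh[OF M]]
  have oZ: "ob Z" using ob_cd[OF ty(4)] unfolding ty(6) .
  note T = ty oZ D
  have "g \<cdot> j = (g \<cdot> f) \<cdot> m" unfolding fe by (simp add: T)
  then have gj: "g \<cdot> j = nul M Z" unfolding ze(1) by (simp add: T)
  have "Sh f \<cdot> Sh m' = Sh (f \<cdot> m')" by (simp add: T)
  also have "\<dots> = nul (So M') (So B)" unfolding fe by (simp add: T)
  \<comment> \<open>The inclusion of \<open>So M'\<close> into \<open>Z\<close>: as \<open>f\<close>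
    kills \<open>m'\<close>, the shifted inclusion lifts along \<open>h\<close>.\<close>
  finally obtain \<sigma> where si: "arr \<sigma>" "dm \<sigma> = So M'" "cd \<sigma> = Z" "h \<cdot> \<sigma> = Sh m'"
    using ex3[of "Sh m'"] T by auto
  define k where "k = Sh p' \<cdot> h"
  have k: "arr k" "dm k = Z" "cd k = So M'" using T by (simp_all add: k_def)
  have "Sh p \<cdot> h = Sh (j' \<cdot> f) \<cdot> h" unfolding fe by (simp add: T)
  also have "\<dots> = Sh j' \<cdot> (Sh f \<cdot> h)" by (simp add: T)
  also have "\<dots> = nul Z (So M)" unfolding ze(3) by (simp add: T)
  finally have ph: "Sh p \<cdot> h = nul Z (So M)" .
  have hk: "Sh m' \<cdot> k = h"
    using biprod_split_into[OF biprod_Sh[OF M], of h] ph T by (simp add: k_def)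
  \<comment> \<open>The complementary projection of \<open>Z\<close> is killed by \<open>h\<close>,
    so it comes from \<open>B\<close>. Only the \<open>N'\<close> component of that lift counts,
    because \<open>g j = 0\<close>.\<close>
  have "h \<cdot> (one Z \<oplus> mns (\<sigma> \<cdot> k)) = nul Z (So A)"
    by (simp add: T si(1-3) k hk reassoc[OF si(4), of k])
  then obtain y where y: "arr y" "dm y = Z" "cd y = B" "g \<cdot> y = one Z \<oplus> mns (\<sigma> \<cdot> k)"
    using ex2[of "one Z \<oplus> mns (\<sigma> \<cdot> k)"] T si(1-3) k by auto
  define \<pi> where "\<pi> = n' \<cdot> y"
  have pi: "arr \<pi>" "dm \<pi> = Z" "cd \<pi> = N'" using T y by (simp_all add: \<pi>_def)
  have "g \<cdot> y = g \<cdot> (j \<cdot> (j' \<cdot> y) \<oplus> n \<cdot> \<pi>)" unfolding \<pi>_def by (rule arg_cong[OF biprod_split_into[OF N y(1,3)]])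
  also have "\<dots> = g \<cdot> n \<cdot> \<pi>" by (simp add: T y(1-3) pi reassoc[OF gj, of "j' \<cdot> y"])
  finally have gnp: "g \<cdot> n \<cdot> \<pi> = one Z \<oplus> mns (\<sigma> \<cdot> k)" by (simp add: y(4))
  \<comment> \<open>A map killed by \<open>g n\<close> lifts along \<open>f\<close>, and
    \<open>f\<close> has no component in \<open>N'\<close>. The remaining biproduct identities are
    checked after this monomorphism.\<close>
  have mono: "w = nul (dm w) N'" if w: "arr w" "cd w = N'" "g \<cdot> n \<cdot> w = nul (dm w) Z" for w
  proof -
    obtain y0 where y0: "arr y0" "dm y0 = dm w" "cd y0 = A" "f \<cdot> y0 = n \<cdot> w"
      using ex1[of "n \<cdot> w"] w T by auto
    have "w = n' \<cdot> (n \<cdot> w)" by (simp add: w T)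
    also have "\<dots> = n' \<cdot> (j \<cdot> p) \<cdot> y0" unfolding y0(4)[symmetric] fe ..
    also have "\<dots> = nul (dm w) N'" by (simp add: y0(1-3) T)
    finally show ?thesis .
  qed
  have ks: "k \<cdot> \<sigma> = one (So M')" unfolding k_def by (simp add: T si)
  have kg: "k \<cdot> g = nul B (So M')" unfolding k_def by (simp add: T ze(2))
  have 1: "\<pi> \<cdot> g \<cdot> n = one N'"
  proof (rule eq_if_diff_nul)
    have "g \<cdot> n \<cdot> (\<pi> \<cdot> g \<cdot> n) = (g \<cdot> n \<cdot> \<pi>) \<cdot> g \<cdot> n" by (simp add: T pi)
    also have "\<dots> = g \<cdot> n" unfolding gnp by (simp add: T si(1-3) k reassoc[OF kg, of n])
    finally have "g \<cdot> n \<cdot> (\<pi> \<cdot> g \<cdot> n \<oplus> mns (one N')) = nul N' Z" by (simp add: T pi)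
    then show "\<pi> \<cdot> g \<cdot> n \<oplus> mns (one N') = nul N' N'"
      using mono[of "\<pi> \<cdot> g \<cdot> n \<oplus> mns (one N')"] T pi by simp
  qed (simp_all add: T pi)
  have 2: "\<pi> \<cdot> \<sigma> = nul (So M') N'"
  proof -
    have "g \<cdot> n \<cdot> (\<pi> \<cdot> \<sigma>) = (g \<cdot> n \<cdot> \<pi>) \<cdot> \<sigma>" by (simp add: T pi si(1-3))
    also have "\<dots> = nul (So M') Z" unfolding gnp by (simp add: T si(1-3) k ks)
    finally show ?thesis using mono[of "\<pi> \<cdot> \<sigma>"] pi si(1-3) by simp
  qed
  have 3: "\<sigma> \<cdot> k \<oplus> (g \<cdot> n) \<cdot> \<pi> = one Z"
  proof -
    have "(g \<cdot> n) \<cdot> \<pi> = one Z \<oplus> mns (\<sigma> \<cdot> k)" by (simp add: gnp T pi)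
    then show ?thesis using T si(1-3) k by (simp add: pls_comm[of "one Z"])
  qed
  have 4: "k \<cdot> g \<cdot> n = nul N' (So M')" by (simp add: reassoc[OF kg, of n] T k)
  have bZ: "is_biprod K (So M') N' Z \<sigma> (g \<cdot> n) k \<pi>"
    unfolding biprod_iff using 3 by (simp add: T si(1-3) k pi ks 1 2 4)
  have ge: "g = (g \<cdot> n) \<cdot> n'" using biprod_split[OF N, of g] T gj by simp
  obtain Z0 where Z0: "zero_obj K Z0" by (rule zero_obj_exists)
  note o = zero_obj_ob[OF Z0]
  \<comment> \<open>The trivial triangles \<open>M = M -> 0\<close>, \<open>M' -> 0 -> So M'\<close>
    and \<open>0 -> N' = N'\<close>.\<close>
  have s1: "split_tri K (one M, nul M Z0, nul Z0 (So M))"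
    by (rule split_base) (simp_all add: triangle_iff T o)
  have s2: "split_tri K (nul M' Z0, nul Z0 (So M'), one (So M'))"
    by (rule split_base) (simp_all add: triangle_iff T o)
  have s3: "split_tri K (nul Z0 N', one N', nul N' (So Z0))"
    by (rule split_base) (simp_all add: triangle_iff T o)
  have s23: "split_tri K (nul M' N', g \<cdot> n, k)"
  proof (rule split_sum_eq[OF s2 s3], rule tri_sumI)
    show "is_biprod K (dm (nul M' Z0)) (dm (nul Z0 N')) (dm (nul M' N')) (one M') (nul Z0 M') (one M') (nul M' Z0)"
      by (simp add: biprod_zero[OF Z0, of M'] T o)
    show "is_biprod K (dm (nul Z0 (So M'))) (dm (one N')) (dm (g \<cdot> n)) (nul Z0 N') (one N') (nul N' Z0) (one N')"
      by (simp add: biprod_swap[OF biprod_zero[OF Z0, of N']] T o)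
    show "is_biprod K (dm (one (So M'))) (dm (nul N' (So Z0))) (dm k) \<sigma> (g \<cdot> n) k \<pi>"
      by (simp add: bZ T o k)
  qed (simp_all add: triangle_iff T o k si(1-3) pi)
  show ?thesis
  proof (rule split_sum_eq[OF s1 s23], rule tri_sumI)
    show "is_biprod K (dm (one M)) (dm (nul M' N')) (dm f) m m' p p'" by (simp add: M T)
    show "is_biprod K (dm (nul M Z0)) (dm (g \<cdot> n)) (dm g) j n j' n'" by (simp add: N T o)
    show "is_biprod K (dm (nul Z0 (So M))) (dm k) (dm h) (nul Z0 Z) (one Z) (nul Z Z0) (one Z)"
      by (simp add: biprod_swap[OF biprod_zero[OF Z0, of Z]] T o k)
    show "f = j \<cdot> one M \<cdot> p \<oplus> n \<cdot> nul M' N' \<cdot> p'" unfolding fe by (simp add: D)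
    show "g = nul Z0 Z \<cdot> nul M Z0 \<cdot> j' \<oplus> one Z \<cdot> (g \<cdot> n) \<cdot> n'" using ge by (simp add: T o)
    show "h = Sh m \<cdot> nul Z0 (So M) \<cdot> nul Z Z0 \<oplus> Sh m' \<cdot> k \<cdot> one Z" by (simp add: hk T o k)
  qed (simp_all add: triangle_iff T o k)
qed

text \<open>Only the source is decomposed; on the target a retraction of \<open>j\<close> is kept.
  For an indecomposable source this already says that \<open>f\<close> is zero or a split
  monomorphism.\<close>

definition half_splits where
  "half_splits f \<longleftrightarrow> (\<exists>M M' m m' p p' j j'. is_biprod K M M' (dm f) m m' p p' \<and>
     arr j \<and> dm j = M \<and> cd j = cd f \<and> arr j' \<and> dm j' = cd f \<and> cd j' = M \<and> j' \<cdot> j = one M \<and> f = j \<cdot> p)"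

lemma half_splits_nul: "ob A \<Longrightarrow> ob B \<Longrightarrow> half_splits (nul A B)"
  using splits_nul[of A B] unfolding splits_def half_splits_def biprod_iff by metis

lemma half_splits_iso: assumes "iso_mor K f" shows "half_splits f"
proof -
  obtain Z where Z: "zero_obj K Z" by (rule zero_obj_exists)
  note f = iso_arr[OF assms]
  obtain g where "arr g" "dm g = cd f" "cd g = dm f" "g \<cdot> f = one (dm f)" "f \<cdot> g = one (cd f)"
    by (rule iso_inv[OF assms])
  moreover have "f = f \<cdot> one (dm f)" by (simp add: f)
  ultimately show ?thesis unfolding half_splits_def using biprod_zero[OF Z ob_dm[OF f]] f by metis
qed

lemma half_splits_sum:
  assumes h1: "half_splits f1" and h2: "half_splits f2" and f1: "arr f1" "dm f1 = A1" "cd f1 = B1" and f2: "arr f2" "dm f2 = A2" "cd f2 = B2"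
    and a: "is_biprod K A1 A2 A a1 a2 x1 x2" and b: "is_biprod K B1 B2 B b1 b2 y1 y2"
  shows "half_splits (b1 \<cdot> f1 \<cdot> x1 \<oplus> b2 \<cdot> f2 \<cdot> x2)"
proof -
  obtain M1 N1 m1 n1 p1 r1 j1 k1 where M1: "is_biprod K M1 N1 A1 m1 n1 p1 r1" and
    j1: "arr j1" "dm j1 = M1" "cd j1 = B1" "arr k1" "dm k1 = B1" "cd k1 = M1" "k1 \<cdot> j1 = one M1" and e1: "f1 = j1 \<cdot> p1"
    using h1 unfolding half_splits_def f1(2,3) by blast
  obtain M2 N2 m2 n2 p2 r2 j2 k2 where M2: "is_biprod K M2 N2 A2 m2 n2 p2 r2" and
    j2: "arr j2" "dm j2 = M2" "cd j2 = B2" "arr k2" "dm k2 = B2" "cd k2 = M2" "k2 \<cdot> j2 = one M2" and e2: "f2 = j2 \<cdot> p2"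
    using h2 unfolding half_splits_def f2(2,3) by blast
  note D = biprodD[OF a] biprodD[OF b] biprodD[OF M1] biprodD[OF M2]
  have o: "ob M1" "ob M2" "ob N1" "ob N2" using M1 M2 by (simp_all add: biprod_iff)
  obtain L l1 l2 c1 c2 where L: "is_biprod K M1 M2 L l1 l2 c1 c2" by (rule biprod_exists[OF o(1,2)])
  obtain L' l1' l2' c1' c2' where L': "is_biprod K N1 N2 L' l1' l2' c1' c2'" by (rule biprod_exists[OF o(3,4)])
  note D = D biprodD[OF L] biprodD[OF L']
  define m where "m = a1 \<cdot> m1 \<cdot> c1 \<oplus> a2 \<cdot> m2 \<cdot> c2"
  define n where "n = a1 \<cdot> n1 \<cdot> c1' \<oplus> a2 \<cdot> n2 \<cdot> c2'"
  define p where "p = l1 \<cdot> p1 \<cdot> x1 \<oplus> l2 \<cdot> p2 \<cdot> x2"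
  define r where "r = l1' \<cdot> r1 \<cdot> x1 \<oplus> l2' \<cdot> r2 \<cdot> x2"
  have s: "l1 \<cdot> c1 \<oplus> l2 \<cdot> c2 = one L" "l1' \<cdot> c1' \<oplus> l2' \<cdot> c2' = one L'"
    using biprod_sum[OF L] biprod_sum[OF L'] .
  have "a1 \<cdot> (m1 \<cdot> p1 \<oplus> n1 \<cdot> r1) \<cdot> x1 \<oplus> a2 \<cdot> (m2 \<cdot> p2 \<oplus> n2 \<cdot> r2) \<cdot> x2 = one A"
    by (simp add: biprod_sum[OF a] biprod_sum[OF M1] biprod_sum[OF M2] D)
  then have "(a1 \<cdot> m1 \<cdot> p1 \<cdot> x1 \<oplus> a2 \<cdot> m2 \<cdot> p2 \<cdot> x2) \<oplus> (a1 \<cdot> n1 \<cdot> r1 \<cdot> x1 \<oplus> a2 \<cdot> n2 \<cdot> r2 \<cdot> x2) = one A"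
    using D by (simp add: pls_ac)
  then have bA: "is_biprod K L L' A m n p r"
    unfolding biprod_iff m_def n_def p_def r_def by (simp add: D s)
  define j where "j = b1 \<cdot> j1 \<cdot> c1 \<oplus> b2 \<cdot> j2 \<cdot> c2"
  define k where "k = l1 \<cdot> k1 \<cdot> y1 \<oplus> l2 \<cdot> k2 \<cdot> y2"
  have kj: "k \<cdot> j = one L" unfolding k_def j_def by (simp add: D j1 j2 s reassoc[OF j1(7), of c1] reassoc[OF j2(7), of c2])
  have jt: "arr j" "dm j = L" "cd j = B" "arr k" "dm k = B" "cd k = L"
    unfolding k_def j_def by (simp_all add: D j1 j2)
  have fe: "b1 \<cdot> f1 \<cdot> x1 \<oplus> b2 \<cdot> f2 \<cdot> x2 = j \<cdot> p" unfolding j_def p_def e1 e2 by (simp add: D j1 j2)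
  have "dm (j \<cdot> p) = A" "cd (j \<cdot> p) = B" using bA jt by (simp_all add: biprod_iff)
  then show ?thesis unfolding half_splits_def fe using bA jt kj by metis
qed

lemma half_splits_transport:
  assumes h: "half_splits f" and f: "arr f" and a: "iso_mor K a" "dm a = dm f" and b: "iso_mor K b" "dm b = cd f"
    and f': "arr f'" "dm f' = cd a" "cd f' = cd b" "b \<cdot> f = f' \<cdot> a"
  shows "half_splits f'"
proof -
  obtain M M' m m' p p' j k where M: "is_biprod K M M' (dm f) m m' p p'" and
    j: "arr j" "dm j = M" "cd j = cd f" "arr k" "dm k = cd f" "cd k = M" "k \<cdot> j = one M" and e: "f = j \<cdot> p"
    using h unfolding half_splits_def by blast
  note D = biprodD[OF M] iso_arr[OF a(1)] iso_arr[OF b(1)]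
  obtain a' where a': "arr a'" "dm a' = cd a" "cd a' = dm f" "a' \<cdot> a = one (dm f)" "a \<cdot> a' = one (cd a)"
    "is_biprod K M M' (cd a) (a \<cdot> m) (a \<cdot> m') (p \<cdot> a') (p' \<cdot> a')"
    by (rule biprod_iso[OF M a])
  obtain b' where b': "arr b'" "dm b' = cd b" "cd b' = dm b" "b' \<cdot> b = one (dm b)"
    using iso_inv[OF b(1)] by metis
  have "f' = (f' \<cdot> a) \<cdot> a'" by (simp add: f' a' D a(2))
  also have "\<dots> = (b \<cdot> (j \<cdot> p)) \<cdot> a'" unfolding f'(4)[symmetric] e[symmetric] ..
  also have "\<dots> = (b \<cdot> j) \<cdot> (p \<cdot> a')" by (simp add: j b(2) a'(1-3) D)
  finally have 1: "f' = (b \<cdot> j) \<cdot> (p \<cdot> a')" .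
  have 2: "(k \<cdot> b') \<cdot> (b \<cdot> j) = one M" by (simp add: j b' b(2) D reassoc[OF b'(4), of j])
  have 3: "arr (b \<cdot> j)" "dm (b \<cdot> j) = M" "cd (b \<cdot> j) = cd f'" "arr (k \<cdot> b')" "dm (k \<cdot> b') = cd f'" "cd (k \<cdot> b') = M"
    by (simp_all add: j b' b(2) D f')
  show ?thesis unfolding half_splits_def using a'(6)[folded f'(2)] 1 2 3 by blast
qed

text \<open>The inclusion of a summand has the retraction \<open>z\<close> at the third object, so a
  vanishing composite of the sum restricts to the summand.\<close>

lemma comp_zero_summand:
  assumes e: "f' \<cdot> a = b \<cdot> f" "g' \<cdot> b = c \<cdot> g" "z \<cdot> c = one (cd g)" "g' \<cdot> f' = nul (dm f') (cd g')"
    and t: "arr f" "arr g" "arr f'" "arr g'" "arr a" "arr b" "arr c" "arr z" "dm g = cd f" "dm g' = cd f'"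
      "dm a = dm f" "cd a = dm f'" "dm b = cd f" "cd b = cd f'" "dm c = cd g" "cd c = cd g'" "dm z = cd g'" "cd z = cd g"
  shows "g \<cdot> f = nul (dm f) (cd g)"
proof -
  have "g \<cdot> f = (z \<cdot> c) \<cdot> g \<cdot> f" unfolding e(3) by (simp add: t)
  also have "\<dots> = z \<cdot> (g' \<cdot> b) \<cdot> f" unfolding e(2) by (simp add: t)
  also have "\<dots> = z \<cdot> g' \<cdot> (f' \<cdot> a)" unfolding e(1) by (simp add: t)
  also have "\<dots> = z \<cdot> (g' \<cdot> f') \<cdot> a" by (simp add: t)
  also have "\<dots> = nul (dm f) (cd g)" unfolding e(4) by (simp add: t)
  finally show ?thesis .
qed

text \<open>\<open>split_base\<close> accepts any candidate triangle with one invertible arrow. Only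
  the vanishing of consecutive composites turns an invertible \<open>g\<close> or \<open>h\<close>
  into \<open>f = 0\<close>, so these three equations are carried through the induction.\<close>

lemma half_splits_if_split_tri:
  assumes "split_tri K (f, g, h)"
    and "g \<cdot> f = nul (dm f) (cd g)" "h \<cdot> g = nul (cd f) (cd h)" "Sh f \<cdot> h = nul (cd g) (So (cd f))"
  shows "half_splits f"
proof -
  have "half_splits (fst T)"
    if "split_tri K T" "fst (snd T) \<cdot> fst T = nul (dm (fst T)) (cd (fst (snd T)))"
      "snd (snd T) \<cdot> fst (snd T) = nul (cd (fst T)) (cd (snd (snd T)))"
      "Sh (fst T) \<cdot> snd (snd T) = nul (cd (fst (snd T))) (So (cd (fst T)))" for T
    using that
  proof (induction T rule: split_tri.induct)
    case (split_base f g h)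
    then have t: "arr f" "arr g" "arr h" "dm g = cd f" "dm h = cd g" "cd h = So (dm f)"
      and z: "g \<cdot> f = nul (dm f) (cd g)" "Sh f \<cdot> h = nul (cd g) (So (cd f))" by (simp_all add: triangle_iff)
    have "f = nul (dm f) (cd f)" if g: "iso_mor K g"
    proof -
      obtain g' where g': "arr g'" "dm g' = cd g" "cd g' = dm g" "g' \<cdot> g = one (dm g)" using iso_inv[OF g] by metis
      have "f = g' \<cdot> g \<cdot> f" by (simp add: reassoc[OF g'(4), of f] g'(1-3) t)
      then show ?thesis unfolding z by (simp add: g'(1-3) t)
    qed
    moreover have "f = nul (dm f) (cd f)" if h: "iso_mor K h"
    proof -
      obtain h' where h': "arr h'" "dm h' = cd h" "cd h' = dm h" "h \<cdot> h' = one (cd h)" using iso_inv[OF h] by metis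
      have "Sh f = (Sh f \<cdot> h) \<cdot> h'" by (simp add: h' t)
      also have "\<dots> = nul (So (dm f)) (So (cd f))" unfolding z by (simp add: h' t)
      finally show ?thesis by (rule Sh_eq_nul) (simp_all add: t)
    qed
    ultimately show ?case using split_base(2) half_splits_iso half_splits_nul[of "dm f" "cd f"] t by auto
  next
    case (split_sum T1 T2 T' T)
    obtain f1 g1 h1 where T1: "T1 = (f1, g1, h1)" by (cases T1)
    obtain f2 g2 h2 where T2: "T2 = (f2, g2, h2)" by (cases T2)
    obtain f' g' h' where T': "T' = (f', g', h')" by (cases T')
    obtain f g h where T: "T = (f, g, h)" by (cases T)
    have tr: "is_triangle K (f1, g1, h1)" "is_triangle K (f2, g2, h2)" "is_triangle K (f', g', h')" "is_triangle K (f, g, h)"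
      using split_sum(3,4) unfolding T1 T2 T' T tri_sum_def tri_iso_def by blast+
    note t = tr[unfolded triangle_iff]
    obtain a b c where "tri_morph K (f', g', h') (f, g, h) a b c" and i: "iso_mor K a" "iso_mor K b" "iso_mor K c"
      using split_sum(4) unfolding T' T tri_iso_def by blast
    then have m: "dm a = dm f'" "cd a = dm f" "dm b = cd f'" "cd b = cd f" "dm c = cd g'" "cd c = cd g"
      "b \<cdot> f' = f \<cdot> a" "c \<cdot> g' = g \<cdot> b" "Sh a \<cdot> h' = h \<cdot> c" "arr a" "arr b" "arr c"
      using t by (simp_all add: tri_morph_def hom_iff)
    obtain a' where a': "arr a'" "dm a' = dm f" "cd a' = dm f'" "a \<cdot> a' = one (dm f)" "a' \<cdot> a = one (dm f')" using iso_inv[OF i(1)] m by metis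
    obtain b' where b': "arr b'" "dm b' = cd f" "cd b' = cd f'" "b \<cdot> b' = one (cd f)" "b' \<cdot> b = one (cd f')" using iso_inv[OF i(2)] m by metis
    obtain c' where c': "arr c'" "dm c' = cd g" "cd c' = cd g'" "c \<cdot> c' = one (cd g)" "c' \<cdot> c = one (cd g')" using iso_inv[OF i(3)] m by metis
    have z: "g \<cdot> f = nul (dm f) (cd g)" "h \<cdot> g = nul (cd f) (cd h)" "Sh f \<cdot> h = nul (cd g) (So (cd f))"
      using split_sum.prems unfolding T by simp_all
    \<comment> \<open>The vanishing composites pass from \<open>T\<close> to the isomorphic sum
      \<open>T'\<close>, and from there to both summands.\<close>
    have "g' \<cdot> f' = c' \<cdot> (c \<cdot> g') \<cdot> f'" by (simp add: reassoc[OF c'(5), of g'] reassoc[OF c'(5), of "g' \<cdot> f'"] c' t m(1-6,10-12))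
    also have "\<dots> = c' \<cdot> (g \<cdot> b) \<cdot> f'" unfolding m(8) ..
    also have "\<dots> = c' \<cdot> g \<cdot> (b \<cdot> f')" by (simp add: c' t m(1-6,10-12))
    also have "\<dots> = c' \<cdot> (g \<cdot> f) \<cdot> a" unfolding m(7) by (simp add: c' t m(1-6,10-12))
    finally have z1': "g' \<cdot> f' = nul (dm f') (cd g')" unfolding z by (simp add: c' t m(1-6,10-12))
    have Sa: "Sh a' \<cdot> Sh a = one (So (dm f'))" by (simp add: a' m t flip: Sh_cmp)
    have "h' \<cdot> g' = Sh a' \<cdot> (Sh a \<cdot> h') \<cdot> g'" by (simp add: reassoc[OF Sa, of "h' \<cdot> g'"] a' t m(1-6,10-12))
    also have "\<dots> = Sh a' \<cdot> h \<cdot> (c \<cdot> g')" unfolding m(9) by (simp add: a' t m(1-6,10-12))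
    also have "\<dots> = Sh a' \<cdot> (h \<cdot> g) \<cdot> b" unfolding m(8) by (simp add: a' t m(1-6,10-12))
    finally have z2': "h' \<cdot> g' = nul (cd f') (So (dm f'))" unfolding z by (simp add: a' t m(1-6,10-12))
    have Sb: "Sh b' \<cdot> Sh b = one (So (cd f'))" by (simp add: b' m t flip: Sh_cmp)
    have "Sh f' \<cdot> h' = Sh b' \<cdot> (Sh b \<cdot> Sh f') \<cdot> h'" by (simp add: reassoc[OF Sb, of "Sh f' \<cdot> h'"] b' t m(1-6,10-12))
    also have "Sh b \<cdot> Sh f' = Sh f \<cdot> Sh a" using m t by (simp flip: Sh_cmp)
    also have "Sh b' \<cdot> (Sh f \<cdot> Sh a) \<cdot> h' = Sh b' \<cdot> Sh f \<cdot> (Sh a \<cdot> h')" by (simp add: a' b' t m(1-6,10-12))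
    also have "\<dots> = Sh b' \<cdot> (Sh f \<cdot> h) \<cdot> c" unfolding m(9) by (simp add: a' b' t m(1-6,10-12))
    finally have z3': "Sh f' \<cdot> h' = nul (cd g') (So (cd f'))" unfolding z by (simp add: b' t m(1-6,10-12))
    obtain a1 a2 x1 x2 b1 b2 y1 y2 c1 c2 z1 z2 where
      bi: "is_biprod K (dm f1) (dm f2) (dm f') a1 a2 x1 x2" "is_biprod K (dm g1) (dm g2) (dm g') b1 b2 y1 y2"
       "is_biprod K (dm h1) (dm h2) (dm h') c1 c2 z1 z2"
      and e: "f' = b1 \<cdot> f1 \<cdot> x1 \<oplus> b2 \<cdot> f2 \<cdot> x2" "g' = c1 \<cdot> g1 \<cdot> y1 \<oplus> c2 \<cdot> g2 \<cdot> y2" "h' = Sh a1 \<cdot> h1 \<cdot> z1 \<oplus> Sh a2 \<cdot> h2 \<cdot> z2"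
      using split_sum(3) unfolding T1 T2 T' tri_sum_def prod.case by blast
    have tt: "arr f1" "arr g1" "arr h1" "arr f2" "arr g2" "arr h2" "cd h1 = So (dm f1)" "cd h2 = So (dm f2)"
       "dm g1 = cd f1" "dm g2 = cd f2" "dm h1 = cd g1" "dm h2 = cd g2" "dm g' = cd f'" "dm h' = cd g'"
      by (simp_all add: t)
    note D = biprodD[OF bi(1)] biprodD[OF bi(2)] biprodD[OF bi(3)]
       biprodD[OF biprod_Sh[OF bi(1)]] biprodD[OF biprod_Sh[OF bi(2)]]
    note D' = D tt
    have f'i: "f' \<cdot> a1 = b1 \<cdot> f1" "f' \<cdot> a2 = b2 \<cdot> f2" unfolding e by (simp_all add: D')
    have g'i: "z1 \<cdot> g' = g1 \<cdot> y1" "z2 \<cdot> g' = g2 \<cdot> y2" "g' \<cdot> b1 = c1 \<cdot> g1" "g' \<cdot> b2 = c2 \<cdot> g2" unfolding e by (simp_all add: D')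
    have h'i: "Sh x1 \<cdot> h' = h1 \<cdot> z1" "Sh x2 \<cdot> h' = h2 \<cdot> z2" "h' \<cdot> c1 = Sh a1 \<cdot> h1" "h' \<cdot> c2 = Sh a2 \<cdot> h2" unfolding e by (simp_all add: D')
    have t': "arr f'" "arr g'" "arr h'" "cd h' = So (dm f')" by (simp_all add: t)
    have gf1: "g1 \<cdot> f1 = nul (dm f1) (cd g1)"
      by (rule comp_zero_summand[OF f'i(1) g'i(3) _ z1', where z = z1]) (simp_all add: D tt t')
    have gf2: "g2 \<cdot> f2 = nul (dm f2) (cd g2)"
      by (rule comp_zero_summand[OF f'i(2) g'i(4) _ z1', where z = z2]) (simp_all add: D tt t')
    have hg1: "h1 \<cdot> g1 = nul (dm g1) (cd h1)"
      by (rule comp_zero_summand[OF g'i(3) h'i(3) _ z2'[folded tt(13) t'(4)], where z = "Sh x1"]) (simp_all add: D tt t')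
    have hg2: "h2 \<cdot> g2 = nul (dm g2) (cd h2)"
      by (rule comp_zero_summand[OF g'i(4) h'i(4) _ z2'[folded tt(13) t'(4)], where z = "Sh x2"]) (simp_all add: D tt t')
    have Sf: "Sh f' \<cdot> Sh a1 = Sh b1 \<cdot> Sh f1" "Sh f' \<cdot> Sh a2 = Sh b2 \<cdot> Sh f2"
      using D tt t' f'i by (simp_all flip: Sh_cmp)
    have zz: "Sh f' \<cdot> h' = nul (dm h') (cd (Sh f'))" by (simp add: z3' tt(14) t'(1))
    have fh1: "Sh f1 \<cdot> h1 = nul (dm h1) (cd (Sh f1))"
      by (rule comp_zero_summand[OF h'i(3) Sf(1) _ zz, where z = "Sh y1"]) (simp_all add: D tt t')
    have fh2: "Sh f2 \<cdot> h2 = nul (dm h2) (cd (Sh f2))"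
      by (rule comp_zero_summand[OF h'i(4) Sf(2) _ zz, where z = "Sh y2"]) (simp_all add: D tt t')
    have "half_splits f1" "half_splits f2"
      using split_sum.IH gf1 gf2 hg1 hg2 fh1 fh2 tt unfolding T1 T2 by simp_all
    then have "half_splits f'" unfolding e(1)
      by (rule half_splits_sum[OF _ _ tt(1) refl refl tt(4) refl refl bi(1) bi(2)[unfolded tt(9,10)]])
    then have "half_splits f" by (rule half_splits_transport[of f' a b f]) (simp_all add: t' i m t)
    then show ?case unfolding T by simp
  qed
  from this[OF assms(1)] assms(2-) show ?thesis by simp
qed

end

section \<open>Localizing rank functions\<close>

context additive_shift_category begin

text \<open>In \<open>split_tri\<close>, transport along isomorphisms is part of the sum rule, so a
  zero triangle is added.\<close>

lemma split_tri_iso: assumes s: "split_tri K T" and i: "tri_iso K T T'" shows "split_tri K T'"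
proof -
  obtain f g h where T: "T = (f, g, h)" by (cases T)
  have t: "is_triangle K (f, g, h)" using i unfolding T tri_iso_def by blast
  note t' = t[unfolded triangle_iff]
  obtain Z where Z: "zero_obj K Z" by (rule zero_obj_exists)
  note o = zero_obj_ob[OF Z]
  have z: "iso_mor K (nul Z Z)" using Z iso_one[OF o] by (simp add: zero_obj_iff)
  have t0: "is_triangle K (nul Z Z, nul Z Z, nul Z (So Z))" using o by (simp add: triangle_iff)
  have s0: "split_tri K (nul Z Z, nul Z Z, nul Z (So Z))" by (rule split_base) (use t0 z in blast)+
  have "tri_sum K (f, g, h) (nul Z Z, nul Z Z, nul Z (So Z)) (f, g, h)"
  proof (rule tri_sumI[OF t t0 t])
    show "is_biprod K (dm f) (dm (nul Z Z)) (dm f) (one (dm f)) (nul Z (dm f)) (one (dm f)) (nul (dm f) Z)"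
      "is_biprod K (dm g) (dm (nul Z Z)) (dm g) (one (dm g)) (nul Z (dm g)) (one (dm g)) (nul (dm g) Z)"
      "is_biprod K (dm h) (dm (nul Z (So Z))) (dm h) (one (dm h)) (nul Z (dm h)) (one (dm h)) (nul (dm h) Z)"
      using biprod_zero[OF Z, of "dm f"] biprod_zero[OF Z, of "dm g"] biprod_zero[OF Z, of "dm h"] t' o by simp_all
  qed (use t' o in simp_all)
  then show ?thesis using split_sum[OF s s0] i unfolding T by blast
qed

definition hom_zero where
  "hom_zero Y U \<longleftrightarrow> (\<forall>\<alpha>. arr \<alpha> \<longrightarrow> dm \<alpha> = Y \<longrightarrow> cd \<alpha> = U \<longrightarrow> \<alpha> = nul Y U)"

lemma hom_zeroD: "hom_zero Y U \<Longrightarrow> arr \<alpha> \<Longrightarrow> dm \<alpha> = Y \<Longrightarrow> cd \<alpha> = U \<Longrightarrow> \<alpha> = nul Y U"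
  by (simp add: hom_zero_def)

lemma hom_zero_iso:
  assumes z: "hom_zero Y U" and Y: "isomorphic K Y Y'" and U: "isomorphic K U U'"
  shows "hom_zero Y' U'"
  unfolding hom_zero_def
proof (intro allI impI)
  fix \<alpha> assume a: "arr \<alpha>" "dm \<alpha> = Y'" "cd \<alpha> = U'"
  obtain y where y: "iso_mor K y" "arr y" "dm y = Y" "cd y = Y'" using Y by (rule isomorphicE)
  obtain u where u: "iso_mor K u" "arr u" "dm u = U" "cd u = U'" using U by (rule isomorphicE)
  obtain y' where y': "arr y'" "dm y' = Y'" "cd y' = Y" "y \<cdot> y' = one Y'" using iso_inv[OF y(1)] y by metis
  obtain u' where u': "arr u'" "dm u' = U'" "cd u' = U" "u \<cdot> u' = one U'" using iso_inv[OF u(1)] u by metis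
  have z: "u' \<cdot> \<alpha> \<cdot> y = nul Y U" by (rule hom_zeroD[OF z]) (use a y u' in simp_all)
  have "\<alpha> = (u \<cdot> u') \<cdot> \<alpha> \<cdot> (y \<cdot> y')" unfolding u'(4) y'(4) using a by simp
  also have "\<dots> = u \<cdot> (u' \<cdot> \<alpha> \<cdot> y) \<cdot> y'" using a u(2-4) u'(1-3) y(2-4) y'(1-3) by simp
  also have "\<dots> = nul Y' U'" unfolding z using u(2-4) y'(1-3) y(2-4) ob_dm[OF u(2)] ob_dm[OF y(2)] ob_dm[OF y'(1)] by simp
  finally show "\<alpha> = nul Y' U'" .
qed

lemma hom_zero_So:
  assumes "ob Y" "ob U" shows "hom_zero (So Y) (So U) \<longleftrightarrow> hom_zero Y U"
proof
  assume z: "hom_zero (So Y) (So U)"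
  show "hom_zero Y U" unfolding hom_zero_def
  proof (intro allI impI)
    fix \<alpha> assume a: "arr \<alpha>" "dm \<alpha> = Y" "cd \<alpha> = U"
    have "Sh \<alpha> = nul (So Y) (So U)" by (rule hom_zeroD[OF z]) (use a in simp_all)
    then show "\<alpha> = nul Y U" by (rule Sh_eq_nul[OF _ a])
  qed
next
  assume z: "hom_zero Y U"
  show "hom_zero (So Y) (So U)" unfolding hom_zero_def
  proof (intro allI impI)
    fix \<alpha> assume "arr \<alpha>" "dm \<alpha> = So Y" "cd \<alpha> = So U"
    then obtain \<beta> where b: "arr \<beta>" "dm \<beta> = Y" "cd \<beta> = U" "\<alpha> = Sh \<beta>" using Sh_full assms by metis
    then show "\<alpha> = nul (So Y) (So U)" using hom_zeroD[OF z b(1-3)] assms by simp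
  qed
qed

end

context thick_subcategory begin

lemma isomorphic_desuspend:
  assumes "ob Y" obtains Y' where "ob Y'" "isomorphic V (So Y') Y" "isomorphic V Y (So Y')"
  using desuspend[OF assms] q_isomorphic isomorphicI isomorphic_sym by metis

text \<open>The left orthogonal of \<open>U0\<close> is shift invariant, so its right orthogonal is thick and contains the generator.\<close>
lemma generator_detects:
  assumes gen: "generator K X" and U0: "U0 \<subseteq> t_ob K" "X \<in> U0"
    and iso: "\<And>U U'. U \<in> U0 \<Longrightarrow> isomorphic V U U' \<Longrightarrow> U' \<in> U0"
    and sh: "\<And>U. ob U \<Longrightarrow> So U \<in> U0 \<longleftrightarrow> U \<in> U0"
    and Y: "ob Y" "Y \<notin> S"
  obtains U \<alpha> where "U \<in> U0" "V.arr \<alpha>" "V.dm \<alpha> = Y" "V.cd \<alpha> = U" "\<alpha> \<noteq> V.nul Y U"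
proof (rule ccontr)
  assume no: "\<not> thesis"
  define N where "N = {Y. ob Y \<and> (\<forall>U\<in>U0. V.hom_zero Y U)}"
  define P where "P = {A. ob A \<and> (\<forall>Y\<in>N. V.hom_zero Y A)}"
  have "Y \<in> N" unfolding N_def V.hom_zero_def using no that Y by blast
  have Niso: "Y' \<in> N" if "Y \<in> N" "isomorphic V Y Y'" for Y Y'
  proof -
    have "ob Y'" using that(2) V.ob_cd by (metis V_ob V.isomorphicE)
    then show ?thesis using that V.hom_zero_iso[OF _ that(2) V.isomorphic_refl] U0(1) unfolding N_def by auto
  qed
  have Nsh: "So Y \<in> N \<longleftrightarrow> Y \<in> N" if Y: "ob Y" for Y
  proof
    assume "So Y \<in> N"
    then have "V.hom_zero (So Y) (So U)" if "U \<in> U0" for U using that sh U0(1) unfolding N_def by auto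
    then show "Y \<in> N" using V.hom_zero_So[of Y] Y U0(1) unfolding N_def by auto
  next
    assume YN: "Y \<in> N"
    \<comment> \<open>\<open>U\<close> is a shift only up to isomorphism in the quotient; the
      desuspended \<open>U'\<close> stays in \<open>U0\<close> because \<open>U0\<close> is closed
      under both.\<close>
    have "V.hom_zero (So Y) U" if U: "U \<in> U0" for U
    proof -
      obtain U' where U': "ob U'" "isomorphic V (So U') U" "isomorphic V U (So U')"
        using isomorphic_desuspend U U0(1) by blast
      have "U' \<in> U0" using iso[OF U U'(3)] sh[OF U'(1)] by simp
      then have "V.hom_zero (So Y) (So U')" using YN V.hom_zero_So[of Y U'] U' unfolding N_def by simp
      then show ?thesis using V.hom_zero_iso[OF _ V.isomorphic_refl U'(2)] Y by simp
    qed
    then show "So Y \<in> N" using Y unfolding N_def by simp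
  qed
  have Piso: "A' \<in> P" if "A \<in> P" "isomorphic V A A'" for A A'
  proof -
    have "ob A'" using that(2) V.ob_cd by (metis V_ob V.isomorphicE)
    moreover have "V.hom_zero Y A'" if "Y \<in> N" for Y
      using V.hom_zero_iso[OF _ V.isomorphic_refl \<open>isomorphic V A A'\<close>, of Y] that \<open>A \<in> P\<close> unfolding P_def N_def by simp
    ultimately show ?thesis unfolding P_def by simp
  qed
  have Psh: "So A \<in> P \<longleftrightarrow> A \<in> P" if A: "ob A" for A
  proof
    assume "So A \<in> P"
    then have "V.hom_zero (So Y) (So A)" if "Y \<in> N" for Y using that Nsh[of Y] unfolding P_def N_def by auto
    then show "A \<in> P" using V.hom_zero_So[of _ A] A unfolding P_def N_def by auto
  next
    assume AP: "A \<in> P"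
    have "V.hom_zero Y (So A)" if Y: "Y \<in> N" for Y
    proof -
      obtain Y' where Y': "ob Y'" "isomorphic V (So Y') Y" "isomorphic V Y (So Y')"
        using isomorphic_desuspend Y unfolding N_def by blast
      have "Y' \<in> N" using Niso[OF Y Y'(3)] Nsh[OF Y'(1)] by simp
      then have "V.hom_zero (So Y') (So A)" using AP V.hom_zero_So[of Y' A] Y' A unfolding P_def by simp
      then show ?thesis using V.hom_zero_iso[OF _ Y'(2) V.isomorphic_refl] A by simp
    qed
    then show "So A \<in> P" using A unfolding P_def by simp
  qed
  have "tri_subcat K P"
  proof (rule tri_subcatI)
    show "P \<subseteq> t_ob K" unfolding P_def by blast
    have XP: "X \<in> P" using U0 unfolding P_def N_def by blast
    then show "P \<noteq> {}" by blast
    show "B \<in> P" if "A \<in> P" "isomorphic K A B" for A B using Piso that q_isomorphic by blast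
    show "So A \<in> P \<longleftrightarrow> A \<in> P" if "ob A" for A using Psh[OF that] .
    fix A B Z f g h assume t: "tri A B Z f g h" and A: "A \<in> P" and B: "B \<in> P"
    note D = triD[OF t]
    have "V.hom_zero Y Z" if Y: "Y \<in> N" for Y
      unfolding V.hom_zero_def
    proof (intro allI impI)
      fix \<alpha> assume a: "V.arr \<alpha>" "V.dm \<alpha> = Y" "V.cd \<alpha> = Z"
      \<comment> \<open>A map to \<open>Z\<close> dies in \<open>So A\<close>, hence lifts to
        \<open>B\<close>, where it vanishes.\<close>
      have "So A \<in> P" using Psh D A by simp
      then have "V.hom_zero Y (So A)" using Y unfolding P_def by blast
      then have "q h \<bullet> \<alpha> = V.nul (V.dm \<alpha>) (So A)"
        using V.hom_zeroD[of Y "So A" "q h \<bullet> \<alpha>"] a D by simp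
      then obtain y where y: "V.arr y" "V.dm y = V.dm \<alpha>" "V.cd y = B" "q g \<bullet> y = \<alpha>"
        using V_exact2[OF t a(1,3)] by blast
      have "V.hom_zero Y B" using B Y unfolding P_def by blast
      then have "y = V.nul Y B" using V.hom_zeroD[of Y B y] y(1-3) a by simp
      moreover have "ob Y" using Y unfolding N_def by blast
      ultimately show "\<alpha> = V.nul Y Z" using y(4) D by simp
    qed
    then show "Z \<in> P" using D unfolding P_def by blast
  qed
  moreover have "A \<in> P \<and> B \<in> P" if b: "is_biprod K A B Z i j p r" and Z: "Z \<in> P" for A B Z i j p r
  proof -
    have *: "A \<in> P" if b: "is_biprod V A B Z i j p r" and o: "ob A" for A B i j p r
    proof -
      note D = V.biprodD[OF b]
      have "V.hom_zero Y A" if Y: "Y \<in> N" for Y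
        unfolding V.hom_zero_def
      proof (intro allI impI)
        fix \<alpha> assume a: "V.arr \<alpha>" "V.dm \<alpha> = Y" "V.cd \<alpha> = A"
        have "V.hom_zero Y Z" using Z Y unfolding P_def by blast
        then have z: "i \<bullet> \<alpha> = V.nul Y Z" using V.hom_zeroD[of Y Z "i \<bullet> \<alpha>"] a D by simp
        have "\<alpha> = p \<bullet> (i \<bullet> \<alpha>)" using a D by simp
        then show "\<alpha> = V.nul Y A" unfolding z using D Y unfolding N_def by simp
      qed
      then show ?thesis using o unfolding P_def by blast
    qed
    note D = biprodD[OF b]
    show ?thesis using *[OF V_biprod[OF b] D(1)] *[OF V.biprod_swap[OF V_biprod[OF b]] D(2)] by blast
  qed
  ultimately have "thick K P" unfolding thick_def by blast
  moreover have "X \<in> P" using U0 unfolding P_def N_def by blast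
  ultimately have "P = t_ob K" using gen unfolding generator_def by blast
  \<comment> \<open>\<open>Y\<close> belongs to \<open>N\<close>, and to \<open>P\<close> since
    \<open>P\<close> is everything; so its identity vanishes in the quotient.\<close>
  then have "V.hom_zero Y Y" using \<open>Y \<in> N\<close> Y unfolding P_def by blast
  then have "V.one Y = V.nul Y Y" using V.hom_zeroD[of Y Y "V.one Y"] Y by simp
  then show False using V_zero_iff[OF Y(1)] Y by (simp add: V.zero_obj_iff)
qed

end

section \<open>Rank functions and their kernels\<close>

locale rank_function = triangulated_category +
  fixes \<rho> assumes rank: "rank_fun K \<rho>"
begin

abbreviation rk where "rk X \<equiv> \<rho> (one X)"

lemma rank_ge0: "arr f \<Longrightarrow> \<rho> f \<ge> 0" and rank_Sh: "arr f \<Longrightarrow> \<rho> (Sh f) = \<rho> f"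
  using rank by (simp_all add: rank_fun_def)

lemma rk_So: "ob X \<Longrightarrow> rk (So X) = rk X"
  using rank_Sh[of "one X"] by simp

lemma rank_tri1: assumes "tri A B Z f g h" shows "\<rho> f + \<rho> g = rk B"
proof -
  have "(f, g, h) \<in> t_tri K" "cd f = B" using assms by (simp_all add: tri_def)
  then show ?thesis using rank unfolding rank_fun_def by blast
qed

text \<open>Both \<open>g\<close> and \<open>mns g\<close> follow the same map \<open>u\<close> in a
  triangle, so the rank identity assigns them the same value. This absorbs the signs of
  rotation.\<close>

lemma rank_mns: assumes "arr g" shows "\<rho> (mns g) = \<rho> g"
proof -
  obtain F u w where t: "tri F (dm g) (cd g) u g w" using fiber_exists[OF assms refl refl] .
  show ?thesis using rank_tri1[OF t] rank_tri1[OF tri_neg[OF t]] by simp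
qed

lemma rank_tri2: assumes "tri A B Z f g h" shows "\<rho> g + \<rho> h = rk Z"
  using rank_tri1[OF tri_rot[OF assms]] .

lemma rank_tri3: assumes t: "tri A B Z f g h" shows "\<rho> h + \<rho> f = rk A"
proof -
  note D = triD[OF t]
  show ?thesis using rank_tri1[OF tri_rot[OF tri_rot[OF t]]] rank_mns[of "Sh f"] rank_Sh[of f] rk_So[of A] D by simp
qed

text \<open>The rank identities at \<open>A\<close> and at \<open>B\<close>, minus the one at
  \<open>Z\<close>.\<close>

lemma rank_tri: assumes "tri A B Z f g h" shows "2 * \<rho> f = rk A + rk B - rk Z"
  using rank_tri1[OF assms] rank_tri2[OF assms] rank_tri3[OF assms] by simp

lemma rk_biprod: assumes b: "is_biprod K A B X i j p q" shows "rk X = rk A + rk B"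
proof -
  note D = biprodD[OF b]
  have "\<rho> (t_add K (t_comp K i (t_comp K (one A) p)) (t_comp K j (t_comp K (one B) q))) = rk A + rk B"
    using rank b D unfolding rank_fun_def hom_iff by (metis arr_one cd_one dm_one)
  moreover have "t_add K (t_comp K i (t_comp K (one A) p)) (t_comp K j (t_comp K (one B) q)) = one X"
    using D biprod_sum[OF b] by simp
  ultimately show ?thesis by simp
qed

lemma rk_zero: assumes "zero_obj K Z" shows "rk Z = 0"
  using rk_biprod[OF biprod_zero[OF assms zero_obj_ob[OF assms]]] by simp

text \<open>Nonnegativity forces both maps adjacent to \<open>Z\<close> to have rank zero, so
  \<open>f\<close> carries the whole rank of either end.\<close>

lemma rk_cone_zero: assumes t: "tri A B Z f g h" and z: "rk Z = 0" shows "rk A = rk B"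
proof -
  note D = triD[OF t]
  have "\<rho> g = 0" "\<rho> h = 0" using rank_tri2[OF t] z rank_ge0[of g] rank_ge0[of h] D by simp_all
  then show ?thesis using rank_tri1[OF t] rank_tri3[OF t] by simp
qed

lemma rk_isomorphic: assumes "isomorphic K X Y" shows "rk X = rk Y"
proof -
  obtain f where f: "iso_mor K f" "arr f" "dm f = X" "cd f = Y" using assms by (rule isomorphicE)
  obtain N0 where z: "zero_obj K N0" by (rule zero_obj_exists)
  have t: "tri X Y N0 f (nul Y N0) (nul N0 (So X))"
    by (rule tri_iso_closed[OF tri_id[OF ob_dm[OF f(2)] z], of "one X" _ f _ "one N0"])
      (use f zero_obj_ob[OF z] ob_dm[OF f(2)] ob_cd[OF f(2)] in simp_all)
  show ?thesis by (rule rk_cone_zero[OF t rk_zero[OF z]])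
qed

lemma rk_ge0: "ob X \<Longrightarrow> rk X \<ge> 0" using rank_ge0[of "one X"] by simp

lemma thick_kernel: "thick K {X \<in> t_ob K. rk X = 0}" (is "thick K ?T")
proof -
  have "tri_subcat K ?T"
  proof (rule tri_subcatI)
    obtain N0 where z: "zero_obj K N0" by (rule zero_obj_exists)
    show "?T \<noteq> {}" using rk_zero[OF z] zero_obj_ob[OF z] by blast
    show "Y \<in> ?T" if "X \<in> ?T" "isomorphic K X Y" for X Y
      using that rk_isomorphic[OF that(2)] ob_cd by (auto elim!: isomorphicE)
    show "So X \<in> ?T \<longleftrightarrow> X \<in> ?T" if "ob X" for X using that rk_So by simp
    fix A B Z f g h assume t: "tri A B Z f g h" and "A \<in> ?T" "B \<in> ?T"
    then have z: "rk A = 0" "rk B = 0" by simp_all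
    note D = triD[OF t]
    have "\<rho> g = 0" "\<rho> h = 0" using rank_tri1[OF t] rank_tri3[OF t] z rank_ge0[of f] rank_ge0[of g] rank_ge0[of h] D by simp_all
    then show "Z \<in> ?T" using rank_tri2[OF t] D by simp
  qed auto
  moreover have "A \<in> ?T \<and> B \<in> ?T" if "is_biprod K A B X i j p q" "X \<in> ?T" for A B X i j p q
    using rk_biprod[OF that(1)] that(2) rk_ge0[of A] rk_ge0[of B] biprodD(1,2)[OF that(1)] by simp
  ultimately show ?thesis unfolding thick_def by blast
qed

end

text \<open>The kernel is a parameter \<open>S\<close> with a membership condition, so that two rank
  functions with equal kernels live over the same quotient in \<open>rk_unique\<close>.\<close>

locale localizing_rank_function = thick_subcategory + rank_function +
  assumes integral: "arr f \<Longrightarrow> \<rho> f \<in> \<int>"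
    and kernel: "ob X \<Longrightarrow> X \<in> S \<longleftrightarrow> rk X = 0"
    and factors_if_rank0: "arr f \<Longrightarrow> \<rho> f = 0 \<Longrightarrow> factors f"
begin

lemma W_rk: assumes "W s" shows "rk (dm s) = rk (cd s)"
proof -
  obtain Z g h where t: "tri (dm s) (cd s) Z s g h" "Z \<in> S" using W_tri[OF assms] .
  show ?thesis using rk_cone_zero[OF t(1)] kernel[OF sub_ob[OF t(2)]] t(2) by simp
qed

lemma V_isomorphic_rk: "isomorphic V X Y \<Longrightarrow> rk X = rk Y"
  using V_isomorphic_roof W_rk by metis

text \<open>The rank of \<open>f\<close> is at most that of either end; integrality and the
  localizing property leave only the value one.\<close>

lemma unit_rank:
  assumes "arr f" "\<not> factors f" "rk (dm f) = 1 \<or> rk (cd f) = 1" shows "\<rho> f = 1"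
proof -
  obtain Z g h where t: "tri (dm f) (cd f) Z f g h" using tri_exists[OF assms(1)] .
  note D = triD[OF t]
  have "\<rho> f \<le> 1" using rank_tri1[OF t] rank_tri3[OF t] rank_ge0[of g] rank_ge0[of h] D assms(3) by auto
  moreover have "\<rho> f \<noteq> 0" using factors_if_rank0 assms by blast
  moreover have "\<rho> f \<ge> 0" using rank_ge0 assms by blast
  moreover obtain n where "\<rho> f = of_int n" using integral[OF assms(1)] by (rule Ints_cases)
  ultimately show ?thesis by simp
qed

text \<open>The numerator has the full rank of its source, so the connecting map \<open>h\<close>
  has rank zero and dies in the quotient. In the rotated triangle \<open>next_split_mono\<close>
  then yields a retraction of the shifted numerator.\<close>

lemma V_split_mono:
  assumes a: "V.arr \<alpha>" "rk (V.dm \<alpha>) = 1" "\<alpha> \<noteq> V.nul (V.dm \<alpha>) (V.cd \<alpha>)"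
  obtains \<kappa> where "V.arr \<kappa>" "V.dm \<kappa> = V.cd \<alpha>" "V.cd \<kappa> = V.dm \<alpha>" "\<kappa> \<bullet> \<alpha> = V.one (V.dm \<alpha>)"
proof -
  obtain s f where r: "W s" "arr s" "cd s = V.dm \<alpha>" "arr f" "dm f = dm s" "cd f = V.cd \<alpha>" "\<alpha> \<bullet> q s = q f"
    using V_roof[OF a(1)] .
  have nf: "\<not> factors f" using roof_zero[OF a(1) r(1,3-7)] a(3) by blast
  have "rk (dm f) = 1" using W_rk[OF r(1)] r a(2) by simp
  then have f1: "\<rho> f = 1" using unit_rank[OF r(4) nf] by simp
  obtain Z g h where t: "tri (dm f) (cd f) Z f g h" using tri_exists[OF r(4)] .
  note D = triD[OF t]
  have "\<rho> h = 0" using rank_tri3[OF t] f1 \<open>rk (dm f) = 1\<close> by simp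
  then have fh: "factors h" using factors_if_rank0 D by simp
  obtain k where k: "V.arr k" "V.dm k = So (cd f)" "V.cd k = So (dm f)" "k \<bullet> q (mns (Sh f)) = V.one (So (dm f))"
    by (rule next_split_mono[OF tri_rot[OF tri_rot[OF t]] fh])
  \<comment> \<open>The sign of the rotated \<open>mns (Sh f)\<close> is moved to \<open>k\<close>
    before desuspending.\<close>
  obtain k' where k': "V.arr k'" "V.dm k' = cd f" "V.cd k' = dm f" "V.mns k = V.Sh k'"
    using V.Sh_full[of "V.mns k" "cd f" "dm f"] k D by auto
  have "V.Sh (k' \<bullet> q f) = V.mns k \<bullet> V.Sh (q f)" unfolding k'(4) using k'(1-3) r(4) by simp
  also have "\<dots> = k \<bullet> q (mns (Sh f))" using k(1-3) D by (simp add: q_minus q_shift)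
  finally have "V.Sh (k' \<bullet> q f) = V.Sh (V.one (dm f))" using k(4) D by simp
  then have kf: "k' \<bullet> q f = V.one (dm f)" by (rule V.Sh_inject) (use k' D in simp_all)
  have "(q s \<bullet> k') \<bullet> \<alpha> = V.one (V.dm \<alpha>)"
    by (rule roof_left_inverse[OF a(1) r(1,3-7) k'(1)]) (use k' kf r in simp_all)
  then show ?thesis using that[of "q s \<bullet> k'"] k' r by simp
qed

text \<open>Here the numerator has the full rank of its target, so the next map \<open>g\<close>
  dies and the identity of the target lifts.\<close>

lemma V_split_epi:
  assumes a: "V.arr \<alpha>" "rk (V.cd \<alpha>) = 1" "\<alpha> \<noteq> V.nul (V.dm \<alpha>) (V.cd \<alpha>)"
  obtains y where "V.arr y" "V.dm y = V.cd \<alpha>" "V.cd y = V.dm \<alpha>" "\<alpha> \<bullet> y = V.one (V.cd \<alpha>)"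
proof -
  obtain s f where r: "W s" "arr s" "cd s = V.dm \<alpha>" "arr f" "dm f = dm s" "cd f = V.cd \<alpha>" "\<alpha> \<bullet> q s = q f"
    using V_roof[OF a(1)] .
  have nf: "\<not> factors f" using roof_zero[OF a(1) r(1,3-7)] a(3) by blast
  have f1: "\<rho> f = 1" using unit_rank[OF r(4) nf] r a(2) by simp
  obtain Z g h where t: "tri (dm f) (cd f) Z f g h" using tri_exists[OF r(4)] .
  note D = triD[OF t]
  have "\<rho> g = 0" using rank_tri1[OF t] f1 r(6) a(2) by simp
  then have "factors g" using factors_if_rank0 D by simp
  then have "q g = V.nul (cd f) Z" using q_zero_iff[of g] D by simp
  then obtain y where y: "V.arr y" "V.dm y = cd f" "V.cd y = dm f" "q f \<bullet> y = V.one (cd f)"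
    using V_exact[OF t, of "V.one (cd f)"] D by auto
  have "\<alpha> \<bullet> (q s \<bullet> y) = (\<alpha> \<bullet> q s) \<bullet> y" using a(1) r(1-6) y(1-3) by simp
  also have "\<dots> = V.one (V.cd \<alpha>)" unfolding r(7) using y r(6) by simp
  finally show ?thesis using that[of "q s \<bullet> y"] y r by simp
qed

text \<open>The kernel of \<beta> is realized in the original category, as the fiber
  \<open>F\<close> of a numerator \<open>a\<close>. As \<open>a\<close> has rank one, the connecting
  map \<open>d\<close> has rank zero and the rank of \<open>F\<close> is one less than that of
  \<open>B\<close>.\<close>

lemma V_complement:
  assumes b: "V.arr \<beta>" "V.dm \<beta> = B" "V.cd \<beta> = U" and y: "V.arr y" "V.dm y = U" "V.cd y = B" "\<beta> \<bullet> y = V.one U"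
    and U: "rk U = 1"
  obtains B1 x k where "is_biprod V U B1 B y k \<beta> x" "rk B1 = rk B - 1"
proof -
  have oU: "ob U" using V.ob_cd[OF b(1)] b(3) by simp
  have oB: "ob B" using V.ob_dm[OF b(1)] b(2) by simp
  obtain s a where r: "W s" "arr s" "cd s = V.dm \<beta>" "arr a" "dm a = dm s" "cd a = V.cd \<beta>" "\<beta> \<bullet> q s = q a"
    using V_roof[OF b(1)] .
  have "\<beta> \<noteq> V.nul (V.dm \<beta>) (V.cd \<beta>)"
  proof
    assume "\<beta> = V.nul (V.dm \<beta>) (V.cd \<beta>)"
    then have "V.one U = V.nul U U" using y b oU oB by simp
    then show False using V_zero_iff[OF oU] kernel[OF oU] U oU by (simp add: V.zero_obj_iff)
  qed
  then have "\<not> factors a" using roof_zero[OF b(1) r(1,3-7)] by blast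
  then have a1: "\<rho> a = 1" using unit_rank[OF r(4)] r(6) b(3) U by simp
  obtain F k0 d where t: "tri F (dm a) (cd a) k0 a d" using fiber_exists[OF r(4) refl refl] .
  note D = triD[OF t]
  have "\<rho> d = 0" using rank_tri2[OF t] a1 r(6) b(3) U by simp
  then have qd: "q d = V.nul (cd a) (So F)" using factors_if_rank0 q_zero_iff[of d] D by simp
  have rkF: "rk F = rk B - 1"
    using rank_tri3[OF t] rank_tri1[OF t] \<open>\<rho> d = 0\<close> a1 W_rk[OF r(1)] r(3,5) b(2) by simp
  obtain v where v: "V.arr v" "V.dm v = cd s" "V.cd v = dm s" "v \<bullet> q s = V.one (dm s)" "q s \<bullet> v = V.one (cd s)"
    using q_inv[OF r(1)] .
  have cs: "cd s = B" "cd a = U" using r b by simp_all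
  \<comment> \<open>The projection onto the complement; \<beta> kills it, so it factors through the
    fiber.\<close>
  define e where "e = V.pls (V.one B) (V.mns (y \<bullet> \<beta>))"
  have e: "V.arr e" "V.dm e = B" "V.cd e = B" using y b oB by (simp_all add: e_def)
  have be: "\<beta> \<bullet> e = V.nul B U" using y b oB V.reassoc[OF y(4), of \<beta>] by (simp add: e_def)
  have "q a \<bullet> (v \<bullet> e) = (\<beta> \<bullet> q s) \<bullet> v \<bullet> e" unfolding r(7) using r(1-6) v(1-3) e cs by simp
  also have "\<dots> = \<beta> \<bullet> (q s \<bullet> v) \<bullet> e" using r(1-6) v(1-3) e cs b by simp
  also have "\<dots> = V.nul B U" unfolding v(5) cs using e be by simp
  finally have "q a \<bullet> (v \<bullet> e) = V.nul (V.dm (v \<bullet> e)) (cd a)" using v(1-3) e cs by simp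
  then obtain x where x: "V.arr x" "V.dm x = B" "V.cd x = F" "q k0 \<bullet> x = v \<bullet> e"
    using V_exact[OF t, of "v \<bullet> e"] v(1-3) e cs r(5) by auto
  define k where "k = q s \<bullet> q k0"
  have k: "V.arr k" "V.dm k = F" "V.cd k = B" using r(2,5) cs D by (simp_all add: k_def)
  have "k \<bullet> x = q s \<bullet> (q k0 \<bullet> x)" unfolding k_def using r(2,5) cs D x(1-3) by simp
  also have "\<dots> = (q s \<bullet> v) \<bullet> e" unfolding x(4) using r(2,5) cs v(1-3) e by simp
  finally have kx: "k \<bullet> x = e" unfolding v(5) using cs e by simp
  have bk: "\<beta> \<bullet> k = V.nul F U"
  proof -
    have "\<beta> \<bullet> k = q a \<bullet> q k0" unfolding k_def r(7)[symmetric] using b r(1-6) D by simp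
    also have "\<dots> = q (a \<cdot> k0)" using D r by (simp add: q_comp)
    finally show ?thesis using tri_comp_zero[OF t] cs by (simp add: q_nul)
  qed
  \<comment> \<open>The shift of a killed map lifts along the connecting map, and
    \<open>q d = 0\<close>.\<close>
  have mono: "w = V.nul (V.dm w) F" if w: "V.arr w" "V.cd w = F" "k \<bullet> w = V.nul (V.dm w) B" for w
  proof -
    have "q k0 \<bullet> w = v \<bullet> (k \<bullet> w)" unfolding k_def using V.reassoc[OF v(4), of "q k0 \<bullet> w"] w(1,2) v(1-3) r(2,5) D cs by simp
    also have "\<dots> = V.nul (V.dm w) (dm a)" unfolding w(3) using w(1,2) v(1-3) cs r(5) V.ob_dm[OF w(1)] by simp
    finally have kw: "q k0 \<bullet> w = V.nul (V.dm w) (dm a)" .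
    have "V.Sh (q k0) \<bullet> V.Sh w = V.Sh (q k0 \<bullet> w)" using w D by simp
    also have "\<dots> = V.nul (V.dm (V.Sh w)) (So (dm a))" unfolding kw using w D V.ob_dm[OF w(1)] by simp
    finally obtain z where z: "V.arr z" "V.dm z = V.dm (V.Sh w)" "V.cd z = cd a" "q d \<bullet> z = V.Sh w"
      using V_exact3[OF t, of "V.Sh w"] w by auto
    have "V.Sh w = V.nul (t_shO V (V.dm w)) (t_shO V F)" using z w D V.ob_dm[OF w(1)] unfolding qd by simp
    then show ?thesis by (rule V.Sh_eq_nul) (use w in simp_all)
  qed
  have 1: "x \<bullet> k = V.one F"
  proof (rule V.eq_if_diff_nul)
    have "k \<bullet> V.pls (x \<bullet> k) (V.mns (V.one F)) = V.pls (e \<bullet> k) (V.mns k)"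
      using k x(1-3) D V.reassoc[OF kx, of k] by simp
    also have "\<dots> = V.nul F B" unfolding e_def using k y(1-3) b oB bk oU D(10) by (simp add: V.pls_ac)
    finally show "V.pls (x \<bullet> k) (V.mns (V.one F)) = V.nul F F"
      using mono[of "V.pls (x \<bullet> k) (V.mns (V.one F))"] k x(1-3) D by simp
  qed (use x k D in simp_all)
  have 2: "x \<bullet> y = V.nul U F"
  proof -
    have "k \<bullet> (x \<bullet> y) = e \<bullet> y" using k x(1-3) y(1-3) V.reassoc[OF kx, of y] by simp
    also have "\<dots> = V.nul U B" unfolding e_def using y b oB by simp
    finally show ?thesis using mono[of "x \<bullet> y"] x(1-3) y(1-3) by simp
  qed
  have 3: "V.pls (y \<bullet> \<beta>) (k \<bullet> x) = V.one B" unfolding kx e_def using y(1-3) b oB by (simp add: V.pls_left_comm[of "y \<bullet> \<beta>" "V.one B"])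
  have "is_biprod V U F B y k \<beta> x" unfolding V.biprod_iff using k x(1-3) y b D oU oB 1 2 3 bk by simp
  then show ?thesis using that rkF by blast
qed

lemma rk_nat: assumes "ob X" obtains n :: nat where "rk X = real n"
  using integral[of "one X"] rk_ge0[OF assms] assms that
  by (metis Ints_cases arr_one of_int_0_le_iff of_nat_nat of_int_of_nat_eq)

end

section \<open>Prime localizing ranks: simplicity of the quotient and uniqueness\<close>

locale localizing_prime = localizing_rank_function +
  fixes X assumes gen: "generator K X" and rkX: "rk X = 1"
begin

lemma obX: "ob X" using gen by (simp add: generator_def)

text \<open>Rank one is invariant under shifts and under isomorphism in the quotient, so the objects
  of rank one can play the part of \<open>U0\<close>.\<close>

lemma detect:
  assumes "ob Y" "Y \<notin> S" obtains U \<alpha> where "ob U" "rk U = 1" "V.arr \<alpha>" "V.dm \<alpha> = Y" "V.cd \<alpha> = U" "\<alpha> \<noteq> V.nul Y U"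
proof -
  define U0 where "U0 = {U. ob U \<and> rk U = 1}"
  have o: "isomorphic V U U' \<Longrightarrow> ob U'" for U U' using V.ob_cd by (metis V_ob V.isomorphicE)
  have 1: "U0 \<subseteq> t_ob K" "X \<in> U0" using obX rkX by (auto simp: U0_def)
  have 2: "U' \<in> U0" if "U \<in> U0" "isomorphic V U U'" for U U'
    using that o[OF that(2)] V_isomorphic_rk[OF that(2)] by (simp add: U0_def)
  have 3: "So U \<in> U0 \<longleftrightarrow> U \<in> U0" if "ob U" for U using that rk_So by (simp add: U0_def)
  obtain U \<alpha> where "U \<in> U0" "V.arr \<alpha>" "V.dm \<alpha> = Y" "V.cd \<alpha> = U" "\<alpha> \<noteq> V.nul Y U"
    by (rule generator_detects[OF gen 1 2 3 assms])
  then show ?thesis using that unfolding U0_def by blast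
qed

text \<open>Induction on the rank of the source, which has a split epimorphism onto some
  \<open>U\<close> of rank one with section \<open>y\<close>. Either \<alpha> kills
  \<open>y\<close>, and \<open>U\<close> is split off the source alone; or its composite with
  \<open>y\<close> is a split monomorphism, and \<open>U\<close> is split off both ends.\<close>

lemma V_splits: "V.arr \<alpha> \<Longrightarrow> rk (V.dm \<alpha>) = real n \<Longrightarrow> V.splits \<alpha>"
proof (induction n arbitrary: \<alpha>)
  case 0
  have o: "ob (V.dm \<alpha>)" "ob (V.cd \<alpha>)" using V.ob_dm[OF 0(1)] V.ob_cd[OF 0(1)] by simp_all
  have "zero_obj V (V.dm \<alpha>)" using V_zero_iff[OF o(1)] kernel[OF o(1)] 0 by simp
  then have "\<alpha> = V.nul (V.dm \<alpha>) (V.cd \<alpha>)" using V.from_zero 0(1) by blast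
  then show ?case using V.splits_nul[of "V.dm \<alpha>" "V.cd \<alpha>"] o by (metis V_ob)
next
  case (Suc n)
  define A where "A = V.dm \<alpha>"
  define B where "B = V.cd \<alpha>"
  have a: "V.arr \<alpha>" "V.dm \<alpha> = A" "V.cd \<alpha> = B" using Suc.prems by (simp_all add: A_def B_def)
  have o: "ob A" "ob B" using V.ob_dm[OF a(1)] V.ob_cd[OF a(1)] a by simp_all
  have rA: "rk A = real (Suc n)" using Suc.prems a by simp
  then have "A \<notin> S" using kernel[OF o(1)] by simp
  then obtain U \<gamma> where U: "ob U" "rk U = 1" and g: "V.arr \<gamma>" "V.dm \<gamma> = A" "V.cd \<gamma> = U" "\<gamma> \<noteq> V.nul A U"
    using detect[OF o(1)] by blast
  obtain y where y: "V.arr y" "V.dm y = U" "V.cd y = A" "\<gamma> \<bullet> y = V.one U"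
    using V_split_epi[OF g(1)] g U by metis
  show ?case
  proof (cases "\<alpha> \<bullet> y = V.nul U B")
    case True
    obtain A1 x k where b: "is_biprod V U A1 A y k \<gamma> x" "rk A1 = rk A - 1"
      by (rule V_complement[OF g(1-3) y U(2)])
    note D = V.biprodD[OF b(1)]
    have "V.splits (\<alpha> \<bullet> k)" using Suc.IH[of "\<alpha> \<bullet> k"] D a b(2) rA by simp
    then show ?thesis using V.splits_kernel_summand[OF b(1) a(1,2)] True a by simp
  next
    case False
    have ay: "V.arr (\<alpha> \<bullet> y)" "V.dm (\<alpha> \<bullet> y) = U" "V.cd (\<alpha> \<bullet> y) = B" using a y by simp_all
    obtain \<beta> where be: "V.arr \<beta>" "V.dm \<beta> = B" "V.cd \<beta> = U" "\<beta> \<bullet> (\<alpha> \<bullet> y) = V.one U"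
      using V_split_mono[OF ay(1)] ay U False by metis
    have ba: "V.arr (\<beta> \<bullet> \<alpha>)" "V.dm (\<beta> \<bullet> \<alpha>) = A" "V.cd (\<beta> \<bullet> \<alpha>) = U" "(\<beta> \<bullet> \<alpha>) \<bullet> y = V.one U"
      using be a y(1-3) by simp_all
    obtain A1 x k where b1: "is_biprod V U A1 A y k (\<beta> \<bullet> \<alpha>) x" "rk A1 = rk A - 1"
      by (rule V_complement[OF ba(1-3) y(1-3) ba(4) U(2)])
    obtain B1 z b where b2: "is_biprod V U B1 B (\<alpha> \<bullet> y) b \<beta> z" "rk B1 = rk B - 1"
      by (rule V_complement[OF be(1-3) ay be(4) U(2)])
    note D = V.biprodD[OF b1(1)] V.biprodD[OF b2(1)]
    have "V.splits (z \<bullet> \<alpha> \<bullet> k)" using Suc.IH[of "z \<bullet> \<alpha> \<bullet> k"] D a b1(2) rA by simp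
    then show ?thesis using V.splits_iso_summand[OF b1(1) b2(1) a] by simp
  qed
qed

lemma V_all_split: assumes "T \<in> t_tri V" shows "split_tri V T"
proof -
  obtain f g h where k: "(f, g, h) \<in> t_tri K" and i: "tri_iso V (q f, q g, q h) T"
    using assms V_tri by blast
  note t = triI[OF k]
  note D = triD[OF t]
  obtain n where n: "rk (dm f) = real n" using rk_nat[of "dm f"] D by blast
  have "split_tri V (q f, q g, q h)"
  proof (rule V.split_tri_if_splits[of "q f" "dm f" "cd f" "q g" "cd g" "q h"])
    show "q g \<bullet> q f = V.nul (dm f) (cd g)" "q h \<bullet> q g = V.nul (cd f) (t_shO V (dm f))"
      "V.Sh (q f) \<bullet> q h = V.nul (cd g) (t_shO V (cd f))"
      using tri_comp_zero[OF t] tri_comp_zero2[OF t] tri_comp_zero3[OF t] D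
      by (simp_all add: q_nul flip: q_comp q_shift)
    show "V.splits (q f)" using V_splits[of "q f"] n D by simp
    show "\<exists>y. V.arr y \<and> V.dm y = V.dm x \<and> V.cd y = dm f \<and> q f \<bullet> y = x"
      if "V.arr x" "V.cd x = cd f" "q g \<bullet> x = V.nul (V.dm x) (cd g)" for x
      using V_exact[OF t that] by metis
    show "\<exists>y. V.arr y \<and> V.dm y = V.dm x \<and> V.cd y = cd f \<and> q g \<bullet> y = x"
      if "V.arr x" "V.cd x = cd g" "q h \<bullet> x = V.nul (V.dm x) (t_shO V (dm f))" for x
      using V_exact2[OF t that(1,2)] that(3) by (metis V_So)
    show "\<exists>y. V.arr y \<and> V.dm y = V.dm x \<and> V.cd y = cd g \<and> q h \<bullet> y = x"
      if "V.arr x" "V.cd x = t_shO V (dm f)" "V.Sh (q f) \<bullet> x = V.nul (V.dm x) (t_shO V (cd f))" for x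
      using V_exact3[OF t that(1)] that(2,3) by (metis V_So)
  qed (use D in simp_all)
  then show ?thesis by (rule V.split_tri_iso[OF _ i])
qed

text \<open>A nonzero projection \<open>p\<close> out of \<open>X\<close> is a split monomorphism,
  so \<open>p j = 0\<close> forces the other inclusion \<open>j\<close> to vanish.\<close>

lemma V_indecomposable: "indecomposable V X"
proof -
  have "zero_obj V A \<or> zero_obj V B" if b: "is_biprod V A B X i j p r" for A B i j p r
  proof (rule ccontr)
    assume n: "\<not> ?thesis"
    note D = V.biprodD[OF b]
    have "p \<noteq> V.nul X A"
    proof
      assume "p = V.nul X A"
      then have "V.one A = V.nul A A" using D by simp
      then show False using n D by (simp add: V.zero_obj_iff)
    qed
    then obtain k where k: "V.arr k" "V.dm k = A" "V.cd k = X" "k \<bullet> p = V.one X"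
      using V_split_mono[of p] D rkX by metis
    have "j = (k \<bullet> p) \<bullet> j" unfolding k(4) using D by simp
    also have "\<dots> = k \<bullet> (p \<bullet> j)" using k(1-3) D by simp
    finally have "j = V.nul B X" using k(1-3) D by simp
    then have "V.one B = V.nul B B" using D by (metis V.cmp_nul)
    then show False using n D by (simp add: V.zero_obj_iff)
  qed
  moreover have "\<not> zero_obj V X" using V_zero_iff[OF obX] kernel[OF obX] rkX by simp
  ultimately show ?thesis unfolding indecomposable_def using obX by auto
qed

text \<open>The counterpart of \<open>V_complement\<close> that keeps a triangle of the original
  category, on which a subcategory or a second rank function can be evaluated.\<close>

lemma peel:
  assumes Y: "ob Y" and a: "V.arr \<alpha>" "V.dm \<alpha> = Y" "V.cd \<alpha> = U" "\<alpha> \<noteq> V.nul Y U" and U: "rk U = 1"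
  obtains s a F k d where "W s" "cd s = Y" "tri F (dm s) U k a d" "\<not> factors a" "rk F = rk Y - 1"
proof -
  obtain s f where r: "W s" "arr s" "cd s = V.dm \<alpha>" "arr f" "dm f = dm s" "cd f = V.cd \<alpha>" "\<alpha> \<bullet> q s = q f"
    using V_roof[OF a(1)] .
  have nf: "\<not> factors f" using roof_zero[OF a(1) r(1,3-7)] a by blast
  have f1: "\<rho> f = 1" using unit_rank[OF r(4) nf] r a U by simp
  obtain F k d where t: "tri F (dm s) U k f d" using fiber_exists[OF r(4,5)] r(6) a(3) by metis
  have "rk F = rk Y - 1" using rank_tri1[OF t] rank_tri2[OF t] rank_tri3[OF t] f1 U W_rk[OF r(1)] r(3) a(2) by simp
  then show ?thesis using that r t nf a by metis
qed

text \<open>Induction on the rank, peeling off only rank-one objects of \<open>T\<close>. They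
  suffice for detection: \<open>X\<close> is among them, and they are closed under shifts and
  isomorphism in the quotient.\<close>

lemma V_generated: assumes T: "tri_subcat V T" "X \<in> T" shows "T = t_ob V"
proof -
  have TK: "tri_subcat K T" "S \<subseteq> T" using T V_subcat_iff by blast+
  interpret T: triangulated_subcategory K T using TK(1) by unfold_locales
  have Tiso: "Y \<in> T" if "Z \<in> T" "isomorphic V Z Y" for Z Y using T(1) that unfolding tri_subcat_def by blast
  have "Y \<in> T" if "ob Y" "rk Y = real n" for Y n
    using that
  proof (induction n arbitrary: Y)
    case 0 then show ?case using kernel TK by auto
  next
    case (Suc n)
    have "Y \<notin> S" using Suc.prems kernel by simp
    have sb: "{U. U \<in> T \<and> rk U = 1} \<subseteq> t_ob K" using T.sub_ob by blast
    have cl: "U' \<in> {U. U \<in> T \<and> rk U = 1}" if "U \<in> {U. U \<in> T \<and> rk U = 1}" "isomorphic V U U'" for U U'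
      using that Tiso V_isomorphic_rk by auto
    have sh: "So U \<in> {U. U \<in> T \<and> rk U = 1} \<longleftrightarrow> U \<in> {U. U \<in> T \<and> rk U = 1}" if "ob U" for U
      using that T.sub_So rk_So by auto
    obtain U \<alpha> where U: "U \<in> {U. U \<in> T \<and> rk U = 1}" and a: "V.arr \<alpha>" "V.dm \<alpha> = Y" "V.cd \<alpha> = U" "\<alpha> \<noteq> V.nul Y U"
      by (rule generator_detects[OF gen sb _ cl sh Suc.prems(1) \<open>Y \<notin> S\<close>]) (use T(2) rkX in blast)+
    have "rk U = 1" using U by simp
    then obtain s b F k d where p: "W s" "cd s = Y" "tri F (dm s) U k b d" "rk F = rk Y - 1"
      using peel[OF Suc.prems(1) a] by metis
    have "F \<in> T" using Suc.IH[of F] triD[OF p(3)] p(4) Suc.prems by simp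
    then have "dm s \<in> T" using T.sub_tri(2)[OF p(3)] U by blast
    then show ?case using Tiso W_isomorphic[OF p(1)] p(2) by blast
  qed
  then have "t_ob K \<subseteq> T" using rk_nat by blast
  then show ?thesis using T.sub_ob by auto
qed

theorem V_simple: "simple_tricat V"
  unfolding simple_tricat_def using V_all_split V_indecomposable V_generated by blast

text \<open>Detection uses objects on which \<rho> is one and \<rho>' takes its value at
  \<open>X\<close>, so peeling changes both ranks by the same amount once that value is known to be
  one. This has to be shown, since \<rho>' is normalised at a possibly different generator
  \<open>X'\<close>.\<close>

lemma rk_unique:
  assumes "localizing_prime K S \<rho>' X'" and "ob Y"
  shows "\<rho>' (one Y) = rk Y"
proof -
  interpret R: localizing_prime K S \<rho>' X' by fact
  have detect2: "\<exists>U \<alpha>. ob U \<and> rk U = 1 \<and> \<rho>' (one U) = \<rho>' (one X) \<and> V.arr \<alpha> \<and> V.dm \<alpha> = Y \<and> V.cd \<alpha> = U \<and> \<alpha> \<noteq> V.nul Y U"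
    if Y: "ob Y" "Y \<notin> S" for Y
  proof -
    define U0 where "U0 = {U. ob U \<and> rk U = 1 \<and> \<rho>' (one U) = \<rho>' (one X)}"
    have o: "isomorphic V U U' \<Longrightarrow> ob U'" for U U' using V.ob_cd by (metis V_ob V.isomorphicE)
    have 1: "U0 \<subseteq> t_ob K" "X \<in> U0" using obX rkX by (auto simp: U0_def)
    have 2: "U' \<in> U0" if "U \<in> U0" "isomorphic V U U'" for U U'
      using that o[OF that(2)] V_isomorphic_rk[OF that(2)] R.V_isomorphic_rk[OF that(2)] by (simp add: U0_def)
    have 3: "So U \<in> U0 \<longleftrightarrow> U \<in> U0" if "ob U" for U using that rk_So R.rk_So by (simp add: U0_def)
    obtain U \<alpha> where "U \<in> U0" "V.arr \<alpha>" "V.dm \<alpha> = Y" "V.cd \<alpha> = U" "\<alpha> \<noteq> V.nul Y U"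
      by (rule generator_detects[OF gen 1 2 3 Y])
    then show ?thesis unfolding U0_def by blast
  qed
  \<comment> \<open>The value of \<rho>' at \<open>X\<close> is found from a nonzero map of the
    quotient from \<open>X'\<close> to a detecting object \<open>U\<close>.\<close>
  have "X' \<notin> S" using R.kernel[OF R.obX] R.rkX by simp
  then obtain U \<alpha> where U: "ob U" "rk U = 1" "\<rho>' (one U) = \<rho>' (one X)" and
    a: "V.arr \<alpha>" "V.dm \<alpha> = X'" "V.cd \<alpha> = U" "\<alpha> \<noteq> V.nul X' U"
    using detect2[OF R.obX] by blast
  obtain s b F k d where p: "W s" "cd s = X'" "tri F (dm s) U k b d" "\<not> factors b"
    by (rule peel[OF R.obX a U(2)])
  note Dp = triD[OF p(3)]
  obtain Z g h where t: "tri (dm s) U Z b g h" using tri_exists[OF Dp(4)] Dp(5,6) by metis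
  note D = triD[OF t]
  have "\<rho> b = 1" using unit_rank[OF D(1) p(4)] D U by simp
  then have "factors g" using factors_if_rank0 rank_tri1[OF t] U(2) D by simp
  have r': "\<rho>' (one (dm s)) = 1" using R.W_rk[OF p(1)] p(2) R.rkX by simp
  then have "\<rho>' b = 1" using R.unit_rank[OF D(1) p(4)] D by simp
  then have "factors h" using factors_if_rank0 R.rank_tri3[OF t] r' R.factors_if_rank0 D by simp
  \<comment> \<open>\<open>g\<close> died because its \<rho> is zero, \<open>h\<close> because its
    \<rho>' is zero. So \<open>b\<close> is in \<open>W\<close> and carries the value one from
    \<open>X'\<close> to \<open>U\<close>.\<close>
  then have "Z \<in> S" using S_if_factors[OF t \<open>factors g\<close>] by blast
  then have "W b" using W_iff[OF t] by simp
  then have c: "\<rho>' (one X) = 1" using R.W_rk[of b] D r' U(3) by simp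
  have "\<rho>' (one Y) = rk Y" if "ob Y" "rk Y = real n" for Y n
    using that
  proof (induction n arbitrary: Y)
    case 0 then show ?case using kernel R.kernel by auto
  next
    case (Suc n)
    have "Y \<notin> S" using Suc.prems kernel by simp
    then obtain U \<alpha> where U: "ob U" "rk U = 1" "\<rho>' (one U) = \<rho>' (one X)" and
      a: "V.arr \<alpha>" "V.dm \<alpha> = Y" "V.cd \<alpha> = U" "\<alpha> \<noteq> V.nul Y U"
      using detect2[OF Suc.prems(1)] by blast
    obtain s b F k d where p: "W s" "cd s = Y" "tri F (dm s) U k b d" "\<not> factors b" "rk F = rk Y - 1"
      by (rule peel[OF Suc.prems(1) a U(2)])
    note D = triD[OF p(3)]
    have "\<rho>' b = 1" using R.unit_rank[OF D(4) p(4)] D U c by simp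
    then have "\<rho>' (one F) = \<rho>' (one Y) - 1"
      using R.rank_tri1[OF p(3)] R.rank_tri2[OF p(3)] R.rank_tri3[OF p(3)] U c R.W_rk[OF p(1)] p(2) by simp
    moreover have "\<rho>' (one F) = rk F" using Suc.IH[of F] D p(5) Suc.prems by simp
    ultimately show ?case using p(5) by simp
  qed
  then show ?thesis using rk_nat assms(2) by metis
qed

lemma rank_unique:
  assumes "localizing_prime K S \<rho>' X'" and "arr f"
  shows "\<rho>' f = \<rho> f"
proof -
  interpret R: localizing_prime K S \<rho>' X' by fact
  obtain Z g h where t: "tri (dm f) (cd f) Z f g h" using tri_exists[OF assms(2)] .
  note D = triD[OF t]
  have "2 * \<rho>' f = 2 * \<rho> f"
    unfolding rank_tri[OF t] R.rank_tri[OF t]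
    using rk_unique[OF assms(1), of "dm f"] rk_unique[OF assms(1), of "cd f"] rk_unique[OF assms(1), of Z] D by simp
  then show ?thesis by simp
qed

end

section \<open>Filtrations by atoms\<close>

context triangulated_subcategory begin

lemma factors_post_W: assumes "W s" "arr f" "dm s = cd f" "factors (s \<cdot> f)" shows "factors f"
proof -
  note s = W_arr[OF assms(1)]
  obtain u where u: "W u" "arr u" "cd u = dm (s \<cdot> f)" "(s \<cdot> f) \<cdot> u = nul (dm u) (cd (s \<cdot> f))"
    using factors_kill_pre[OF assms(4)] .
  have u': "cd u = dm f" using u(3) s assms by simp
  have "factors (f \<cdot> u)" by (rule factors_if_post[OF assms(1)]) (use u u' s assms in simp_all)
  then obtain w where w: "W w" "arr w" "cd w = dm (f \<cdot> u)" "(f \<cdot> u) \<cdot> w = nul (dm w) (cd (f \<cdot> u))"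
    by (rule factors_kill_pre)
  show ?thesis by (rule factors_if_pre[of "u \<cdot> w"]) (use u u' w assms W_cmp in simp_all)
qed

lemma factors_pre_W: assumes "W u" "arr f" "cd u = dm f" "factors (f \<cdot> u)" shows "factors f"
proof -
  note s = W_arr[OF assms(1)]
  obtain w where w: "W w" "arr w" "cd w = dm (f \<cdot> u)" "(f \<cdot> u) \<cdot> w = nul (dm w) (cd (f \<cdot> u))"
    by (rule factors_kill_pre[OF assms(4)])
  show ?thesis by (rule factors_if_pre[of "u \<cdot> w"]) (use s w assms W_cmp in simp_all)
qed

lemma factors_shift: assumes "factors f" shows "factors (Sh f)"
proof -
  obtain Z u v where *: "Z \<in> S" "arr u" "arr v" "cd u = Z" "dm v = Z" "f = v \<cdot> u"
    using assms unfolding factors_def by blast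
  show ?thesis unfolding factors_def using * sub_So[OF sub_ob[OF *(1)]]
    by (intro exI[of _ "So Z"] exI[of _ "Sh u"] exI[of _ "Sh v"]) simp
qed

lemma factors_mns: assumes "factors f" shows "factors (mns f)"
proof -
  obtain Z u v where *: "Z \<in> S" "arr u" "arr v" "cd u = Z" "dm v = Z" "f = v \<cdot> u"
    using assms unfolding factors_def by blast
  show ?thesis unfolding factors_def using *
    by (intro exI[of _ Z] exI[of _ u] exI[of _ "mns v"]) simp
qed

lemma factors_if_dm: "arr f \<Longrightarrow> dm f \<in> S \<Longrightarrow> factors f"
  unfolding factors_def by (intro exI[of _ "dm f"] exI[of _ "one (dm f)"] exI[of _ f]) simp

lemma factors_if_cd: "arr f \<Longrightarrow> cd f \<in> S \<Longrightarrow> factors f"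
  unfolding factors_def by (intro exI[of _ "cd f"] exI[of _ f] exI[of _ "one (cd f)"]) simp

text \<open>If \<open>h\<close> dies in the quotient, \<open>f\<close> is a monomorphism there. In
  the original category: a refinement kills \<open>f x\<close>, the shifted composite lifts along
  \<open>h\<close>, and so it factors through \<open>S\<close>.\<close>

lemma factors_reflect:
  assumes t: "tri A B Z f g h" and "factors h" and x: "arr x" "cd x = A" "factors (f \<cdot> x)"
  shows "factors x"
proof -
  note D = triD[OF t]
  obtain u where u: "W u" "arr u" "cd u = dm (f \<cdot> x)" "(f \<cdot> x) \<cdot> u = nul (dm u) (cd (f \<cdot> x))"
    using factors_kill_pre[OF x(3)] .
  have u': "cd u = dm x" using u(3) D x by simp
  have "Sh f \<cdot> Sh (x \<cdot> u) = Sh ((f \<cdot> x) \<cdot> u)" using u(2) u' D x(1,2) by simp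
  also have "\<dots> = nul (dm (Sh (x \<cdot> u))) (So B)" unfolding u(4) using u(2) u' D x(1,2) by simp
  finally obtain y where y: "arr y" "dm y = dm (Sh (x \<cdot> u))" "cd y = Z" "h \<cdot> y = Sh (x \<cdot> u)"
    using tri_lift3[OF t, of "Sh (x \<cdot> u)"] u(2) u' D x(1,2) by auto
  have "factors (Sh (x \<cdot> u))" using factors_pre[OF assms(2) y(1)] y(3,4) D by simp
  then have "factors (x \<cdot> u)" by (rule factors_Sh[rotated]) (use u(2) u' x in simp)
  then show ?thesis by (rule factors_pre_W[OF u(1) x(1) u'])
qed

text \<open>In the octahedron on \<open>f u\<close> the remaining cone is that of \<open>u\<close>,
  up to a shift, and lies in \<open>S\<close>. So the map between the other two cones is in
  \<open>W\<close>; \<open>W_post_cone\<close> treats composition on the other side.\<close>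

lemma W_pre_cone:
  assumes t: "tri A B Z f g h" and u: "W u" "cd u = A" and t': "tri (dm u) B Z' (f \<cdot> u) g' h'"
  obtains b where "W b" "dm b = Z'" "cd b = Z"
proof -
  obtain Q c d where t1: "tri (dm u) A Q u c d" "Q \<in> S" using W_tri[OF u(1)] u(2) by metis
  obtain a b where "tri Q Z' Z a b (Sh c \<cdot> h)" using octahedron[OF t1(1) t t'] by metis
  note o = this
  have "W b" using W_iff[OF tri_rot[OF o]] t1(2) sub_So triD(10)[OF o] by simp
  then show ?thesis using that triD[OF o] by blast
qed

lemma W_post_cone:
  assumes t: "tri A B Z f g h" and u: "W u" "dm u = B" and t': "tri A (cd u) Z' (u \<cdot> f) g' h'"
  obtains b where "W b" "dm b = Z" "cd b = Z'"
proof -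
  obtain Q c d where t1: "tri B (cd u) Q u c d" "Q \<in> S" using W_tri[OF u(1)] u(2) by metis
  obtain a b where "tri Z Z' Q a b (Sh g \<cdot> d)" using octahedron[OF t t1(1) t'] by metis
  note o = this
  have "W a" using W_iff[OF o] t1(2) by simp
  then show ?thesis using that triD[OF o] by blast
qed

end

section \<open>Atoms of the quotient and lengths of filtrations\<close>

context thick_subcategory begin

text \<open>Nonzero in the quotient, and each nonzero morphism of the quotient out of it is a split
  monomorphism: the property of rank-one objects, expressed without a rank.\<close>

definition atom where
  "atom U \<longleftrightarrow> ob U \<and> U \<notin> S \<and> (\<forall>\<alpha>. V.arr \<alpha> \<longrightarrow> V.dm \<alpha> = U \<longrightarrow> \<alpha> = V.nul U (V.cd \<alpha>) \<or>
     (\<exists>\<kappa>. V.arr \<kappa> \<and> V.dm \<kappa> = V.cd \<alpha> \<and> V.cd \<kappa> = U \<and> \<kappa> \<bullet> \<alpha> = V.one U))"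

lemma atomE:
  assumes "atom U" "V.arr \<alpha>" "V.dm \<alpha> = U" "\<alpha> \<noteq> V.nul U (V.cd \<alpha>)"
  obtains \<kappa> where "V.arr \<kappa>" "V.dm \<kappa> = V.cd \<alpha>" "V.cd \<kappa> = U" "\<kappa> \<bullet> \<alpha> = V.one U"
  using assms unfolding atom_def by blast

lemma V_iso_S: assumes "isomorphic V U U'" shows "U \<in> S \<longleftrightarrow> U' \<in> S"
proof -
  have "ob U" "ob U'" using assms V.ob_dm V.ob_cd by (metis V_ob V.isomorphicE)+
  then show ?thesis using V_zero_iff V.zero_obj_iso assms V.isomorphic_sym by metis
qed

lemma atom_iso: assumes U: "atom U" and i: "isomorphic V U U'" shows "atom U'"
  unfolding atom_def
proof (intro conjI allI impI)
  obtain t where t: "iso_mor V t" "V.arr t" "V.dm t = U" "V.cd t = U'" using i by (rule V.isomorphicE)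
  obtain t' where t': "V.arr t'" "V.dm t' = U'" "V.cd t' = U" "t \<bullet> t' = V.one U'" using V.iso_inv[OF t(1)] t by metis
  have o: "ob U" "ob U'" using V.ob_dm[OF t(2)] V.ob_cd[OF t(2)] t by simp_all
  show "ob U'" by fact
  show "U' \<notin> S" using V_iso_S[OF i] U by (simp add: atom_def)
  fix \<alpha> assume a: "V.arr \<alpha>" "V.dm \<alpha> = U'"
  have at: "V.arr (\<alpha> \<bullet> t)" "V.dm (\<alpha> \<bullet> t) = U" "V.cd (\<alpha> \<bullet> t) = V.cd \<alpha>" using a t by simp_all
  have att: "\<alpha> = (\<alpha> \<bullet> t) \<bullet> t'" using a t(2-4) t' by simp
  show "\<alpha> = V.nul U' (V.cd \<alpha>) \<or> (\<exists>\<kappa>. V.arr \<kappa> \<and> V.dm \<kappa> = V.cd \<alpha> \<and> V.cd \<kappa> = U' \<and> \<kappa> \<bullet> \<alpha> = V.one U')"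
  proof (cases "\<alpha> \<bullet> t = V.nul U (V.cd \<alpha>)")
    case True
    have "V.nul U (V.cd \<alpha>) \<bullet> t' = V.nul U' (V.cd \<alpha>)" using t' V.ob_cd[OF a(1)] by simp
    then show ?thesis using att unfolding True by simp
  next
    case False
    then obtain k where k: "V.arr k" "V.dm k = V.cd \<alpha>" "V.cd k = U" "k \<bullet> (\<alpha> \<bullet> t) = V.one U"
      using atomE[OF U at(1,2)] at(3) by metis
    have "t \<bullet> k \<bullet> ((\<alpha> \<bullet> t) \<bullet> t') = t \<bullet> (k \<bullet> (\<alpha> \<bullet> t)) \<bullet> t'" using k(1-3) a t(2-4) t'(1-3) by simp
    also have "\<dots> = V.one U'" unfolding k(4) using t(2-4) t' by simp
    finally have "(t \<bullet> k) \<bullet> \<alpha> = V.one U'" unfolding att[symmetric] using k(1-3) a t(2-4) by simp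
    then show ?thesis using k a t by (intro disjI2 exI[of _ "t \<bullet> k"]) simp
  qed
qed

lemma atom_So: assumes oU: "ob U" shows "atom (So U) \<longleftrightarrow> atom U"
proof
  assume U: "atom (So U)"
  show "atom U"
    unfolding atom_def
  proof (intro conjI allI impI)
    show "ob U" by fact
    show "U \<notin> S" using U sub_So[OF oU] by (simp add: atom_def)
    fix \<alpha> assume a: "V.arr \<alpha>" "V.dm \<alpha> = U"
    show "\<alpha> = V.nul U (V.cd \<alpha>) \<or> (\<exists>\<kappa>. V.arr \<kappa> \<and> V.dm \<kappa> = V.cd \<alpha> \<and> V.cd \<kappa> = U \<and> \<kappa> \<bullet> \<alpha> = V.one U)"
    proof (cases "V.Sh \<alpha> = V.nul (So U) (V.cd (V.Sh \<alpha>))")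
      case True
      then have "V.Sh \<alpha> = V.nul (t_shO V U) (t_shO V (V.cd \<alpha>))" using a by simp
      then show ?thesis using V.Sh_eq_nul[OF _ a refl] by blast
    next
      case False
      then obtain k where k: "V.arr k" "V.dm k = V.cd (V.Sh \<alpha>)" "V.cd k = So U" "k \<bullet> V.Sh \<alpha> = V.one (So U)"
        using atomE[OF U, of "V.Sh \<alpha>"] a by auto
      then obtain k' where k': "V.arr k'" "V.dm k' = V.cd \<alpha>" "V.cd k' = U" "k = V.Sh k'"
        using V.Sh_full[of k "V.cd \<alpha>" U] a oU V.ob_cd[OF a(1)] by auto
      have "V.Sh (k' \<bullet> \<alpha>) = V.Sh (V.one U)" using k(4) unfolding k'(4) using k'(1-3) a oU by simp
      then have "k' \<bullet> \<alpha> = V.one U" by (rule V.Sh_inject) (use k' a oU in simp_all)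
      then show ?thesis using k' by blast
    qed
  qed
next
  assume U: "atom U"
  show "atom (So U)"
    unfolding atom_def
  proof (intro conjI allI impI)
    show "ob (So U)" using oU by simp
    show "So U \<notin> S" using U sub_So[OF oU] by (simp add: atom_def)
    fix \<alpha> assume a: "V.arr \<alpha>" "V.dm \<alpha> = So U"
    \<comment> \<open>The target of \<alpha> need not be a shift, so it is first desuspended up to
      isomorphism.\<close>
    obtain Y t where Y: "ob Y" "iso_mor V t" "V.arr t" "V.dm t = So Y" "V.cd t = V.cd \<alpha>"
      using V.desuspend[of "V.cd \<alpha>"] V.ob_cd[OF a(1)] by auto
    obtain t' where t': "V.arr t'" "V.dm t' = V.cd \<alpha>" "V.cd t' = So Y" "t \<bullet> t' = V.one (V.cd \<alpha>)" using V.iso_inv[OF Y(2)] Y by metis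
    have ta: "V.arr (t' \<bullet> \<alpha>)" "V.dm (t' \<bullet> \<alpha>) = t_shO V U" "V.cd (t' \<bullet> \<alpha>) = t_shO V Y" "U \<in> t_ob V" "Y \<in> t_ob V" using t' a oU Y by simp_all
    obtain \<beta> where b: "V.arr \<beta>" "V.dm \<beta> = U" "V.cd \<beta> = Y" "t' \<bullet> \<alpha> = V.Sh \<beta>" by (rule V.Sh_full[OF ta])
    have "\<alpha> = (t \<bullet> t') \<bullet> \<alpha>" unfolding t'(4) using a by simp
    then have ab: "\<alpha> = t \<bullet> V.Sh \<beta>" unfolding b(4)[symmetric] using a t'(1-3) Y by simp
    show "\<alpha> = V.nul (So U) (V.cd \<alpha>) \<or> (\<exists>\<kappa>. V.arr \<kappa> \<and> V.dm \<kappa> = V.cd \<alpha> \<and> V.cd \<kappa> = So U \<and> \<kappa> \<bullet> \<alpha> = V.one (So U))"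
    proof (cases "\<beta> = V.nul U Y")
      case True
      have "t \<bullet> V.Sh \<beta> = V.nul (So U) (V.cd \<alpha>)" unfolding True using Y oU by simp
      then show ?thesis using ab by simp
    next
      case False
      then obtain k where k: "V.arr k" "V.dm k = Y" "V.cd k = U" "k \<bullet> \<beta> = V.one U"
        using atomE[OF U b(1,2)] b(3) by metis
      have "(V.Sh k \<bullet> t') \<bullet> \<alpha> = V.Sh k \<bullet> V.Sh \<beta>" unfolding b(4)[symmetric] using k(1-3) t'(1-3) a by simp
      also have "\<dots> = V.Sh (k \<bullet> \<beta>)" using k(1-3) b(1-3) by simp
      also have "\<dots> = V.one (So U)" unfolding k(4) using oU by simp
      finally show ?thesis using k t' by (intro disjI2 exI[of _ "V.Sh k \<bullet> t'"]) simp
    qed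
  qed
qed

text \<open>Schur's lemma. The retraction of \<open>q k\<close> is itself a nonzero morphism out of
  an atom, so it has a left inverse besides its right inverse \<open>q k\<close> and is
  invertible.\<close>

lemma atom_W: assumes "atom U" "atom U'" and k: "arr k" "dm k = U" "cd k = U'" "\<not> factors k" shows "W k"
proof -
  have "q k \<noteq> V.nul U U'" using q_zero_iff[OF k(1-3)] k(4) by simp
  then obtain \<kappa> where ka: "V.arr \<kappa>" "V.dm \<kappa> = U'" "V.cd \<kappa> = U" "\<kappa> \<bullet> q k = V.one U"
    using atomE[OF assms(1), of "q k"] k by auto
  have oU: "ob U" "ob U'" using assms by (simp_all add: atom_def)
  have "\<kappa> \<noteq> V.nul U' U"
  proof
    assume "\<kappa> = V.nul U' U"
    then have "V.one U = V.nul U U" using ka(4) k oU by simp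
    then show False using V_zero_iff[OF oU(1)] assms(1) oU by (simp add: V.zero_obj_iff atom_def)
  qed
  then obtain l where l: "V.arr l" "V.dm l = U" "V.cd l = U'" "l \<bullet> \<kappa> = V.one U'"
    using atomE[OF assms(2), of \<kappa>] ka by auto
  have "iso_mor V \<kappa>"
    by (rule V.iso_from_left_right[of \<kappa> l "q k"]) (use ka l k in simp_all)
  then obtain m where m: "V.arr m" "V.dm m = U" "V.cd m = U'" "m \<bullet> \<kappa> = V.one U'" "iso_mor V m"
    using V.iso_inv ka by metis
  have "q k = (m \<bullet> \<kappa>) \<bullet> q k" unfolding m(4) using k by simp
  also have "\<dots> = m \<bullet> (\<kappa> \<bullet> q k)" using m(1-3) ka(1-3) k by simp
  finally have "q k = m" unfolding ka(4) using m(1-3) by simp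
  then show ?thesis using W_if_V_iso[OF k(1)] m(5) by simp
qed

text \<open>In a simple quotient the atoms are the shifts of the indecomposable generator. The filtration
  consists of triangles of \<open>K\<close>, not of \<open>V\<close>: this way the octahedral axiom is available without
  having to verify it for the quotient.\<close>
inductive filtered where
  filtered_0: "Y \<in> S \<Longrightarrow> filtered 0 Y"
| filtered_Suc: "atom U \<Longrightarrow> tri U Y Z i p d \<Longrightarrow> \<not> factors i \<Longrightarrow> filtered n Z \<Longrightarrow> filtered (Suc n) Y"

lemma filtered_0_iff: "filtered 0 Y \<longleftrightarrow> Y \<in> S"
  using filtered.simps[of 0 Y] by auto

lemma filtered_SucE:
  assumes "filtered (Suc n) Y" obtains U Z i p d where "atom U" "tri U Y Z i p d" "\<not> factors i" "filtered n Z"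
  using assms filtered.simps[of "Suc n" Y] by auto

lemma filtered_ob: "filtered n Y \<Longrightarrow> ob Y"
  by (induction rule: filtered.induct) (auto simp: sub_ob triD)

text \<open>An atom of \<open>dm s\<close> is pushed forward along \<open>s\<close>. Conversely, Ore
  replaces an atom of \<open>cd s\<close> by one isomorphic to it in the quotient that lifts to
  \<open>dm s\<close>.\<close>

lemma filtered_W: "W s \<Longrightarrow> filtered n (dm s) \<longleftrightarrow> filtered n (cd s)"
proof (induction n arbitrary: s)
  case 0
  obtain Z g h where "tri (dm s) (cd s) Z s g h" "Z \<in> S" using W_tri[OF 0] .
  from sub_tri[OF this(1)] this(2) show ?case unfolding filtered_0_iff by blast
next
  case (Suc n)
  note s = W_arr[OF Suc.prems]
  show ?case
  proof
    assume "filtered (Suc n) (dm s)"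
    then obtain U Z i p d where U: "atom U" "tri U (dm s) Z i p d" "\<not> factors i" "filtered n Z" by (rule filtered_SucE)
    note D = triD[OF U(2)]
    have nf: "\<not> factors (s \<cdot> i)" using factors_post_W[OF Suc.prems D(1)] D U(3) by auto
    obtain Q w w' where t: "tri U (cd s) Q (s \<cdot> i) w w'" using tri_exists[of "s \<cdot> i"] D s by (metis arr_cmp cd_cmp dm_cmp)
    obtain b where b: "W b" "dm b = Z" "cd b = Q" by (rule W_post_cone[OF U(2) Suc.prems refl t])
    show "filtered (Suc n) (cd s)" using filtered_Suc[OF U(1) t nf] Suc.IH[OF b(1)] b U(4) by simp
  next
    assume "filtered (Suc n) (cd s)"
    then obtain U Z i p d where U: "atom U" "tri U (cd s) Z i p d" "\<not> factors i" "filtered n Z" by (rule filtered_SucE)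
    note D = triD[OF U(2)]
    obtain u k where u: "W u" "arr u" "cd u = dm i" "arr k" "dm k = dm u" "cd k = dm s" "i \<cdot> u = s \<cdot> k"
      by (rule W_Ore[OF D(1) Suc.prems]) (use D in simp)
    have "isomorphic V (dm u) U" using W_isomorphic[OF u(1)] u(3) D by simp
    then have at: "atom (dm u)" using atom_iso[OF U(1)] V.isomorphic_sym by blast
    have nf: "\<not> factors (i \<cdot> u)" using factors_pre_W[OF u(1) D(1)] u(3) U(3) by auto
    obtain Q w w' where t: "tri (dm u) (cd s) Q (i \<cdot> u) w w'" using tri_exists[of "i \<cdot> u"] D u(2,3) by (metis arr_cmp cd_cmp dm_cmp)
    obtain b where b: "W b" "dm b = Q" "cd b = Z" by (rule W_pre_cone[OF U(2) u(1) _ t]) (use u D in simp)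
    have fQ: "filtered n Q" using Suc.IH[OF b(1)] b U(4) by simp
    obtain R x x' where tk: "tri (dm u) (dm s) R k x x'" using tri_exists[OF u(4)] u(5,6) by metis
    obtain c where c: "W c" "dm c = R" "cd c = Q" by (rule W_post_cone[OF tk Suc.prems refl t[unfolded u(7)]])
    have fR: "filtered n R" using Suc.IH[OF c(1)] c fQ by simp
    have "\<not> factors k" using nf factors_post[of k s] u(4,6,7) s by auto
    then show "filtered (Suc n) (dm s)" by (rule filtered_Suc[OF at tk _ fR])
  qed
qed

lemma filtered_iso: assumes "isomorphic V Y Y'" shows "filtered n Y \<longleftrightarrow> filtered n Y'"
proof -
  obtain s f where "W s" "arr s" "cd s = Y" "W f" "arr f" "dm f = dm s" "cd f = Y'" using V_isomorphic_roof[OF assms] .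
  then show ?thesis using filtered_W[of s] filtered_W[of f] by metis
qed

text \<open>If \<open>U'\<close> dies in \<open>Z\<close>, then after a refinement \<open>i'\<close>
  factors through \<open>i\<close> by a nonzero map between atoms. This map is in \<open>W\<close>,
  so both atoms have the same cone up to isomorphism in the quotient.\<close>

lemma atom_compare:
  assumes U: "atom U" "tri U Y Z i p d" and U': "atom U'" "tri U' Y Z' i' p' d'" "\<not> factors i'" and f: "factors (p \<cdot> i')"
  shows "isomorphic V Z Z'" "factors (p' \<cdot> i)"
proof -
  note D = triD[OF U(2)] triD[OF U'(2)]
  obtain t where t: "W t" "arr t" "cd t = dm (p \<cdot> i')" "(p \<cdot> i') \<cdot> t = nul (dm t) (cd (p \<cdot> i'))" by (rule factors_kill_pre[OF f])
  have t': "cd t = U'" using t(3) D by simp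
  have "p \<cdot> (i' \<cdot> t) = nul (dm (i' \<cdot> t)) Z" using t(2,4) t' D by simp
  then obtain k where k: "arr k" "dm k = dm t" "cd k = U" "i \<cdot> k = i' \<cdot> t"
    using tri_lift[OF U(2), of "i' \<cdot> t"] t(2) t' D by auto
  have "isomorphic V (dm t) U'" using W_isomorphic[OF t(1)] t' by simp
  then have at: "atom (dm t)" using atom_iso[OF U'(1)] V.isomorphic_sym by blast
  have "\<not> factors (i' \<cdot> t)" using factors_pre_W[OF t(1), of i'] t' D U'(3) by auto
  then have nk: "\<not> factors k" using factors_post[of k i] k D by auto
  have Wk: "W k" by (rule atom_W[OF at U(1) k(1-3) nk])
  obtain Q w w' where tQ: "tri (dm t) Y Q (i' \<cdot> t) w w'" using tri_exists[of "i' \<cdot> t"] D t(2) t' by (metis arr_cmp cd_cmp dm_cmp)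
  obtain b where b: "W b" "dm b = Q" "cd b = Z'" by (rule W_pre_cone[OF U'(2) t(1) t' tQ])
  obtain c where c: "W c" "dm c = Q" "cd c = Z" by (rule W_pre_cone[OF U(2) Wk k(3)]) (use tQ[folded k(4)] k(2) in simp)
  show "isomorphic V Z Z'" using W_isomorphic[OF b(1)] W_isomorphic[OF c(1)] b c V.isomorphic_sym V.isomorphic_trans by metis
  have "(p' \<cdot> i) \<cdot> k = (p' \<cdot> i') \<cdot> t" using k D t(2) t' by simp
  also have "\<dots> = nul (dm k) Z'" unfolding tri_comp_zero[OF U'(2)] using k(2) t(2) t' D by simp
  finally show "factors (p' \<cdot> i)" by (intro factors_if_pre[OF Wk]) (use D k(1-3) in simp_all)
qed

text \<open>The exchange step of a Jordan-Hoelder argument: any nonzero atom of \<open>Y\<close> can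
  be taken as the first step of a filtration of the same length. Either it agrees with the first
  atom \<open>U\<close> up to isomorphism in the quotient, or it survives in \<open>Z\<close> and
  the induction hypothesis applies there.\<close>

lemma filtered_exchange:
  "filtered n Y \<Longrightarrow> atom U' \<Longrightarrow> tri U' Y Z' i' p' d' \<Longrightarrow> \<not> factors i' \<Longrightarrow> \<exists>m. n = Suc m \<and> filtered m Z'"
proof (induction n arbitrary: Y U' Z' i' p' d')
  case 0
  then show ?case using factors_if_cd[of i'] triD[OF 0(3)] by (simp add: filtered_0_iff)
next
  case (Suc n)
  obtain U Z i p d where U: "atom U" "tri U Y Z i p d" "\<not> factors i" "filtered n Z" using Suc.prems(1) by (rule filtered_SucE)
  note D = triD[OF U(2)] triD[OF Suc.prems(3)]
  show ?case
  proof (cases "factors (p \<cdot> i')")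
    case True
    then show ?thesis using atom_compare(1)[OF U(1,2) Suc.prems(2,3,4)] filtered_iso U(4) by blast
  next
    case False
    have nf: "\<not> factors (p' \<cdot> i)" using atom_compare(2)[OF Suc.prems(2,3) U(1-3)] False by blast
    obtain Q w w' where t: "tri U' Z Q (p \<cdot> i') w w'" using tri_exists[of "p \<cdot> i'"] D by (metis arr_cmp cd_cmp dm_cmp)
    obtain m where m: "n = Suc m" "filtered m Q" using Suc.IH[OF U(4) Suc.prems(2) t False] by blast
    \<comment> \<open>\<open>Q\<close> arises from \<open>Y\<close> by dividing out \<open>U\<close>
      and then \<open>U'\<close>. The octahedron shows that the opposite order gives the same
      object, so \<open>U\<close> can follow \<open>U'\<close>.\<close>
    obtain a b where o: "tri Z' Q (So U) a b (Sh p' \<cdot> mns (Sh i))"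
      using octahedron[OF Suc.prems(3) tri_rot[OF U(2)] t] by metis
    have "tri U Z' Q (p' \<cdot> i) a b"
      by (rule tri_unrot) (use o D in simp_all)
    then show ?thesis using filtered_Suc[OF U(1) _ nf m(2)] m(1) by blast
  qed
qed

lemma filtered_unique: "filtered n Y \<Longrightarrow> filtered m Y \<Longrightarrow> n = m"
proof (induction n arbitrary: Y m)
  case 0
  then have "Y \<in> S" by (simp add: filtered_0_iff)
  have "\<not> filtered (Suc k) Y" for k
  proof
    assume "filtered (Suc k) Y"
    then obtain U Z i p d where "tri U Y Z i p d" "\<not> factors i" by (rule filtered_SucE)
    then show False using factors_if_cd[of i] triD[of U Y Z i p d] \<open>Y \<in> S\<close> by simp
  qed
  then show ?case using 0(2) by (cases m) auto
next
  case (Suc n)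
  obtain U Z i p d where U: "atom U" "tri U Y Z i p d" "\<not> factors i" "filtered n Z" using Suc.prems(1) by (rule filtered_SucE)
  obtain k where "m = Suc k" "filtered k Z" using filtered_exchange[OF Suc.prems(2) U(1-3)] by blast
  then show ?case using Suc.IH[OF U(4)] by simp
qed

text \<open>As \<open>h\<close> dies in the quotient, an atom of \<open>A\<close> stays nonzero in
  \<open>B\<close> by \<open>factors_reflect\<close>. The octahedron divides it out of both, leaving
  a triangle of the same kind.\<close>

lemma filtered_add: "filtered a A \<Longrightarrow> filtered b Z \<Longrightarrow> tri A B Z f g h \<Longrightarrow> factors h \<Longrightarrow> filtered (a + b) B"
proof (induction a arbitrary: A B Z f g h)
  case 0
  note D = triD[OF 0(3)]
  have "W g" using W_iff[OF tri_rot[OF 0(3)]] sub_So[OF D(10)] 0(1) by (simp add: filtered_0_iff)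
  then show ?case using filtered_W[of g b] D 0(2) by simp
next
  case (Suc a)
  obtain U A1 i p d where U: "atom U" "tri U A A1 i p d" "\<not> factors i" "filtered a A1" using Suc.prems(1) by (rule filtered_SucE)
  note D = triD[OF U(2)] triD[OF Suc.prems(3)]
  have nf: "\<not> factors (f \<cdot> i)" using factors_reflect[OF Suc.prems(3,4), of i] D U(3) by auto
  obtain Q w w' where t: "tri U B Q (f \<cdot> i) w w'" using tri_exists[of "f \<cdot> i"] D by (metis arr_cmp cd_cmp dm_cmp)
  obtain a' b' where o: "tri A1 Q Z a' b' (Sh p \<cdot> h)" using octahedron[OF U(2) Suc.prems(3) t] by metis
  have "factors (Sh p \<cdot> h)" using factors_post[OF Suc.prems(4)] D by simp
  then have "filtered (a + b) Q" using Suc.IH[OF U(4) Suc.prems(2) o] by blast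
  then show ?case using filtered_Suc[OF U(1) t nf] by simp
qed

lemma filtered_atom: assumes "atom U" shows "filtered 1 U"
proof -
  obtain N0 where z: "zero_obj K N0" by (rule zero_obj_exists)
  have o: "ob U" "U \<notin> S" using assms by (simp_all add: atom_def)
  have "\<not> factors (one U)" using factors_one o by blast
  then show ?thesis using filtered_Suc[OF assms tri_id[OF o(1) z] _ filtered_0[OF sub_zero[OF z]]] by simp
qed

text \<open>The rotated triangle has the dead connecting map \<open>mns (Sh e)\<close>, so the
  lengths of \<open>B\<close> and of the atom \<open>So U\<close> add up.\<close>

lemma filtered_cone_factors:
  assumes "atom U" "tri U B Q e w w'" "factors e" "filtered b B" shows "filtered (Suc b) Q"
proof -
  have "factors (mns (Sh e))" using factors_mns[OF factors_shift[OF assms(3)]] .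
  moreover have "filtered 1 (So U)" using filtered_atom assms(1) atom_So[of U] by (simp add: atom_def)
  ultimately show ?thesis using filtered_add[OF assms(4) _ tri_rot[OF assms(2)]] by fastforce
qed

text \<open>Peel an atom off \<open>A\<close> and follow it into \<open>B\<close>. If it dies there,
  coning it off adds one to the length; otherwise it cancels an atom of \<open>B\<close> by
  \<open>filtered_exchange\<close>. Either way the parity is preserved.\<close>

lemma filtered_cone: "filtered a A \<Longrightarrow> filtered b B \<Longrightarrow> tri A B Z f g h \<Longrightarrow> \<exists>c. filtered c Z \<and> c \<le> a + b \<and> even (a + b + c)"
proof (induction a arbitrary: A B Z f g h b)
  case 0
  note D = triD[OF 0(3)]
  have "W g" using W_iff[OF tri_rot[OF 0(3)]] sub_So[OF D(10)] 0(1) by (simp add: filtered_0_iff)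
  then have "filtered b Z" using filtered_W[of g b] D 0(2) by simp
  then show ?case by (intro exI[of _ b]) simp
next
  case (Suc a)
  obtain U A1 i p d where U: "atom U" "tri U A A1 i p d" "\<not> factors i" "filtered a A1" using Suc.prems(1) by (rule filtered_SucE)
  note D = triD[OF U(2)] triD[OF Suc.prems(3)]
  obtain Q w w' where t: "tri U B Q (f \<cdot> i) w w'" using tri_exists[of "f \<cdot> i"] D by (metis arr_cmp cd_cmp dm_cmp)
  obtain a' b' where o: "tri A1 Q Z a' b' (Sh p \<cdot> h)" using octahedron[OF U(2) Suc.prems(3) t] by metis
  show ?case
  proof (cases "factors (f \<cdot> i)")
    case True
    have "filtered (Suc b) Q" by (rule filtered_cone_factors[OF U(1) t True Suc.prems(2)])
    from Suc.IH[OF U(4) this o] show ?thesis by auto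
  next
    case False
    obtain b1 where b1: "b = Suc b1" "filtered b1 Q" using filtered_exchange[OF Suc.prems(2) U(1) t False] by blast
    from Suc.IH[OF U(4) b1(2) o] obtain c where "filtered c Z" "c \<le> a + b1" "even (a + b1 + c)" by blast
    then show ?thesis using b1(1) by (intro exI[of _ c]) simp
  qed
qed

text \<open>Attaining the bound of \<open>filtered_cone\<close> leaves no room for a cancellation,
  so the first atom of \<open>A\<close> dies in \<open>B\<close>, and the induction hypothesis
  handles the rest. This is the source of the localizing property.\<close>

lemma filtered_extremal: "filtered a A \<Longrightarrow> filtered b B \<Longrightarrow> tri A B Z f g h \<Longrightarrow> filtered (a + b) Z \<Longrightarrow> factors f"
proof (induction a arbitrary: A B Z f g h b)
  case 0
  then show ?case using factors_if_dm[of f] triD[OF 0(3)] by (simp add: filtered_0_iff)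
next
  case (Suc a)
  obtain U A1 i p d where U: "atom U" "tri U A A1 i p d" "\<not> factors i" "filtered a A1" using Suc.prems(1) by (rule filtered_SucE)
  note D = triD[OF U(2)] triD[OF Suc.prems(3)]
  obtain Q w w' where t: "tri U B Q (f \<cdot> i) w w'" using tri_exists[of "f \<cdot> i"] D by (metis arr_cmp cd_cmp dm_cmp)
  obtain a' b' where o: "tri A1 Q Z a' b' (Sh p \<cdot> h)" "a' \<cdot> p = w \<cdot> f" using octahedron[OF U(2) Suc.prems(3) t] by metis
  have fi: "factors (f \<cdot> i)"
  proof (rule ccontr)
    assume "\<not> factors (f \<cdot> i)"
    then obtain b1 where b1: "b = Suc b1" "filtered b1 Q" using filtered_exchange[OF Suc.prems(2) U(1) t] by blast
    obtain c where "filtered c Z" "c \<le> a + b1" using filtered_cone[OF U(4) b1(2) o(1)] by blast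
    then show False using filtered_unique[OF _ Suc.prems(4)] b1(1) by fastforce
  qed
  have "filtered (Suc b) Q" by (rule filtered_cone_factors[OF U(1) t fi Suc.prems(2)])
  then have "factors a'" using Suc.IH[OF U(4) _ o(1)] Suc.prems(4) by simp
  \<comment> \<open>Since \<open>f i\<close> dies, \<open>w\<close> is a monomorphism in the
    quotient; so it is enough that \<open>w f\<close>, which equals \<open>a' p\<close>,
    dies.\<close>
  then have "factors (w \<cdot> f)" using factors_pre[of a' p] triD[OF o(1)] D o(2) by simp
  then show ?case
    using factors_reflect[OF tri_rot[OF t] factors_mns[OF factors_shift[OF fi]]] D by blast
qed

lemma filtered_So: "filtered n Y \<Longrightarrow> filtered n (So Y)"
proof (induction rule: filtered.induct)
  case (filtered_0 Y) then show ?case using sub_So[OF sub_ob] filtered.filtered_0 by blast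
next
  case (filtered_Suc U Y Z i p d n)
  note D = triD[OF filtered_Suc(2)]
  have "\<not> factors (Sh i)" using factors_Sh[OF D(1)] filtered_Suc(3) by blast
  then show ?case using filtered.filtered_Suc[OF _ tri_Sh[OF filtered_Suc(2)]] atom_So[OF D(10)] filtered_Suc by blast
qed

lemma filtered_desuspend: "filtered n (So Y) \<Longrightarrow> ob Y \<Longrightarrow> filtered n Y"
proof (induction n arbitrary: Y)
  case 0 then show ?case using sub_So by (simp add: filtered_0_iff)
next
  case (Suc n)
  obtain U Z i p d where U: "atom U" "tri U (So Y) Z i p d" "\<not> factors i" "filtered n Z" using Suc.prems(1) by (rule filtered_SucE)
  note D = triD[OF U(2)]
  obtain U1 t where t: "ob U1" "iso_mor K t" "arr t" "dm t = So U1" "cd t = U" using desuspend[OF D(10)] .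
  obtain i1 where i1: "arr i1" "dm i1 = U1" "cd i1 = Y" "i \<cdot> t = Sh i1"
    by (rule Sh_full[of "i \<cdot> t" U1 Y]) (use t D Suc.prems in simp_all)
  have "isomorphic V U (So U1)" using q_isomorphic isomorphicI[OF t(2)] t isomorphic_sym by metis
  then have at: "atom U1" using atom_iso[OF U(1)] atom_So[OF t(1)] by blast
  have nf: "\<not> factors i1" using factors_shift[of i1] factors_pre_W[OF W_iso[OF t(2)] D(1)] t D U(3) i1(4) by auto
  obtain Z1 p1 d1 where t1: "tri U1 Y Z1 i1 p1 d1" using tri_exists[OF i1(1)] i1 by metis
  have tt: "tri (So U1) (So Y) (So Z1) (i \<cdot> t) (Sh p1) (mns (Sh d1))" using tri_Sh[OF t1] i1(4) by simp
  obtain b where "W b" "dm b = So Z1" "cd b = Z" by (rule W_pre_cone[OF U(2) W_iso[OF t(2)] t(5)]) (use tt t(4) in simp)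
  then have "filtered n (So Z1)" using filtered_W[of b n] U(4) by simp
  then have "filtered n Z1" using Suc.IH triD(12)[OF t1] by blast
  then show ?case by (rule filtered_Suc[OF at t1 nf])
qed

text \<open>If the atom \<open>X\<close> generates the quotient, it follows that every object has a
  filtration.\<close>

lemma filtered_subcat: assumes "atom X" shows "tri_subcat V {Y. \<exists>n. filtered n Y}" (is "tri_subcat V ?T")
proof -
  have "tri_subcat K ?T"
  proof (rule tri_subcatI)
    show "?T \<subseteq> t_ob K" using filtered_ob by blast
    show "?T \<noteq> {}" using filtered_atom[OF assms] by blast
    show "Y \<in> ?T" if "X \<in> ?T" "isomorphic K X Y" for X Y using filtered_iso q_isomorphic that by blast
    show "So Y \<in> ?T \<longleftrightarrow> Y \<in> ?T" if "ob Y" for Y using that filtered_So filtered_desuspend by blast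
    show "Z \<in> ?T" if "tri A B Z f g h" "A \<in> ?T" "B \<in> ?T" for A B Z f g h using filtered_cone that by blast
  qed
  moreover have "S \<subseteq> ?T" using filtered_0 by blast
  ultimately show ?thesis using V_subcat_iff by blast
qed

text \<open>The triangle on a numerator \<open>f\<close> splits, so its source decomposes as in
  \<open>half_splits\<close>. The decomposition is carried to \<open>X\<close> along the invertible
  \<open>q s\<close>, and indecomposability leaves \<open>f\<close> zero or a split
  monomorphism.\<close>

lemma indecomposable_atom:
  assumes sp: "\<And>T. T \<in> t_tri V \<Longrightarrow> split_tri V T" and X: "indecomposable V X"
  shows "atom X"
proof -
  have oX: "ob X" using X by (simp add: indecomposable_def)
  have "X \<notin> S" using V_zero_iff[OF oX] X by (simp add: indecomposable_def)
  moreover have "\<alpha> = V.nul X (V.cd \<alpha>) \<or> (\<exists>\<kappa>. V.arr \<kappa> \<and> V.dm \<kappa> = V.cd \<alpha> \<and> V.cd \<kappa> = X \<and> \<kappa> \<bullet> \<alpha> = V.one X)"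
    if a: "V.arr \<alpha>" "V.dm \<alpha> = X" for \<alpha>
  proof -
    obtain s f where r: "W s" "arr s" "cd s = V.dm \<alpha>" "arr f" "dm f = dm s" "cd f = V.cd \<alpha>" "\<alpha> \<bullet> q s = q f"
      using V_roof[OF a(1)] .
    obtain Z g h where t: "tri (dm f) (cd f) Z f g h" using tri_exists[OF r(4)] .
    note D = triD[OF t]
    have "V.half_splits (q f)"
      by (rule V.half_splits_if_split_tri[OF sp[OF tri_V[OF t]]])
       (use tri_comp_zero[OF t] tri_comp_zero2[OF t] tri_comp_zero3[OF t] D in \<open>simp_all add: q_nul flip: q_comp q_shift\<close>)
    then obtain M M' m m' p p' j j' where M: "is_biprod V M M' (dm f) m m' p p'" and
       j: "V.arr j" "V.dm j = M" "V.cd j = cd f" "V.arr j'" "V.dm j' = cd f" "V.cd j' = M" "j' \<bullet> j = V.one M" and e: "q f = j \<bullet> p"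
      unfolding V.half_splits_def using r(4) by auto
    note E = V.biprodD[OF M]
    obtain v where "is_biprod V M M' (V.cd (q s)) (q s \<bullet> m) (q s \<bullet> m') (p \<bullet> v) (p' \<bullet> v)"
      by (rule V.biprod_iso[OF M q_iso[OF r(1)]]) (use r in simp)
    moreover have "V.cd (q s) = X" using r(2,3) a by simp
    ultimately have "zero_obj V M \<or> zero_obj V M'" using X unfolding indecomposable_def by metis
    then show ?thesis
    proof
      assume "zero_obj V M"
      then have "p = V.nul (dm f) M" using V.into_zero[of M p] E by simp
      then have "q f = V.nul (dm f) (cd f)" using e E j by simp
      then have "factors f" using q_zero_iff[OF r(4)] by simp
      then show ?thesis using roof_zero[OF a(1) r(1,3-7)] a(2) by simp
    next
      assume "zero_obj V M'"
      then have "p' = V.nul (dm f) M'" using V.into_zero[of M' p'] E by simp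
      then have mp: "m \<bullet> p = V.one (dm f)" using V.biprod_sum[OF M] E by simp
      have "(m \<bullet> j') \<bullet> q f = m \<bullet> (j' \<bullet> j) \<bullet> p" unfolding e using E j(1-6) by simp
      also have "\<dots> = V.one (dm f)" unfolding j(7) using E mp by simp
      finally have "(q s \<bullet> (m \<bullet> j')) \<bullet> \<alpha> = V.one (V.dm \<alpha>)"
        by (intro roof_left_inverse[OF a(1) r(1,3-7)]) (use E j in simp_all)
      then show ?thesis using E j(1-6) r a by (intro disjI2 exI[of _ "q s \<bullet> (m \<bullet> j')"]) simp
    qed
  qed
  ultimately show ?thesis unfolding atom_def using oX by blast
qed

end

section \<open>The rank function of a simple quotient\<close>

locale simple_quotient = thick_subcategory +
  fixes X assumes atom_X: "atom X"
    and generated: "tri_subcat V T \<Longrightarrow> X \<in> T \<Longrightarrow> T = t_ob V"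
begin

definition len where "len Y = (THE n. filtered n Y)"

lemma len_eq: "filtered n Y \<Longrightarrow> len Y = n"
  unfolding len_def using filtered_unique by blast

lemma filtered_len: assumes "ob Y" shows "filtered (len Y) Y"
proof -
  have "Y \<in> {Y. \<exists>n. filtered n Y}"
    using generated[OF filtered_subcat[OF atom_X]] filtered_atom[OF atom_X] assms by fastforce
  then show ?thesis using len_eq by auto
qed

lemma len_iso: "isomorphic V Y Y' \<Longrightarrow> len Y = len Y'"
  unfolding len_def using filtered_iso by simp

lemma len_So: "ob Y \<Longrightarrow> len (So Y) = len Y"
  using len_eq[OF filtered_So[OF filtered_len]] .

lemma len_0_iff: "ob Y \<Longrightarrow> len Y = 0 \<longleftrightarrow> Y \<in> S"
  using filtered_len[of Y] len_eq[of 0 Y] by (metis filtered_0_iff)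

lemma len_biprod: assumes b: "is_biprod K A B Y i j p r" shows "len Y = len A + len B"
proof -
  note D = biprodD[OF b]
  obtain N0 where z: "zero_obj K N0" by (rule zero_obj_exists)
  have "factors (nul B (So A))" unfolding factors_def using D sub_zero[OF z] zero_obj_ob[OF z]
    by (intro exI[of _ N0] exI[of _ "nul B N0"] exI[of _ "nul N0 (So A)"]) simp
  then have "filtered (len A + len B) Y" using filtered_add[OF filtered_len filtered_len biprod_tri[OF b]] D by blast
  then show ?thesis by (rule len_eq)
qed

lemma len_tri:
  assumes t: "tri A B Z f g h" shows "len Z \<le> len A + len B" "even (len A + len B + len Z)"
  using filtered_cone[OF filtered_len filtered_len t] triD(10,11)[OF t] len_eq by blast+

text \<open>The rank of a morphism is forced by the ranks of objects, see \<open>rank_tri\<close>.\<close>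
definition lrank :: "'b \<Rightarrow> real" where
  "lrank f = (if arr f then (real (len (dm f)) + real (len (cd f)) -
     real (len (SOME Z. \<exists>g h. tri (dm f) (cd f) Z f g h))) / 2 else 0)"

lemma lrank_tri: assumes t: "tri A B Z f g h" shows "lrank f = (real (len A) + real (len B) - real (len Z)) / 2"
proof -
  note D = triD[OF t]
  define Z' where "Z' = (SOME Z. \<exists>g h. tri A B Z f g h)"
  have "\<exists>Z g h. tri A B Z f g h" using t by blast
  then have "\<exists>g h. tri A B Z' f g h" unfolding Z'_def by (rule someI_ex)
  then obtain g' h' where t': "tri A B Z' f g' h'" by blast
  obtain c where "iso_mor K c" "dm c = Z" "cd c = Z'" using cone_unique[OF t t'] by metis
  then have "len Z = len Z'" using len_iso q_isomorphic isomorphicI by metis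
  then show ?thesis unfolding lrank_def using D Z'_def by simp
qed

lemma lrank_one: assumes "ob Y" shows "lrank (one Y) = real (len Y)"
proof -
  obtain N0 where z: "zero_obj K N0" by (rule zero_obj_exists)
  have "len N0 = 0" using len_0_iff[OF zero_obj_ob[OF z]] sub_zero[OF z] by simp
  then show ?thesis using lrank_tri[OF tri_id[OF assms z]] by simp
qed

text \<open>Nonnegativity is the bound on the length of a cone, additivity rests on
  \<open>biprod_cone\<close>, and in the identity of a triangle the lengths of the two outer objects
  cancel.\<close>

lemma lrank_rank_fun: "rank_fun K lrank"
  unfolding rank_fun_def
proof (intro conjI ballI allI impI)
  show "0 \<le> lrank f" if f: "f \<in> t_mor K" for f
  proof -
    obtain Z g h where t: "tri (dm f) (cd f) Z f g h" using tri_exists[OF f] .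
    have "real (len Z) \<le> real (len (dm f)) + real (len (cd f))" using len_tri(1)[OF t] by linarith
    then show ?thesis unfolding lrank_tri[OF t] by simp
  qed
  show "lrank (Sh f) = lrank f" if f: "f \<in> t_mor K" for f
  proof -
    obtain Z g h where t: "tri (dm f) (cd f) Z f g h" using tri_exists[OF f] .
    show ?thesis unfolding lrank_tri[OF t] lrank_tri[OF tri_Sh[OF t]]
      using len_So triD(10-12)[OF t] by simp
  qed
  show "lrank (j1 \<cdot> f \<cdot> p1 \<oplus> j2 \<cdot> g \<cdot> p2) = lrank f + lrank g"
    if b: "is_biprod K A B Y i1 i2 p1 p2" and b': "is_biprod K A' B' Y' j1 j2 q1 q2"
      and fg: "f \<in> hom K A A'" "g \<in> hom K B B'" for A B Y i1 i2 p1 p2 A' B' Y' j1 j2 q1 q2 f g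
  proof -
    note D = biprodD[OF b] biprodD[OF b']
    have ft: "arr f" "dm f = A" "cd f = A'" and gt: "arr g" "dm g = B" "cd g = B'" using fg by (simp_all add: hom_iff)
    obtain Z1 g1 h1 where t1: "tri A A' Z1 f g1 h1" using tri_exists[OF ft(1)] ft by metis
    obtain Z2 g2 h2 where t2: "tri B B' Z2 g g2 h2" using tri_exists[OF gt(1)] gt by metis
    obtain Z k1 k2 r1 r2 where bZ: "is_biprod K Z1 Z2 Z k1 k2 r1 r2" by (rule biprod_exists[OF triD(12)[OF t1] triD(12)[OF t2]])
    define \<phi> where "\<phi> = j1 \<cdot> f \<cdot> p1 \<oplus> j2 \<cdot> g \<cdot> p2"
    have ph: "arr \<phi>" "dm \<phi> = Y" "cd \<phi> = Y'" using D ft gt by (simp_all add: \<phi>_def)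
    obtain Z' g' h' where t: "tri Y Y' Z' \<phi> g' h'" using tri_exists[OF ph(1)] ph by metis
    have "isomorphic K Z Z'" by (rule biprod_cone[OF t1 t2 b b' bZ t[unfolded \<phi>_def]])
    then have "len Z' = len Z1 + len Z2" using len_iso[OF q_isomorphic] len_biprod[OF bZ] by metis
    then show ?thesis unfolding \<phi>_def[symmetric] lrank_tri[OF t] lrank_tri[OF t1] lrank_tri[OF t2]
      len_biprod[OF b] len_biprod[OF b'] by (simp add: field_simps)
  qed
  show "lrank f + lrank g = lrank (one (cd f))" if "(f, g, h) \<in> t_tri K" for f g h
  proof -
    note t = triI[OF that]
    note D = triD[OF t]
    show ?thesis unfolding lrank_tri[OF t] lrank_tri[OF tri_rot[OF t]] lrank_one[OF D(11)] len_So[OF D(10)]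
      by (simp add: field_simps)
  qed
qed

text \<open>The parity statement of \<open>filtered_cone\<close> makes the numerator of
  \<open>lrank\<close> even.\<close>

lemma lrank_integral: assumes "arr f" shows "lrank f \<in> \<int>"
proof -
  obtain Z g h where t: "tri (dm f) (cd f) Z f g h" using tri_exists[OF assms] .
  have "even (int (len (dm f)) + int (len (cd f)) - int (len Z))" using len_tri(2)[OF t] by presburger
  then obtain k where "int (len (dm f)) + int (len (cd f)) - int (len Z) = 2 * k" by (rule evenE)
  then have "real (len (dm f)) + real (len (cd f)) - real (len Z) = 2 * of_int k" by linarith
  then show ?thesis unfolding lrank_tri[OF t] by simp
qed

text \<open>Rank zero says that the cone has the largest possible length, which is the case of
  \<open>filtered_extremal\<close>.\<close>

lemma lrank_0_factors: assumes "arr f" "lrank f = 0" shows "factors f"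
proof -
  obtain Z g h where t: "tri (dm f) (cd f) Z f g h" using tri_exists[OF assms(1)] .
  note D = triD[OF t]
  have "real (len Z) = real (len (dm f)) + real (len (cd f))" using assms(2) unfolding lrank_tri[OF t] by simp
  then have "len Z = len (dm f) + len (cd f)" by linarith
  then show ?thesis using filtered_extremal[OF filtered_len[OF D(10)] filtered_len[OF D(11)] t] filtered_len[OF D(12)] by simp
qed

text \<open>\<open>X\<close> generates only modulo \<open>S\<close>. But a generator of \<open>K\<close> is built from \<open>X\<close> and finitely many
  objects of \<open>S\<close>, so adding their sum \<open>T\<close> to \<open>X\<close> gives a generator, still of rank one.\<close>
lemma lrank_prime: assumes "\<exists>G. generator K G" shows "\<exists>G. generator K G \<and> lrank (one G) = 1"
proof -
  obtain G0 where G0: "generator K G0" using assms by blast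
  have oX: "ob X" using atom_X by (simp add: atom_def)
  \<comment> \<open>Objects in the thick hull of \<open>X\<close> together with one object of
    \<open>S\<close>, the hull being replaced by a quantifier over thick \<open>P\<close>. Two such
    objects of \<open>S\<close> are merged into their sum, since thick subcategories contain the
    summands.\<close>
  define H where "H = {Y. ob Y \<and> (\<exists>T\<in>S. \<forall>P. thick K P \<longrightarrow> X \<in> P \<longrightarrow> T \<in> P \<longrightarrow> Y \<in> P)}"
  have SH: "S \<subseteq> H" unfolding H_def using sub_ob by blast
  have XH: "X \<in> H"
  proof -
    obtain N0 where z: "zero_obj K N0" by (rule zero_obj_exists)
    show ?thesis unfolding H_def using oX sub_zero[OF z] by blast
  qed
  have P: "thick_subcategory K P" if "thick K P" for P using that by unfold_locales
  have PS: "triangulated_subcategory K P" if "thick K P" for P using that by unfold_locales (simp add: thick_def)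
  have "tri_subcat K H"
  proof (rule tri_subcatI)
    show "H \<subseteq> t_ob K" unfolding H_def by blast
    show "H \<noteq> {}" using XH by blast
    show "Y' \<in> H" if Y: "Y \<in> H" "isomorphic K Y Y'" for Y Y'
    proof -
      have oY': "ob Y'" using isomorphicE[OF Y(2)] ob_cd by metis
      obtain T where T: "T \<in> S" "\<And>P. thick K P \<Longrightarrow> X \<in> P \<Longrightarrow> T \<in> P \<Longrightarrow> Y \<in> P" using Y(1) unfolding H_def by blast
      have "Y' \<in> P" if "thick K P" "X \<in> P" "T \<in> P" for P
        by (rule triangulated_subcategory.sub_iso[OF PS[OF that(1)] T(2)[OF that] Y(2)])
      then show ?thesis unfolding H_def using oY' T(1) by blast
    qed
    show "So Y \<in> H \<longleftrightarrow> Y \<in> H" if "ob Y" for Y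
    proof -
      have "thick K P \<Longrightarrow> So Y \<in> P \<longleftrightarrow> Y \<in> P" for P
        by (rule triangulated_subcategory.sub_So[OF PS that])
      then show ?thesis unfolding H_def using that by auto
    qed
    fix A B Z f g h assume t: "tri A B Z f g h" and A: "A \<in> H" and B: "B \<in> H"
    obtain T1 where T1: "T1 \<in> S" "\<And>P. thick K P \<Longrightarrow> X \<in> P \<Longrightarrow> T1 \<in> P \<Longrightarrow> A \<in> P" using A unfolding H_def by blast
    obtain T2 where T2: "T2 \<in> S" "\<And>P. thick K P \<Longrightarrow> X \<in> P \<Longrightarrow> T2 \<in> P \<Longrightarrow> B \<in> P" using B unfolding H_def by blast
    obtain T i j p r where b: "is_biprod K T1 T2 T i j p r" using biprod_exists[OF sub_ob[OF T1(1)] sub_ob[OF T2(1)]] .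
    have "Z \<in> P" if th: "thick K P" and "X \<in> P" "T \<in> P" for P
    proof -
      have "T1 \<in> P" "T2 \<in> P" using thick_subcategory.sub_summand[OF P[OF th] b] \<open>T \<in> P\<close> by blast+
      then show ?thesis using triangulated_subcategory.sub_tri(1)[OF PS[OF th] t] T1(2) T2(2) th \<open>X \<in> P\<close> by blast
    qed
    then show "Z \<in> H" unfolding H_def using sub_biprod[OF b T1(1) T2(1)] triD(12)[OF t] by blast
  qed
  then have "H = t_ob V" using generated V_subcat_iff SH XH by blast
  then have "G0 \<in> H" using G0 by (simp add: generator_def)
  then obtain T where T: "T \<in> S" "\<And>P. thick K P \<Longrightarrow> X \<in> P \<Longrightarrow> T \<in> P \<Longrightarrow> G0 \<in> P" unfolding H_def by blast
  obtain G i j p r where b: "is_biprod K X T G i j p r" using biprod_exists[OF oX sub_ob[OF T(1)]] .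
  have "generator K G"
    unfolding generator_def
  proof (intro conjI allI impI)
    show "ob G" using biprodD(3)[OF b] .
    fix P assume a: "thick K P \<and> G \<in> P"
    then have "X \<in> P" "T \<in> P" using thick_subcategory.sub_summand[OF P b] by blast+
    then show "P = t_ob K" using T(2) a G0 unfolding generator_def by blast
  qed
  moreover have "len G = 1"
    using len_biprod[OF b] len_eq[OF filtered_atom[OF atom_X]] len_0_iff[OF sub_ob[OF T(1)]] T(1) by simp
  ultimately show ?thesis using lrank_one[OF biprodD(3)[OF b]] by auto
qed

lemma lrank_loc_prime:
  assumes "\<exists>G. generator K G"
  shows "lrank \<in> loc_prime_ranks K" "{Y \<in> t_ob K. lrank (one Y) = 0} = S"
proof -
  have int: "integral_rank K lrank" unfolding integral_rank_def using lrank_rank_fun lrank_integral by blast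
  have zero: "lrank (one Z) = 0 \<longleftrightarrow> Z \<in> S" if "ob Z" for Z using lrank_one[OF that] len_0_iff[OF that] by simp
  have "\<exists>Z\<in>t_ob K. lrank (one Z) = 0 \<and> (\<exists>u\<in>hom K (dm f) Z. \<exists>v\<in>hom K Z (cd f). f = v \<cdot> u)"
    if f: "f \<in> t_mor K" "lrank f = 0" for f
  proof -
    obtain Z u v where *: "Z \<in> S" "arr u" "arr v" "cd u = Z" "dm v = Z" "f = v \<cdot> u"
      using lrank_0_factors[OF f] unfolding factors_def by blast
    then show ?thesis using zero[of Z] sub_ob[of Z]
      by (intro bexI[of _ Z] conjI bexI[of _ u] bexI[of _ v]) (simp_all add: hom_iff)
  qed
  then have "localizing_rank K lrank" unfolding localizing_rank_def using int by blast
  moreover have "prime_rank K lrank" unfolding prime_rank_def using int lrank_prime[OF assms] by blast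
  \<comment> \<open>The default value of \<open>lrank\<close> matches the normalisation in
    \<open>loc_prime_ranks\<close>.\<close>
  moreover have "\<forall>f. f \<notin> t_mor K \<longrightarrow> lrank f = 0" by (simp add: lrank_def)
  ultimately show "lrank \<in> loc_prime_ranks K" unfolding loc_prime_ranks_def by blast
  show "{Y \<in> t_ob K. lrank (one Y) = 0} = S" using zero sub_ob by blast
qed

end

section \<open>The kernel map as a bijection\<close>

context triangulated_category begin

lemma loc_prime_ranks_kernel:
  assumes "\<rho> \<in> loc_prime_ranks K"
  obtains X where "localizing_prime K {Y \<in> t_ob K. \<rho> (one Y) = 0} \<rho> X"
proof -
  have r: "rank_fun K \<rho>" and int: "\<And>f. arr f \<Longrightarrow> \<rho> f \<in> \<int>"
    using assms by (auto simp: loc_prime_ranks_def prime_rank_def integral_rank_def)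
  obtain X where X: "generator K X" "\<rho> (one X) = 1"
    using assms unfolding loc_prime_ranks_def prime_rank_def by blast
  interpret rank_function K \<rho> using r by unfold_locales
  let ?S = "{Y \<in> t_ob K. \<rho> (one Y) = 0}"
  interpret thick_subcategory K ?S using thick_kernel by unfold_locales
  have "localizing_prime K ?S \<rho> X"
  proof unfold_locales
    show "factors f" if f: "arr f" "\<rho> f = 0" for f
    proof -
      have "\<exists>Z\<in>t_ob K. \<rho> (one Z) = 0 \<and> (\<exists>u\<in>hom K (dm f) Z. \<exists>v\<in>hom K Z (cd f). f = v \<cdot> u)"
        using assms f unfolding loc_prime_ranks_def localizing_rank_def by blast
      then obtain Z u v where "Z \<in> ?S" "u \<in> hom K (dm f) Z" "v \<in> hom K Z (cd f)" "f = v \<cdot> u" by blast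
      then show ?thesis unfolding factors_def hom_iff by blast
    qed
  qed (use int X in auto)
  then show ?thesis by (rule that)
qed

end

theorem theorem6p4:
  fixes C :: "('o, 'm) tricat"
  assumes "triangulated C"
    and "\<exists>X. generator C X"
  shows "\<exists>F. bij_betw F (loc_prime_ranks C) {\<tau>. thick C \<tau> \<and> simple_tricat (verdier C \<tau>)}"
proof -
  interpret triangulated_category C using assms(1) by unfold_locales (simp_all add: triangulated_def)
  define F where "F = (\<lambda>\<rho>. {X \<in> t_ob C. \<rho> (t_id C X) = (0::real)})"
  have "inj_on F (loc_prime_ranks C)"
  proof (rule inj_onI)
    fix \<rho> \<rho>' assume r: "\<rho> \<in> loc_prime_ranks C" "\<rho>' \<in> loc_prime_ranks C" and eq: "F \<rho> = F \<rho>'"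
    obtain X where X: "localizing_prime C (F \<rho>) \<rho> X" using loc_prime_ranks_kernel[OF r(1)] unfolding F_def .
    obtain X' where X': "localizing_prime C (F \<rho>) \<rho>' X'" using loc_prime_ranks_kernel[OF r(2)] unfolding eq unfolding F_def .
    have "\<rho>' f = \<rho> f" for f
    proof (cases "f \<in> t_mor C")
      case True then show ?thesis by (rule localizing_prime.rank_unique[OF X X'])
    next
      case False then show ?thesis using r by (simp add: loc_prime_ranks_def)
    qed
    then show "\<rho> = \<rho>'" by auto
  qed
  moreover have "F ` loc_prime_ranks C = {\<tau>. thick C \<tau> \<and> simple_tricat (verdier C \<tau>)}"
  proof (intro equalityI subsetI)
    fix \<tau> assume "\<tau> \<in> F ` loc_prime_ranks C"
    then obtain \<rho> where r: "\<rho> \<in> loc_prime_ranks C" "\<tau> = F \<rho>" by blast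
    obtain X where "localizing_prime C \<tau> \<rho> X" using loc_prime_ranks_kernel[OF r(1)] unfolding r(2) F_def .
    then interpret localizing_prime C \<tau> \<rho> X .
    show "\<tau> \<in> {\<tau>. thick C \<tau> \<and> simple_tricat (verdier C \<tau>)}" using thk V_simple by blast
  next
    fix \<tau> assume "\<tau> \<in> {\<tau>. thick C \<tau> \<and> simple_tricat (verdier C \<tau>)}"
    then have t: "thick C \<tau>" and s: "simple_tricat (verdier C \<tau>)" by blast+
    interpret thick_subcategory C \<tau> using t by unfold_locales
    obtain X where X: "indecomposable V X" "\<And>T. tri_subcat V T \<Longrightarrow> X \<in> T \<Longrightarrow> T = t_ob V"
      using s unfolding simple_tricat_def by blast
    have "split_tri V T" if "T \<in> t_tri V" for T using s that unfolding simple_tricat_def by blast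
    then have aX: "atom X" by (rule indecomposable_atom[OF _ X(1)])
    interpret simple_quotient C \<tau> X by unfold_locales (fact aX, fact X(2))
    have "\<tau> = F lrank" unfolding F_def by (rule lrank_loc_prime(2)[OF assms(2), symmetric])
    then show "\<tau> \<in> F ` loc_prime_ranks C" using lrank_loc_prime(1)[OF assms(2)] by blast
  qed
  ultimately show ?thesis unfolding bij_betw_def by blast
qed

end
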